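(* Let $m,n\ge1$ and let $A\in\mathbb R^{m\times n}$ satisfy $\sum_{i=1}^m A_{ij}^2\le1$ for every $j$. Let $b\in[-1,1]^n$, and let $q$ be the number of fractional coordinates of $b$ (those with $|b_j|<1$). For every real $R\ge0$ there is $y\in[-1,1]^n$ such that $y_j=b_j$ whenever $|b_j|=1$, at most $$N_R(q):=\max\{\lceil qe^{-R}\rceil-1,\,8\}$$ coordinates of $y$ are fractional, and $$\|A(y-b)\|_\infty\le2395(1+R)^{1/4}.$$ If $q\le8$, one may take $y=b$. If $q>8$, such a $y$ is attained by a finite construction at a positive mesh, using a feasible covariance and a finite direction law at each step. That is, after restricting $A$ and $b$ to the $q$ fractional coordinates of $b$, there are a mesh $\gamma>0$ and a finite trajectory (as defined in the context) of states starting from the initial state at $b$ whose last point $x$ has at most $N_R(q)$ alive coordinates, and $y$ is obtained from $x$ by replacing each non-alive coordinate by its sign, leaving the alive coordinates unchanged, and restoring the original signs $b_j$ at the coordinates with $|b_j|=1$.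
   Context: A coordinate of a point of $[-1,1]^n$ is fractional when its absolute value is strictly less than one. Construction (for $q>8$). Work with the restriction of $A$ to the fractional columns of $b$, so $A\in\mathbb R^{m\times q}$ with rows $a_1,\dots,a_m$ and $b\in(-1,1)^q$. Parameters for $k\ge0$: $s_k=\frac{60}{7}2^{-k}$, $M=\frac{60}7$, $w_0=\frac{17}{140}$, $w_k=\frac{123}{1190}(\frac{15}{17})^{k-1}$ for $k\ge1$, $\delta_k=\frac{43}{80}w_k$, $L_k=\log\frac{32}{\delta_ks_k}$, $$B_k=\Big(\tfrac{1925648}{675}\tfrac{s_kL_k(L_k+R)}{\delta_k}\Big)^{1/4}+\sqrt{\tfrac{244}{9}s_kL_k},\qquad \lambda_k=L_k/B_k,\quad \beta_k=\frac{B_k}{2s_k}.$$ Fix an integer $K$ with $s_{K+1}\le1/q$ (e.g. $K=q+3$); the classes are $0,\dots,K$. For a mesh $0<\gamma<\min\{1/2,\min_j(1-|b(j)|)\}$ and a point $x\in[-1,1]^q$, the alive set is $V(x)=\{j:|x(j)|<1-\gamma\}$, and $r_x(c)=\sum_{j\in V(x)}c(j)^2$. Normalization at a point $u$ of a vector $v$ supported on $V(u)$ with $\|v\|_2^2\le s_p$, starting at class $p\in\{0,\dots,K+1\}$: set $k=p$. While $k\le K$: if $\|v\|_2^2\le s_{k+1}$, increase $k$ by one; otherwise let $T=\{j:|v(j)|>s_k/B_k\}$, store the peeled vector $v\mathbf 1_T$ (class $k$, anchor $u$), and replace $v$ by $v-v\mathbf 1_T$; if now $\|v\|_2^2>s_{k+1}$,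 stop and output $v$ as an active restriction of class $k$ with birth point $u$; otherwise increase $k$ by one. If $k=K+1$ is reached, output $v$ as a terminal residual with anchor $u$. A state consists of a point $x\in[-1,1]^q$; for every original row a status large, active (with one current active restriction, given by its class $k$, coefficient vector $c$ and birth point $u$), or terminal; and, for every restriction $(k,c,u)$ ever born and each sign $\varepsilon\in\{-1,1\}$, a signed record with status live, dangerous or retired and a number $X\in(0,e^{L_k}]$. For such a record put $$Z_c^\varepsilon(x)=\varepsilon\langle c,x-u\rangle+\beta_k\sum_jc(j)^2(u(j)^2-x(j)^2),\qquad e_c^\varepsilon(x)=\varepsilon c-2\beta_k(c^{\odot2}\odot x),$$ with coordinatewise square and product. Initial state at $b$: a row is large if $r_b(a_i)>M$; every other row is normalized at $b$ starting at class $0$; every signed record of a birth is live with $X=1$. Feasible covariance at a state with $V=V(x)$, $h=|V|$: a nonzero positive-semidefinite $U$, supported on $V\times V$, with $Uw=0$ for $w$ equal to $a_i\mathbf 1_V$ for each large row, $e_c^\varepsilon(x)\mathbf 1_V$ for each dangerous signed record, and $x\mathbf 1_V$; with $U(j,j)\le1$, $\operatorname{Tr}U\ge h/65536$, $U\preceq\frac{61}{18}\operatorname{diag}U$; and, for every $0\le k\le K$, $E_kUE_k^{\mathsf T}\preceq\frac{1973}{100s_k}\operatorname{diag}(E_kUE_k^{\mathsf T})$, where the rows of $E_k$ are the vectors $e_c^{\varepsilon}(x)\mathbf 1_V$, $\varepsilon=\pm1$, over the currently active restrictions of class $k$. ($\operatorname{diag}$ of a matrix is the diagonal matrix with the same diagonal.)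 A direction law for $U$ is a finitely supported, centrally symmetric probability law on unit vectors in the range of $U$ with covariance $U/\operatorname{Tr}U$. Complete successor along a positive-probability atom $v$: put $x^+=x+\gamma v$, $V^+=V(x^+)$. Each old live record is updated to $X^+=\min\{e^{L_k},Xe^{\lambda_k(Z_c^\varepsilon(x^+)-Z_c^\varepsilon(x))}\}$; all other old records keep $X$. Every active restriction of class $k$ with $r_{x^+}(c)\le s_k/2$ retires (both of its signed records become retired, keeping their values of $X$). For the restrictions that remain active, every old live record with $Z_c^\varepsilon(x^+)\ge B_k$ becomes dangerous; dangerous records stay dangerous until retirement. Then, for each retired restriction of class $k$, its surviving part $c\mathbf 1_{V^+}$ is normalized at $x^+$ starting at class $k+1$, and each large row with $r_{x^+}(a_i)\le M$ has $a_i\mathbf 1_{V^+}$ normalized at $x^+$ starting at class $0$; new births get two live signed records with $X=1$. A trajectory is a finite sequence of states beginning with the initial state at $b$, each later state being a complete successor of the preceding one along a positive-probability atom of a direction law of a feasible covariance at the preceding state. *)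

theory Defs
  imports "HOL-Analysis.Analysis" "HOL-Probability.Probability"
begin

text \<open>
  The restriction of the problem to the set \<open>J\<close> of fractional columns takes place in
  \<open>\<real>\<^sup>J\<close>, which is identified with the subspace of those \<open>v :: real ^ 'n\<close> that vanish
  outside \<open>J\<close>.  Note that \<open>0\<close> counts as a small entry, so alive sets have to be cut
  down to \<open>J\<close> explicitly.
\<close>

definition restrict_to :: "'n set \<Rightarrow> real ^ 'n \<Rightarrow> real ^ 'n::finite" where
  "restrict_to S v = (\<chi> j. if j \<in> S then v $ j else 0)"

definition fractional :: "real ^ 'n::finite \<Rightarrow> 'n set" where
  "fractional y = {j. \<bar>y $ j\<bar> < 1}"

definition N_bound :: "real \<Rightarrow> nat \<Rightarrow> int" where
  "N_bound R q = max (\<lceil>real q * exp (- R)\<rceil> - 1) 8"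

definition good_rounding ::
    "real ^ 'n ^ 'm \<Rightarrow> real ^ 'n \<Rightarrow> real \<Rightarrow> real ^ 'n::finite \<Rightarrow> bool" where
  "good_rounding A b R y \<longleftrightarrow>
     (\<forall>j. \<bar>y $ j\<bar> \<le> 1) \<and>
     (\<forall>j. \<bar>b $ j\<bar> = 1 \<longrightarrow> y $ j = b $ j) \<and>
     int (card (fractional y)) \<le> N_bound R (card (fractional b)) \<and>
     infnorm (A *v (y - b)) \<le> 2395 * (1 + R) powr (1/4)"

definition s_par :: "nat \<Rightarrow> real" where
  "s_par k = 60/7 * (1/2) ^ k"

definition M_par :: real where
  "M_par = 60/7"

definition w_par :: "nat \<Rightarrow> real" where
  "w_par k = (if k = 0 then 17/140 else 123/1190 * (15/17) ^ (k - 1))"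

definition delta_par :: "nat \<Rightarrow> real" where
  "delta_par k = 43/80 * w_par k"

definition L_par :: "nat \<Rightarrow> real" where
  "L_par k = ln (32 / (delta_par k * s_par k))"

definition B_par :: "real \<Rightarrow> nat \<Rightarrow> real" where
  "B_par R k =
     (1925648/675 * (s_par k * L_par k * (L_par k + R) / delta_par k)) powr (1/4)
     + sqrt (244/9 * s_par k * L_par k)"

definition lambda_par :: "real \<Rightarrow> nat \<Rightarrow> real" where
  "lambda_par R k = L_par k / B_par R k"

definition beta_par :: "real \<Rightarrow> nat \<Rightarrow> real" where
  "beta_par R k = B_par R k / (2 * s_par k)"

definition alive :: "'n set \<Rightarrow> real \<Rightarrow> real ^ 'n::finite \<Rightarrow> 'n set" where
  "alive J \<gamma> x = {j \<in> J. \<bar>x $ j\<bar> < 1 - \<gamma>}"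

definition alive_energy :: "'n set \<Rightarrow> real \<Rightarrow> real ^ 'n \<Rightarrow> real ^ 'n::finite \<Rightarrow> real" where
  "alive_energy J \<gamma> x c = (\<Sum>j \<in> alive J \<gamma> x. (c $ j)\<^sup>2)"

text \<open>
  A piece is a coefficient vector with its class and its anchor.  Pieces represent both
  the restrictions (whose anchor is the birth point) and the stored peeled vectors.
\<close>

datatype ('n::finite) piece =
  Piece (cls: nat) (coef: "real ^ 'n") (anchor: "real ^ 'n")

datatype ('n::finite) row_status =
  Large | Active "'n piece" | Terminal "real ^ 'n" "real ^ 'n"

datatype rec_status = Live | Dangerous | Retired

datatype signed_record = SRec (rstat: rec_status) (rval: real)

definition sign_of :: "bool \<Rightarrow> real" where
  "sign_of \<epsilon> = (if \<epsilon> then 1 else - 1)"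

text \<open>
  \<open>recs S i p \<epsilon>\<close> is the record of sign \<open>sign_of \<epsilon>\<close> of the restriction \<open>p\<close> of row \<open>i\<close>; it is
  \<open>None\<close> if \<open>p\<close> has not been born from row \<open>i\<close>.  Equal restrictions that come from
  different (e.g. identical) rows are thus kept apart.  The arguments of \<open>Terminal\<close> are
  the residual and its anchor.  They and \<open>peeled\<close> only record the output of the
  normalizations and do not influence the evolution.
\<close>

record ('m, 'n::finite) state =
  point :: "real ^ 'n"
  rowst :: "'m \<Rightarrow> 'n row_status"
  recs :: "'m \<Rightarrow> 'n piece \<Rightarrow> bool \<Rightarrow> signed_record option"
  peeled :: "'m \<Rightarrow> 'n piece list"

definition Z_val :: "real \<Rightarrow> 'n piece \<Rightarrow> bool \<Rightarrow> real ^ 'n::finite \<Rightarrow> real" where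
  "Z_val R p \<epsilon> x =
     sign_of \<epsilon> * (coef p \<bullet> (x - anchor p))
     + beta_par R (cls p) *
       (\<Sum>j\<in>UNIV. (coef p $ j)\<^sup>2 * ((anchor p $ j)\<^sup>2 - (x $ j)\<^sup>2))"

definition e_vec :: "real \<Rightarrow> 'n piece \<Rightarrow> bool \<Rightarrow> real ^ 'n::finite \<Rightarrow> real ^ 'n" where
  "e_vec R p \<epsilon> x =
     (\<chi> j. sign_of \<epsilon> * coef p $ j - 2 * beta_par R (cls p) * ((coef p $ j)\<^sup>2 * x $ j))"

text \<open>
  \<open>normalize R K u k v\<close> normalizes \<open>v\<close> at \<open>u\<close> starting at class \<open>k\<close>; the result consists of
  the stored peeled vectors and the resulting status (\<open>Active\<close> or \<open>Terminal\<close>) of the row.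
\<close>

function normalize ::
    "real \<Rightarrow> nat \<Rightarrow> real ^ 'n \<Rightarrow> nat \<Rightarrow> real ^ 'n::finite \<Rightarrow> 'n piece list \<times> 'n row_status"
where
  "normalize R K u k v =
    (if K < k then ([], Terminal v u)
     else if (norm v)\<^sup>2 \<le> s_par (Suc k) then normalize R K u (Suc k) v
     else
       let t = restrict_to {j. \<bar>v $ j\<bar> > s_par k / B_par R k} v;
           v' = v - t
       in if (norm v')\<^sup>2 > s_par (Suc k) then ([Piece k t u], Active (Piece k v' u))
          else (case normalize R K u (Suc k) v' of
                  (ps, st) \<Rightarrow> (Piece k t u # ps, st)))"
  by pat_completeness auto
termination
  by (relation "Wellfounded.measure (\<lambda>(R, K, u, k, v). Suc K - k)") auto

declare normalize.simps [simp del]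

definition pos_semidef :: "real ^ 'a ^ 'a::finite \<Rightarrow> bool" where
  "pos_semidef P \<longleftrightarrow> transpose P = P \<and> (\<forall>z. 0 \<le> z \<bullet> (P *v z))"

definition loewner_le :: "real ^ 'a ^ 'a \<Rightarrow> real ^ 'a ^ 'a::finite \<Rightarrow> bool" where
  "loewner_le P Q \<longleftrightarrow> pos_semidef (Q - P)"

definition diag_part :: "real ^ 'a ^ 'a \<Rightarrow> real ^ 'a ^ 'a::finite" where
  "diag_part P = (\<chi> i j. if i = j then P $ i $ j else 0)"

text \<open>
  The rows of \<open>E_mat \<dots> k\<close> are indexed by all pairs of an original row and a sign; the row
  vector is \<open>0\<close> if the original row has no active restriction of class \<open>k\<close>.  Such zero
  rows do not affect the Loewner inequality below.
\<close>

definition E_mat ::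
    "'n set \<Rightarrow> real \<Rightarrow> real \<Rightarrow> ('m::finite, 'n::finite) state \<Rightarrow> nat \<Rightarrow> real ^ 'n ^ ('m \<times> bool)" where
  "E_mat J R \<gamma> S k =
     (\<chi> r. case rowst S (fst r) of
         Active p \<Rightarrow>
           if cls p = k then restrict_to (alive J \<gamma> (point S)) (e_vec R p (snd r) (point S))
           else 0
       | _ \<Rightarrow> 0)"

definition feasible_covariance ::
    "'n set \<Rightarrow> real ^ 'n ^ 'm \<Rightarrow> real \<Rightarrow> nat \<Rightarrow> real \<Rightarrow> ('m::finite, 'n::finite) state
     \<Rightarrow> real ^ 'n ^ 'n \<Rightarrow> bool" where
  "feasible_covariance J a R K \<gamma> S U \<longleftrightarrow>
     (let x = point S; V = alive J \<gamma> x in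
       U \<noteq> 0 \<and> pos_semidef U \<and>
       (\<forall>i j. \<not> (i \<in> V \<and> j \<in> V) \<longrightarrow> U $ i $ j = 0) \<and>
       (\<forall>i. rowst S i = Large \<longrightarrow> U *v restrict_to V (a $ i) = 0) \<and>
       (\<forall>i p \<epsilon> X. recs S i p \<epsilon> = Some (SRec Dangerous X) \<longrightarrow>
          U *v restrict_to V (e_vec R p \<epsilon> x) = 0) \<and>
       U *v restrict_to V x = 0 \<and>
       (\<forall>j. U $ j $ j \<le> 1) \<and>
       trace U \<ge> real (card V) / 65536 \<and>
       loewner_le U ((61/18) *\<^sub>R diag_part U) \<and>
       (\<forall>k\<le>K. let E = E_mat J R \<gamma> S k; G = E ** U ** transpose E in
          loewner_le G ((1973 / (100 * s_par k)) *\<^sub>R diag_part G)))"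

definition covariance :: "(real ^ 'n::finite) pmf \<Rightarrow> real ^ 'n ^ 'n" where
  "covariance D =
     (\<chi> i j. measure_pmf.expectation D
        (\<lambda>v. (v $ i - measure_pmf.expectation D (\<lambda>v. v $ i)) *
             (v $ j - measure_pmf.expectation D (\<lambda>v. v $ j))))"

definition direction_law :: "real ^ 'n ^ 'n \<Rightarrow> (real ^ 'n::finite) pmf \<Rightarrow> bool" where
  "direction_law U D \<longleftrightarrow>
     finite (set_pmf D) \<and>
     (\<forall>v. pmf D (- v) = pmf D v) \<and>
     (\<forall>v \<in> set_pmf D. norm v = 1 \<and> v \<in> range (\<lambda>z. U *v z)) \<and>
     covariance D = (1 / trace U) *\<^sub>R U"

definition born_records :: "'n::finite row_status \<Rightarrow> 'n piece \<Rightarrow> bool \<Rightarrow> signed_record option" where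
  "born_records st p \<epsilon> = (if st = Active p then Some (SRec Live 1) else None)"

definition initial_state ::
    "'n set \<Rightarrow> real ^ 'n ^ 'm \<Rightarrow> real ^ 'n \<Rightarrow> real \<Rightarrow> nat \<Rightarrow> real
     \<Rightarrow> ('m::finite, 'n::finite) state" where
  "initial_state J a b R K \<gamma> =
     (let out = (\<lambda>i. if alive_energy J \<gamma> b (a $ i) > M_par then ([], Large)
                     else normalize R K b 0 (a $ i))
      in \<lparr>point = b,
          rowst = (\<lambda>i. snd (out i)),
          recs = (\<lambda>i. born_records (snd (out i))),
          peeled = (\<lambda>i. fst (out i))\<rparr>)"

definition retires :: "'n set \<Rightarrow> real \<Rightarrow> real ^ 'n \<Rightarrow> 'n::finite piece \<Rightarrow> bool" where
  "retires J \<gamma> x' p \<longleftrightarrow> alive_energy J \<gamma> x' (coef p) \<le> s_par (cls p) / 2"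

text \<open>
  The update of an existing record of the restriction \<open>p\<close>, where \<open>act\<close> tells whether \<open>p\<close> is
  active in the old state.  The value is updated before a retirement and then kept.
\<close>

definition update_record ::
    "'n set \<Rightarrow> real \<Rightarrow> real \<Rightarrow> real ^ 'n \<Rightarrow> real ^ 'n \<Rightarrow> bool \<Rightarrow> 'n::finite piece \<Rightarrow> bool
     \<Rightarrow> signed_record \<Rightarrow> signed_record" where
  "update_record J R \<gamma> x x' act p \<epsilon> r =
     SRec
       (if act \<and> retires J \<gamma> x' p then Retired
        else if act \<and> rstat r = Live \<and> Z_val R p \<epsilon> x' \<ge> B_par R (cls p) then Dangerous
        else rstat r)
       (if rstat r = Live
        then min (exp (L_par (cls p)))
               (rval r * exp (lambda_par R (cls p) * (Z_val R p \<epsilon> x' - Z_val R p \<epsilon> x)))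
        else rval r)"

text \<open>
  The starting class and the vector of row \<open>i\<close> that have to be normalized at the new
  point \<open>x'\<close>, if any.
\<close>

definition to_normalize ::
    "'n set \<Rightarrow> real ^ 'n ^ 'm \<Rightarrow> real \<Rightarrow> ('m::finite, 'n::finite) state \<Rightarrow> real ^ 'n \<Rightarrow> 'm
     \<Rightarrow> (nat \<times> (real ^ 'n)) option" where
  "to_normalize J a \<gamma> S x' i =
     (case rowst S i of
        Large \<Rightarrow>
          if alive_energy J \<gamma> x' (a $ i) \<le> M_par
          then Some (0, restrict_to (alive J \<gamma> x') (a $ i)) else None
      | Active p \<Rightarrow>
          if retires J \<gamma> x' p
          then Some (Suc (cls p), restrict_to (alive J \<gamma> x') (coef p)) else None
      | Terminal _ _ \<Rightarrow> None)"

definition successor ::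
    "'n set \<Rightarrow> real ^ 'n ^ 'm \<Rightarrow> real \<Rightarrow> nat \<Rightarrow> real \<Rightarrow> ('m::finite, 'n::finite) state \<Rightarrow> real ^ 'n
     \<Rightarrow> ('m, 'n) state" where
  "successor J a R K \<gamma> S v =
     (let x = point S;
          x' = x + \<gamma> *\<^sub>R v;
          out = (\<lambda>i. map_option (\<lambda>(k, z). normalize R K x' k z) (to_normalize J a \<gamma> S x' i));
          old = (\<lambda>i p \<epsilon>. map_option (update_record J R \<gamma> x x' (rowst S i = Active p) p \<epsilon>)
                            (recs S i p \<epsilon>))
      in \<lparr>point = x',
          rowst = (\<lambda>i. case out i of None \<Rightarrow> rowst S i | Some (_, st) \<Rightarrow> st),
          recs = (\<lambda>i p \<epsilon>. case out i of
                     None \<Rightarrow> old i p \<epsilon>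
                   | Some (_, st) \<Rightarrow>
                       (case born_records st p \<epsilon> of None \<Rightarrow> old i p \<epsilon> | Some r \<Rightarrow> Some r)),
          peeled = (\<lambda>i. peeled S i @ (case out i of None \<Rightarrow> [] | Some (ps, _) \<Rightarrow> ps))\<rparr>)"

definition complete_successor ::
    "'n set \<Rightarrow> real ^ 'n ^ 'm \<Rightarrow> real \<Rightarrow> nat \<Rightarrow> real \<Rightarrow> ('m::finite, 'n::finite) state
     \<Rightarrow> ('m, 'n) state \<Rightarrow> bool" where
  "complete_successor J a R K \<gamma> S S' \<longleftrightarrow>
     (\<exists>U D v. feasible_covariance J a R K \<gamma> S U \<and> direction_law U D \<and> v \<in> set_pmf D \<and>
        S' = successor J a R K \<gamma> S v)"

definition trajectory ::
    "'n set \<Rightarrow> real ^ 'n ^ 'm \<Rightarrow> real ^ 'n \<Rightarrow> real \<Rightarrow> nat \<Rightarrow> real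
     \<Rightarrow> ('m::finite, 'n::finite) state list \<Rightarrow> bool" where
  "trajectory J a b R K \<gamma> Ss \<longleftrightarrow>
     Ss \<noteq> [] \<and> hd Ss = initial_state J a b R K \<gamma> \<and>
     (\<forall>t. Suc t < length Ss \<longrightarrow> complete_successor J a R K \<gamma> (Ss ! t) (Ss ! Suc t))"

definition final_rounding ::
    "'n set \<Rightarrow> real ^ 'n \<Rightarrow> real \<Rightarrow> real ^ 'n::finite \<Rightarrow> real ^ 'n" where
  "final_rounding J b \<gamma> x =
     (\<chi> j. if j \<notin> J then b $ j else if j \<in> alive J \<gamma> x then x $ j else sgn (x $ j))"

end

theory Submission
  imports Defs
begin

text \<open>
  A stored or active vector of class \<open>k\<close> contributes \<open>O(B\<^sub>k)\<close> to the final discrepancy of its row,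
  because \<open>Z\<close> stays below about \<open>B\<^sub>k\<close> in both signs, and \<open>\<Sum>k. B\<^sub>k = O((1 + R)\<^bsup>1/4\<^esup>)\<close>.  What
  has to be shown is that a feasible covariance exists as long as more than \<open>N\<^sub>R(q)\<close> coordinates
  are alive.  By convex separation and a count of large eigenvalues this holds if at most
  \<open>\<delta>\<^sub>k h/2\<close> signed records of class \<open>k\<close> are dangerous, where \<open>h\<close> is the number of alive coordinates.

  To control the dangerous records, let \<open>\<ell>\<^sub>k\<^sub>j\<close> be the sum of \<open>X c(j)\<^sup>2\<close> over the signed records of
  class \<open>k\<close>, where rows that can still reach class \<open>k\<close> are charged in advance; initially
  \<open>\<ell>\<^sub>k\<^sub>j \<le> 2\<close>.  The peeling bound \<open>\<bar>c(j)\<bar> \<le> s\<^sub>k/B\<^sub>k\<close> makes every summand tiny, so, by the spectral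
  condition across rows, the variance of \<open>\<theta>\<^sub>k \<ell>\<^sub>k\<^sub>j\<close> is dominated by its negative drift for
  \<open>\<theta>\<^sub>k = (L\<^sub>k + R)/6\<close>; this is where the fourth power of \<open>B\<^sub>k\<close> comes from.  Hence
  \<open>\<Sum>k. exp (- L\<^sub>k) (\<Sum>j. exp (\<theta>\<^sub>k (\<ell>\<^sub>k\<^sub>j - 2)))\<close> over the alive \<open>j\<close> can be kept at most \<open>q \<le> h exp R\<close>.
  By convexity the average of \<open>\<ell>\<^sub>k\<^sub>j\<close> over the alive \<open>j\<close> is then at most 8, while a dangerous
  record alone contributes at least \<open>exp L\<^sub>k s\<^sub>k/2 = 16/\<delta>\<^sub>k\<close> to the sum.
\<close>

section \<open>Spectral decomposition\<close>

text \<open>No concentration over time is used. A direction law serves only to show that one of its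
  atoms does not increase the potential, and the walk follows that atom. It stops because
  \<open>U\<close> kills the current point: every step is orthogonal to the point and raises its
  squared norm by exactly \<open>\<gamma>\<^sup>2\<close>, while this norm stays at most
  \<open>q\<close>.

  The negative drift is the second-order term of \<open>Z\<close> itself: \<open>e_vec\<close> is
  the gradient of \<open>Z\<close>, and the compensator with coefficient \<beta> loses a multiple of
  the weighted squared step each time.

  The obstacle is that every dangerous record costs a whole dimension. As fractions of
  \<open>h\<close>, the dimensions spent are at most 43/160 for dangerous records, 18/61 for the
  diagonal bound on \<open>U\<close>, 400/1973 for the large rows together with the spectral bounds
  of all classes, and 1/9 for the current point; the sum is below 0.88. The last fraction needs
  \<open>h \<ge> 9\<close>, which is where the 8 in \<open>N_bound\<close> enters. The 6 in the
  exponent of the potential is 8 - 2, the gap between the average load that can be tolerated and the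
  initial load.\<close>

lemma linear_coeff_zero_of_quadratic_nonpos:
  fixes c d :: real
  assumes "\<And>t. 2 * t * c + t\<^sup>2 * d \<le> 0"
  shows "c = 0"
proof -
  \<comment> \<open>The witness \<open>t = c / D\<close> is short enough, as
    \<open>2 * D + d > 0\<close>, for the linear term to dominate the quadratic one.\<close>
  define D where "D = \<bar>d\<bar> + 1"
  have D: "D > 0" "2 * D + d > 0" by (auto simp: D_def)
  have "2 * (c / D) * c + (c / D)\<^sup>2 * d = c\<^sup>2 * (2 * D + d) / D\<^sup>2"
    using D by (simp add: field_simps power2_eq_square)
  with assms[of "c / D"] have "c\<^sup>2 * (2 * D + d) / D\<^sup>2 \<le> 0" by simp
  with D have "c\<^sup>2 * (2 * D + d) \<le> 0"
    by (metis divide_pos_pos not_le zero_less_power)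
  with D show ?thesis by (simp add: mult_le_0_iff)
qed

lemma inner_symmetric_matrix:
  fixes Q :: "real ^ 'a ^ 'a::finite"
  assumes "transpose Q = Q"
  shows "x \<bullet> (Q *v y) = (Q *v x) \<bullet> y"
  by (metis assms dot_lmul_matrix transpose_matrix_vector)

lemma axis_inner_matrix [simp]:
  fixes U :: "real ^ 'b::finite ^ 'a::finite"
  shows "axis i 1 \<bullet> (U *v axis j 1) = U $ i $ j"
  by (simp add: inner_axis' matrix_vector_mul_component inner_axis)

text \<open>Induction on the dimension: at a maximiser \<open>z\<close> of the quadratic form on the
  unit sphere of \<open>S\<close>, the first-order condition makes \<open>Q *v z\<close> orthogonal
  to everything in \<open>S\<close> that is orthogonal to \<open>z\<close>, and the rest of the
  basis is found in that complement. \<open>S\<close> need not be invariant under \<open>Q\<close>,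
  so only the mixed terms vanish; eigenvectors appear once \<open>S\<close> is the whole
  space.\<close>

lemma orthonormal_diagonalization_on:
  fixes Q :: "real ^ 'a ^ 'a::finite"
  assumes sym: "transpose Q = Q"
  shows "subspace S \<Longrightarrow> dim S = n \<Longrightarrow>
    \<exists>B\<subseteq>S. finite B \<and> card B = n \<and> pairwise orthogonal B \<and> (\<forall>b\<in>B. norm b = 1) \<and>
      (\<forall>b\<in>B. \<forall>b'\<in>B. b \<noteq> b' \<longrightarrow> b \<bullet> (Q *v b') = 0)"
proof (induction n arbitrary: S)
  case 0
  then show ?case by (intro exI[of _ "{}"]) (auto simp: pairwise_def)
next
  case (Suc n)
  let ?f = "\<lambda>z. z \<bullet> (Q *v z)"
  have "\<exists>x\<in>S. x \<noteq> 0" using Suc.prems by (metis dim_eq_0 nat.distinct(1) singletonI subsetI)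
  then obtain x where x: "x \<in> S" "x \<noteq> 0" by blast
  have "compact (S \<inter> sphere 0 1)"
    by (intro closed_Int_compact closed_subspace Suc.prems compact_sphere)
  moreover have "x /\<^sub>R norm x \<in> S \<inter> sphere 0 1"
    using x Suc.prems by (auto intro: subspace_scale)
  moreover have "continuous_on (S \<inter> sphere 0 1) ?f"
    by (intro continuous_intros linear_continuous_on) (simp add: linear_linear)
  ultimately obtain z where z: "z \<in> S \<inter> sphere 0 1"
    and max: "\<And>y. y \<in> S \<inter> sphere 0 1 \<Longrightarrow> ?f y \<le> ?f z"
    using continuous_attains_sup[of "S \<inter> sphere 0 1" ?f] by blast
  have nz: "norm z = 1" and zS: "z \<in> S" using z by auto
  \<comment> \<open>The homogeneous form of maximality can be used at the vectors
    \<open>z + t *\<^sub>R w\<close>, which are not normalized.\<close>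
  have max': "?f y \<le> ?f z * (norm y)\<^sup>2" if "y \<in> S" for y
  proof (cases "y = 0")
    case False
    then have "y /\<^sub>R norm y \<in> S \<inter> sphere 0 1"
      using that Suc.prems by (auto intro: subspace_scale)
    from max[OF this] False show ?thesis
      by (simp add: matrix_vector_mult_scaleR field_simps power2_eq_square)
  qed simp
  have orth: "w \<bullet> (Q *v z) = 0" if w: "w \<in> S" "orthogonal z w" for w
  proof (rule linear_coeff_zero_of_quadratic_nonpos)
    fix t :: real
    have "z + t *\<^sub>R w \<in> S" using zS w Suc.prems by (auto intro: subspace_add subspace_scale)
    from max'[OF this] have "?f (z + t *\<^sub>R w) \<le> ?f z * (norm (z + t *\<^sub>R w))\<^sup>2" .
    moreover have "(norm (z + t *\<^sub>R w))\<^sup>2 = 1 + t\<^sup>2 * (norm w)\<^sup>2"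
      using w nz norm_add_Pythagorean[of z "t *\<^sub>R w"]
      by (simp add: orthogonal_clauses power_mult_distrib)
    moreover have "?f (z + t *\<^sub>R w) = ?f z + 2 * t * (w \<bullet> (Q *v z)) + t\<^sup>2 * ?f w"
    proof -
      have "z \<bullet> (Q *v w) = w \<bullet> (Q *v z)"
        by (subst inner_symmetric_matrix[OF sym]) (simp add: inner_commute)
      then show ?thesis
        by (simp add: matrix_vector_right_distrib matrix_vector_mult_scaleR inner_add_left
            inner_add_right power2_eq_square algebra_simps)
    qed
    ultimately show "2 * t * (w \<bullet> (Q *v z)) + t\<^sup>2 * (?f w - ?f z * (norm w)\<^sup>2) \<le> 0"
      by (simp add: algebra_simps)
  qed
  define S' where "S' = {y \<in> S. \<forall>x\<in>span {z}. orthogonal x y}"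
  have S'eq: "S' = S \<inter> {y. z \<bullet> y = 0}"
    by (auto simp: S'_def orthogonal_def span_singleton)
  have subS': "subspace S'"
    unfolding S'eq using Suc.prems by (intro subspace_inter subspace_hyperplane) auto
  have "dim S' + dim (span {z}) = dim S"
    unfolding S'_def using Suc.prems zS
    by (intro dim_subspace_orthogonal_to_vectors) (auto simp: span_minimal)
  moreover have "dim (span {z}) = 1" using nz by auto
  ultimately have "dim S' = n" using Suc.prems by simp
  from Suc.IH[OF subS' this] obtain B where B: "B \<subseteq> S'" "finite B" "card B = n"
    "pairwise orthogonal B" "\<forall>b\<in>B. norm b = 1"
    "\<forall>b\<in>B. \<forall>b'\<in>B. b \<noteq> b' \<longrightarrow> b \<bullet> (Q *v b') = 0" by blast
  have "z \<notin> B" using B(1) nz by (auto simp: S'eq dot_square_norm)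
  have zB: "z \<bullet> b = 0" "b \<bullet> (Q *v z) = 0" if "b \<in> B" for b
    using that B(1) orth by (auto simp: S'eq orthogonal_def)
  then have zB': "z \<bullet> (Q *v b) = 0" if "b \<in> B" for b
    using that by (subst inner_symmetric_matrix[OF sym]) (simp add: inner_commute)
  show ?case
  proof (intro exI[of _ "insert z B"] conjI)
    show "insert z B \<subseteq> S" using B(1) zS by (auto simp: S'eq)
    show "card (insert z B) = Suc n" using B \<open>z \<notin> B\<close> by simp
    show "pairwise orthogonal (insert z B)"
      using B(4) zB by (auto simp: pairwise_insert orthogonal_def inner_commute)
  qed (use B zB zB' nz in auto)
qed

lemma orthonormal_expand_inner:
  fixes B :: "(real ^ 'a::finite) set"
  assumes "finite B" "card B = CARD('a)" "pairwise orthogonal B" "\<forall>b\<in>B. norm b = 1"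
  shows "(\<Sum>b\<in>B. (x \<bullet> b) *\<^sub>R b) = x" and "(\<Sum>b\<in>B. (x \<bullet> b) * (y \<bullet> b)) = x \<bullet> y"
proof -
  have "independent B" using assms by (intro pairwise_orthogonal_independent) auto
  then have "span B = UNIV"
    using assms by (metis DIM_cart DIM_real card_eq_dim dim_UNIV mult.right_neutral subset_UNIV top.extremum_uniqueI)
  then show 1: "(\<Sum>b\<in>B. (x \<bullet> b) *\<^sub>R b) = x" for x
    using assms by (intro orthonormal_basis_expand) auto
  have "x \<bullet> y = (\<Sum>b\<in>B. (x \<bullet> b) *\<^sub>R b) \<bullet> y" by (simp add: 1)
  also have "\<dots> = (\<Sum>b\<in>B. (x \<bullet> b) * (y \<bullet> b))"
    unfolding inner_sum_left by (simp add: inner_commute)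
  finally show "(\<Sum>b\<in>B. (x \<bullet> b) * (y \<bullet> b)) = x \<bullet> y" by simp
qed

text \<open>An orthonormal basis without mixed terms consists of eigenvectors: in the expansion of
  \<open>Q *v b\<close> only the coefficient of \<open>b\<close> survives.\<close>

theorem spectral_decomposition:
  fixes Q :: "real ^ 'a ^ 'a::finite"
  assumes sym: "transpose Q = Q"
  obtains B \<mu> where "finite B" "card B = CARD('a)" "pairwise orthogonal B" "\<forall>b\<in>B. norm b = 1"
    "\<And>b. b \<in> B \<Longrightarrow> Q *v b = \<mu> b *\<^sub>R b"
    "\<And>x y. x \<bullet> (Q *v y) = (\<Sum>b\<in>B. \<mu> b * (x \<bullet> b) * (y \<bullet> b))"
    "trace Q = (\<Sum>b\<in>B. \<mu> b)"
proof -
  obtain B where B: "finite B" "card B = CARD('a)" "pairwise orthogonal B" "\<forall>b\<in>B. norm b = 1"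
    and d: "\<forall>b\<in>B. \<forall>b'\<in>B. b \<noteq> b' \<longrightarrow> b \<bullet> (Q *v b') = 0"
    using orthonormal_diagonalization_on[OF sym subspace_UNIV, of "CARD('a)"] by auto
  note exp = orthonormal_expand_inner[OF B]
  define \<mu> where "\<mu> b = b \<bullet> (Q *v b)" for b
  have ev: "Q *v b = \<mu> b *\<^sub>R b" if "b \<in> B" for b
  proof -
    have "Q *v b = (\<Sum>b'\<in>B. ((Q *v b) \<bullet> b') *\<^sub>R b')" by (simp add: exp)
    also have "\<dots> = (\<Sum>b'\<in>B. if b' = b then \<mu> b *\<^sub>R b else 0)"
      using d that by (intro sum.cong) (auto simp: \<mu>_def inner_commute)
    finally show ?thesis using that B by simp
  qed
  have form: "x \<bullet> (Q *v y) = (\<Sum>b\<in>B. \<mu> b * (x \<bullet> b) * (y \<bullet> b))" for x y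
  proof -
    have "x \<bullet> (Q *v y) = (\<Sum>b\<in>B. (x \<bullet> b) * ((Q *v y) \<bullet> b))" by (simp add: exp)
    also have "\<dots> = (\<Sum>b\<in>B. \<mu> b * (x \<bullet> b) * (y \<bullet> b))"
    proof (intro sum.cong refl)
      fix b assume "b \<in> B"
      then have "(Q *v y) \<bullet> b = \<mu> b * (y \<bullet> b)"
        using inner_symmetric_matrix[OF sym, of y b] by (simp add: ev)
      then show "(x \<bullet> b) * ((Q *v y) \<bullet> b) = \<mu> b * (x \<bullet> b) * (y \<bullet> b)" by simp
    qed
    finally show ?thesis .
  qed
  have "trace Q = (\<Sum>i\<in>UNIV. axis i 1 \<bullet> (Q *v axis i 1))"
    by (simp add: trace_def)
  also have "\<dots> = (\<Sum>b\<in>B. \<mu> b * (\<Sum>i\<in>UNIV. (b $ i)\<^sup>2))"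
    unfolding form by (subst sum.swap) (simp add: inner_axis' sum_distrib_left power2_eq_square mult.assoc)
  also have "\<dots> = (\<Sum>b\<in>B. \<mu> b)"
    using B(4) by (intro sum.cong refl) (simp add: norm_vec_def L2_set_def real_sqrt_eq_1_iff)
  finally show ?thesis using that B ev form by blast
qed

section \<open>Positive semidefinite matrices and their large eigenvalues\<close>

lemma inner_matrix_vector_sum:
  fixes P :: "real ^ 'b::finite ^ 'a::finite"
  shows "x \<bullet> (P *v y) = (\<Sum>i\<in>UNIV. \<Sum>j\<in>UNIV. P $ i $ j * x $ i * y $ j)"
  by (simp add: inner_vec_def matrix_vector_mult_def sum_distrib_left mult_ac)

lemma pos_semidef_sym:
  fixes Y :: "real ^ 'a ^ 'a::finite"
  assumes "pos_semidef Y"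
  shows "Y $ s $ r = Y $ r $ s"
proof -
  have "transpose Y $ r $ s = Y $ r $ s" using assms by (simp add: pos_semidef_def)
  then show ?thesis by (simp add: transpose_def)
qed

text \<open>The form at \<open>axis j 1 + t *\<^sub>R axis i 1\<close> is affine in
  \<open>t\<close>, because its quadratic coefficient is \<open>Y $ i $ i\<close>, and a nonnegative
  affine function has slope 0. The witness at the end is the \<open>t\<close> at which it would
  equal -1.\<close>

lemma pos_semidef_zero_diag:
  fixes Y :: "real ^ 'a ^ 'a::finite"
  assumes Y: "pos_semidef Y" and z: "Y $ i $ i = 0"
  shows "Y $ i $ j = 0"
proof -
  have sym: "Y $ j $ i = Y $ i $ j" using Y by (rule pos_semidef_sym)
  have "2 * t * (- (Y $ i $ j)) + t\<^sup>2 * 0 \<le> Y $ j $ j" for t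
  proof -
    have "0 \<le> (axis j 1 + t *\<^sub>R axis i 1) \<bullet> (Y *v (axis j 1 + t *\<^sub>R axis i 1))"
      using Y by (auto simp: pos_semidef_def)
    also have "\<dots> = Y $ j $ j + 2 * t * Y $ i $ j"
      using z sym by (simp add: inner_add_left matrix_vector_right_distrib matrix_vector_mult_scaleR
          algebra_simps)
    finally show ?thesis by simp
  qed
  note le = this
  show ?thesis
  proof (rule ccontr)
    assume "Y $ i $ j \<noteq> 0"
    then have "2 * (- (Y $ j $ j + 1) / (2 * Y $ i $ j)) * (- (Y $ i $ j)) = Y $ j $ j + 1"
      by (simp add: field_simps)
    with le[of "- (Y $ j $ j + 1) / (2 * Y $ i $ j)"] show False by simp
  qed
qed

text \<open>
  After rescaling to unit diagonal, \<open>Y\<close> has trace at most \<open>card I\<close>, so fewer than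
  \<open>card I / \<alpha>\<close> of its eigenvalues exceed \<open>\<alpha>\<close>.
\<close>

lemma few_large_eigenvectors:
  fixes Y :: "real ^ 'a ^ 'a::finite"
  assumes Y: "pos_semidef Y" and \<alpha>: "\<alpha> > 0"
  obtains B where "finite B" "real (card B) \<le> real (card I) / \<alpha>"
    "\<And>y. (\<forall>r. r \<notin> I \<longrightarrow> y $ r = 0) \<Longrightarrow> (\<forall>b\<in>B. b \<bullet> y = 0) \<Longrightarrow>
       y \<bullet> (Y *v y) \<le> \<alpha> * (\<Sum>r\<in>I. Y $ r $ r * (y $ r)\<^sup>2)"
proof -
  have symY: "Y $ s $ r = Y $ r $ s" for r s using Y by (rule pos_semidef_sym)
  have diag: "Y $ r $ r \<ge> 0" for r
    using Y[unfolded pos_semidef_def, THEN conjunct2, rule_format, of "axis r 1"] by simp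
  \<comment> \<open>Since \<open>inverse 0 = 0\<close>, a zero diagonal entry of \<open>Y\<close>
    gives a zero row of \<open>Q\<close>. Nothing is lost, because that whole row of
    \<open>Y\<close> vanishes by \<open>pos_semidef_zero_diag\<close>.\<close>
  define d where "d r = (if r \<in> I then inverse (sqrt (Y $ r $ r)) else 0)" for r
  define Q :: "real ^ 'a ^ 'a" where "Q = (\<chi> r s. d r * d s * Y $ r $ s)"
  have symQ: "transpose Q = Q" by (simp add: transpose_def Q_def symY vec_eq_iff)
  have Qform: "z \<bullet> (Q *v z) = (\<chi> r. d r * z $ r) \<bullet> (Y *v (\<chi> r. d r * z $ r))" for z
    by (simp add: inner_matrix_vector_sum Q_def mult_ac)
  obtain E \<mu> where E: "finite E" "card E = CARD('a)" "pairwise orthogonal E" "\<forall>b\<in>E. norm b = 1"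
    and ev: "\<And>b. b \<in> E \<Longrightarrow> Q *v b = \<mu> b *\<^sub>R b"
    and form: "\<And>x y. x \<bullet> (Q *v y) = (\<Sum>b\<in>E. \<mu> b * (x \<bullet> b) * (y \<bullet> b))"
    and tr: "trace Q = (\<Sum>b\<in>E. \<mu> b)"
    by (rule spectral_decomposition[OF symQ]) blast
  have \<mu>0: "\<mu> b \<ge> 0" if "b \<in> E" for b
  proof -
    have "0 \<le> b \<bullet> (Q *v b)" unfolding Qform using Y by (simp add: pos_semidef_def)
    then show ?thesis using ev[OF that] E(4) that by (simp add: dot_square_norm)
  qed
  have trle: "trace Q \<le> real (card I)"
  proof -
    have 1: "d r * d r * Y $ r $ r \<le> 1" if "r \<in> I" for r
    proof -
      have "d r * d r = inverse (Y $ r $ r)"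
        using that diag[of r] by (simp add: d_def flip: inverse_mult_distrib)
      then show ?thesis by (cases "Y $ r $ r = 0") auto
    qed
    have "trace Q = (\<Sum>r\<in>UNIV. if r \<in> I then d r * d r * Y $ r $ r else 0)"
      unfolding trace_def by (intro sum.cong refl) (simp add: Q_def d_def)
    also have "\<dots> = (\<Sum>r\<in>I. d r * d r * Y $ r $ r)" by (simp flip: sum.inter_filter)
    also have "\<dots> \<le> (\<Sum>r\<in>I. 1)"
      by (intro sum_mono 1)
    finally show ?thesis by simp
  qed
  define Bad where "Bad = {b \<in> E. \<mu> b > \<alpha>}"
  have "\<alpha> * real (card Bad) = (\<Sum>b\<in>Bad. \<alpha>)" by simp
  also have "\<dots> \<le> (\<Sum>b\<in>Bad. \<mu> b)" by (intro sum_mono) (auto simp: Bad_def)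
  also have "\<dots> \<le> (\<Sum>b\<in>E. \<mu> b)" using E \<mu>0 by (intro sum_mono2) (auto simp: Bad_def)
  finally have card: "\<alpha> * real (card Bad) \<le> real (card I)" using tr trle by simp
  \<comment> \<open>Pulls an eigenvector of \<open>Q\<close> back to the coordinates of
    \<open>Y\<close>: \<open>sc b \<bullet> y = b \<bullet> sc y\<close>, so orthogonality to
    \<open>sc b\<close> says that the rescaled \<open>y\<close> has no component along
    \<open>b\<close>.\<close>
  define sc where "sc b = (\<chi> r. sqrt (Y $ r $ r) * b $ r)" for b :: "real ^ 'a"
  show ?thesis
  proof (rule that[of "sc ` Bad"])
    show "finite (sc ` Bad)" using E by (simp add: Bad_def)
    have "card (sc ` Bad) \<le> card Bad" using E by (intro card_image_le) (simp add: Bad_def)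
    then show "real (card (sc ` Bad)) \<le> real (card I) / \<alpha>"
      using card \<alpha> by (simp add: pos_le_divide_eq mult.commute)
        (meson \<alpha> dual_order.trans less_eq_real_def mult_left_mono of_nat_mono)
    fix y :: "real ^ 'a"
    assume supp: "\<forall>r. r \<notin> I \<longrightarrow> y $ r = 0" and orth: "\<forall>b\<in>sc ` Bad. b \<bullet> y = 0"
    define z where "z = sc y"
    have zb: "z \<bullet> b = 0" if "b \<in> Bad" for b
    proof -
      have "sc b \<bullet> y = 0" using orth that by auto
      then show ?thesis by (simp add: z_def sc_def inner_vec_def mult_ac)
    qed
    have "y \<bullet> (Y *v y) = z \<bullet> (Q *v z)"
      unfolding inner_matrix_vector_sum
    proof (intro sum.cong refl)
      fix r s
      show "Y $ r $ s * y $ r * y $ s = Q $ r $ s * z $ r * z $ s"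
      proof (cases "r \<in> I \<and> s \<in> I \<and> Y $ r $ r \<noteq> 0 \<and> Y $ s $ s \<noteq> 0")
        case True
        then have "d r * sqrt (Y $ r $ r) = 1" "d s * sqrt (Y $ s $ s) = 1" by (auto simp: d_def)
        moreover have "Q $ r $ s * z $ r * z $ s =
            (d r * sqrt (Y $ r $ r)) * (d s * sqrt (Y $ s $ s)) * (Y $ r $ s * y $ r * y $ s)"
          by (simp add: Q_def z_def sc_def)
        ultimately show ?thesis by simp
      next
        case False
        then have "Y $ r $ s * y $ r * y $ s = 0"
          using supp pos_semidef_zero_diag[OF Y] symY by (metis mult_zero_left mult_zero_right)
        moreover have "Q $ r $ s * z $ r * z $ s = 0" using False supp
          by (auto simp: Q_def z_def sc_def d_def)
        ultimately show ?thesis by metis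
      qed
    qed
    also have "\<dots> = (\<Sum>b\<in>E. \<mu> b * (z \<bullet> b)\<^sup>2)" unfolding form by (simp add: power2_eq_square mult.assoc)
    also have "\<dots> \<le> (\<Sum>b\<in>E. \<alpha> * (z \<bullet> b)\<^sup>2)"
    proof (intro sum_mono)
      fix b assume "b \<in> E"
      then show "\<mu> b * (z \<bullet> b)\<^sup>2 \<le> \<alpha> * (z \<bullet> b)\<^sup>2"
        using zb[of b] by (cases "b \<in> Bad") (auto simp: Bad_def intro!: mult_right_mono)
    qed
    also have "\<dots> = \<alpha> * (z \<bullet> z)"
      using orthonormal_expand_inner(2)[OF E, of z z] by (simp add: power2_eq_square flip: sum_distrib_left)
    also have "z \<bullet> z = (\<Sum>r\<in>UNIV. if r \<in> I then Y $ r $ r * (y $ r)\<^sup>2 else 0)"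
      unfolding inner_vec_def using diag supp
      by (intro sum.cong) (auto simp: z_def sc_def power2_eq_square algebra_simps)
    also have "\<dots> = (\<Sum>r\<in>I. Y $ r $ r * (y $ r)\<^sup>2)" by (simp add: sum.If_cases)
    finally show "y \<bullet> (Y *v y) \<le> \<alpha> * (\<Sum>r\<in>I. Y $ r $ r * (y $ r)\<^sup>2)" .
  qed
qed

section \<open>Existence of covariances\<close>

lemma Bessel_inequality:
  fixes x :: "'a::real_inner"
  assumes "finite Z" "pairwise orthogonal Z" "\<forall>z\<in>Z. norm z = 1"
  shows "(\<Sum>z\<in>Z. (x \<bullet> z)\<^sup>2) \<le> x \<bullet> x"
proof -
  define p where "p = (\<Sum>z\<in>Z. (x \<bullet> z) *\<^sub>R z)"
  have pz: "p \<bullet> z = x \<bullet> z" if "z \<in> Z" for z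
  proof -
    have "p \<bullet> z = (\<Sum>z'\<in>Z. if z' = z then x \<bullet> z else 0)"
      unfolding p_def inner_sum_left using assms that
      by (intro sum.cong) (auto simp: pairwise_def orthogonal_def dot_square_norm)
    then show ?thesis using that assms by simp
  qed
  have yp: "y \<bullet> p = (\<Sum>z\<in>Z. (x \<bullet> z) * (y \<bullet> z))" for y
    by (simp add: p_def inner_sum_right)
  have pp: "p \<bullet> p = (\<Sum>z\<in>Z. (x \<bullet> z)\<^sup>2)" unfolding yp[of p] by (simp add: pz power2_eq_square)
  have xp: "x \<bullet> p = (\<Sum>z\<in>Z. (x \<bullet> z)\<^sup>2)" unfolding yp[of x] by (simp add: power2_eq_square)
  have "0 \<le> (x - p) \<bullet> (x - p)" by simp
  then show ?thesis using pp xp by (simp add: inner_diff inner_commute)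
qed

lemma dim_orthogonal_complement_ge:
  fixes W :: "(real ^ 'n::finite) set"
  assumes "finite W"
  shows "CARD('n) \<le> dim {z. \<forall>w\<in>W. w \<bullet> z = 0} + card W"
proof -
  have "(\<forall>w\<in>W. w \<bullet> z = 0) \<longleftrightarrow> (\<forall>x\<in>span W. orthogonal x z)" for z
  proof
    assume "\<forall>w\<in>W. w \<bullet> z = 0"
    then have "orthogonal z x" if "x \<in> span W" for x
      using that by (intro orthogonal_to_span[of x W z]) (simp_all add: orthogonal_def inner_commute)
    then show "\<forall>x\<in>span W. orthogonal x z" by (simp add: orthogonal_commute)
  next
    assume *: "\<forall>x\<in>span W. orthogonal x z"
    show "\<forall>w\<in>W. w \<bullet> z = 0"
      using * span_base[of _ W] unfolding orthogonal_def by blast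
  qed
  then have "{z. \<forall>w\<in>W. w \<bullet> z = 0} = {z \<in> UNIV. \<forall>x\<in>span W. orthogonal x z}" by simp
  moreover have "dim {z \<in> UNIV. \<forall>x\<in>span W. orthogonal x z} + dim (span W) = dim (UNIV :: (real^'n) set)"
    by (intro dim_subspace_orthogonal_to_vectors) auto
  moreover have "dim (span W) \<le> card W" using assms by (simp add: dim_le_card')
  ultimately show ?thesis by simp
qed

text \<open>Testing the form at the sum and the difference of two coordinate vectors bounds an entry
  by the mean of two diagonal entries. This is what makes the set of candidate covariances
  bounded.\<close>

lemma pos_semidef_entry_le:
  fixes U :: "real ^ 'a ^ 'a::finite"
  assumes U: "pos_semidef U" and d: "\<forall>j. U $ j $ j \<le> 1"
  shows "\<bar>U $ i $ j\<bar> \<le> 1"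
proof -
  have *: "0 \<le> U $ i $ i + 2 * t * U $ i $ j + t\<^sup>2 * U $ j $ j" for t
  proof -
    have "0 \<le> (axis i 1 + t *\<^sub>R axis j 1) \<bullet> (U *v (axis i 1 + t *\<^sub>R axis j 1))"
      using U by (simp add: pos_semidef_def)
    also have "\<dots> = U $ i $ i + 2 * t * U $ i $ j + t\<^sup>2 * U $ j $ j"
      using pos_semidef_sym[OF U, of j i]
      by (simp add: inner_add_left matrix_vector_right_distrib matrix_vector_mult_scaleR
          algebra_simps power2_eq_square)
    finally show ?thesis .
  qed
  show ?thesis using *[of 1] *[of "-1"] d[rule_format, of i] d[rule_format, of j] by (simp add: abs_le_iff)
qed

lemma norm_matrix_le_sum:
  fixes U :: "real ^ 'a::finite ^ 'b::finite"
  shows "norm U \<le> (\<Sum>i\<in>UNIV. \<Sum>j\<in>UNIV. \<bar>U $ i $ j\<bar>)"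
proof -
  have "norm U \<le> (\<Sum>i\<in>UNIV. norm (U $ i))"
    unfolding norm_vec_def by (rule L2_set_le_sum) simp
  also have "\<dots> \<le> (\<Sum>i\<in>UNIV. \<Sum>j\<in>UNIV. \<bar>U $ i $ j\<bar>)"
    by (intro sum_mono norm_le_l1_cart)
  finally show ?thesis .
qed

lemma inner_matrix_sum:
  fixes P Q :: "real ^ 'a::finite ^ 'b::finite"
  shows "P \<bullet> Q = (\<Sum>i\<in>UNIV. \<Sum>j\<in>UNIV. P $ i $ j * Q $ i $ j)"
  by (simp add: inner_vec_def)

section \<open>The compact convex set of candidate covariances\<close>

definition admissible_covariances :: "'n set \<Rightarrow> (real ^ 'n) set \<Rightarrow> (real ^ 'n ^ 'n::finite) set" where
  "admissible_covariances V C = {U. pos_semidef U \<and> (\<forall>i j. \<not> (i \<in> V \<and> j \<in> V) \<longrightarrow> U $ i $ j = 0) \<and>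
     (\<forall>c\<in>C. U *v c = 0) \<and> (\<forall>j. U $ j $ j \<le> 1)}"

text \<open>Every condition becomes an equation or a weak inequality between continuous functions of
  the entries, so that the \<open>closed_Collect\<close> rules yield closedness.\<close>

lemma admissible_covariances_alt:
  "admissible_covariances V C = {U. (\<forall>i j. U $ j $ i = U $ i $ j) \<and>
     (\<forall>z. 0 \<le> (\<Sum>i\<in>UNIV. \<Sum>j\<in>UNIV. U $ i $ j * z $ i * z $ j)) \<and>
     (\<forall>i j. \<not> (i \<in> V \<and> j \<in> V) \<longrightarrow> U $ i $ j = 0) \<and>
     (\<forall>c i. c \<in> C \<longrightarrow> (\<Sum>j\<in>UNIV. U $ i $ j * c $ j) = 0) \<and> (\<forall>j. U $ j $ j \<le> 1)}"
  unfolding admissible_covariances_def pos_semidef_def inner_matrix_vector_sum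
  by (auto simp: transpose_def vec_eq_iff matrix_vector_mult_def)

lemma compact_admissible_covariances: "compact (admissible_covariances V C)"
proof -
  have "closed (admissible_covariances V C)"
    unfolding admissible_covariances_alt
    by (intro closed_Collect_conj closed_Collect_all closed_Collect_imp closed_Collect_le
        closed_Collect_eq continuous_intros open_Collect_const)
  moreover have "norm U \<le> (\<Sum>i\<in>(UNIV::'a set). \<Sum>j\<in>(UNIV::'a set). (1::real))" if "U \<in> admissible_covariances V C" for U :: "real^'a^'a"
  proof -
    have "norm U \<le> (\<Sum>i\<in>UNIV. \<Sum>j\<in>UNIV. \<bar>U $ i $ j\<bar>)" by (rule norm_matrix_le_sum)
    also have "\<dots> \<le> (\<Sum>i\<in>(UNIV::'a set). \<Sum>j\<in>(UNIV::'a set). (1::real))"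
    proof (rule sum_mono, rule sum_mono)
      show "\<bar>U $ i $ j\<bar> \<le> 1" for i j
        using that by (intro pos_semidef_entry_le) (auto simp: admissible_covariances_def)
    qed
    finally show ?thesis .
  qed
  ultimately show ?thesis unfolding compact_eq_bounded_closed bounded_iff by blast
qed

lemma convex_admissible_covariances: "convex (admissible_covariances V C)"
proof (rule convexI)
  fix P Q :: "real^'a^'a" and u v :: real
  assume *: "P \<in> admissible_covariances V C" "Q \<in> admissible_covariances V C" and uv: "0 \<le> u" "0 \<le> v" "u + v = 1"
  have "0 \<le> z \<bullet> ((u *\<^sub>R P + v *\<^sub>R Q) *v z)" for z
    using * uv by (simp add: admissible_covariances_def pos_semidef_def matrix_vector_mult_add_rdistrib
        inner_add_right scaleR_matrix_vector_assoc[symmetric])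
  moreover have "transpose (u *\<^sub>R P + v *\<^sub>R Q) = u *\<^sub>R P + v *\<^sub>R Q"
    using * by (auto simp: admissible_covariances_def vec_eq_iff transpose_def pos_semidef_sym)
  moreover have "u * P $ j $ j + v * Q $ j $ j \<le> 1" for j
    using * uv by (intro convex_bound_le) (auto simp: admissible_covariances_def)
  ultimately show "u *\<^sub>R P + v *\<^sub>R Q \<in> admissible_covariances V C"
    using * by (auto simp: admissible_covariances_def pos_semidef_def matrix_vector_mult_add_rdistrib
        scaleR_matrix_vector_assoc[symmetric])
qed

text \<open>The matrix is the sum of all \<open>z z\<^sup>T\<close>; for orthonormal
  \<open>Z\<close> it is the orthogonal projection onto the span of \<open>Z\<close>.\<close>

lemma inner_gram_sum:
  fixes Z :: "(real ^ 'n::finite) set"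
  shows "x \<bullet> ((\<Sum>z\<in>Z. (\<chi> i j. z $ i * z $ j)) *v y) = (\<Sum>z\<in>Z. (x \<bullet> z) * (y \<bullet> z))"
proof -
  have "(\<Sum>z\<in>Z. (\<chi> i j. z $ i * z $ j)) *v y = (\<Sum>z\<in>Z. (y \<bullet> z) *\<^sub>R z)"
    by (simp add: vec_eq_iff matrix_vector_mult_def inner_vec_def sum_distrib_right sum_distrib_left
        mult_ac sum.swap[of _ Z])
  then show ?thesis by (simp add: inner_sum_right mult.commute)
qed

text \<open>
  By separation it suffices to satisfy any single nonnegative combination \<open>(Y, t\<^sub>0)\<close> of the spectral
  constraints and the trace bound.  The orthogonal projection onto a subspace on which the combined
  quadratic form is nonnegative does this, and few large eigenvectors mean small codimension.
\<close>

theorem covariance_exists: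
  fixes f :: "'t::finite \<Rightarrow> real ^ 'n::finite" and cl :: "'t \<Rightarrow> 'c" and \<alpha> :: "'c \<Rightarrow> real"
  assumes fin: "finite C" and \<alpha>: "\<And>\<kappa>. \<alpha> \<kappa> > 0" and fI: "\<And>r. r \<notin> I \<Longrightarrow> f r = 0" and \<tau>: "\<tau> \<ge> 0"
    and count: "real (card C) + (\<Sum>r\<in>I. 1 / \<alpha> (cl r)) + \<tau> \<le> real (card V)"
  obtains U where "U \<in> admissible_covariances V C" "trace U \<ge> \<tau>"
    "\<And>\<kappa> g z. z = (\<Sum>r | r \<in> I \<and> cl r = \<kappa>. g r *\<^sub>R f r) \<Longrightarrow>
       z \<bullet> (U *v z) \<le> \<alpha> \<kappa> * (\<Sum>r | r \<in> I \<and> cl r = \<kappa>. (g r)\<^sup>2 * (f r \<bullet> (U *v f r)))"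
proof -
  \<comment> \<open>\<open>M U\<close> is block diagonal over the classes, a block being \<alpha>
    times the diagonal of \<open>G\<close> minus \<open>G\<close>, for the Gram matrix
    \<open>G\<close> of the \<open>f r\<close> under \<open>U\<close>. All requirements together
    then say that \<open>(M U, trace U)\<close> lies in the closed convex set
    \<open>T\<close>.\<close>
  define M :: "real^'n^'n \<Rightarrow> real^'t^'t" where
    "M U = (\<chi> r s. (if r = s then \<alpha> (cl r) * (f r \<bullet> (U *v f r)) else 0)
                  - (if cl r = cl s then f r \<bullet> (U *v f s) else 0))" for U
  define T :: "((real^'t^'t) \<times> real) set" where
    "T = {p. (\<forall>g. 0 \<le> (\<Sum>r\<in>UNIV. \<Sum>s\<in>UNIV. fst p $ r $ s * g $ r * g $ s)) \<and> \<tau> \<le> snd p}"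
  define \<Lambda> where "\<Lambda> U = (M U, trace U)" for U
  have "linear \<Lambda>"
  proof (rule linearI)
    show "\<Lambda> (P + Q) = \<Lambda> P + \<Lambda> Q" for P Q
      by (auto simp: \<Lambda>_def M_def vec_eq_iff matrix_vector_mult_add_rdistrib inner_add_right
          algebra_simps trace_def sum.distrib)
    show "\<Lambda> (c *\<^sub>R P) = c *\<^sub>R \<Lambda> P" for c P
      by (auto simp: \<Lambda>_def M_def vec_eq_iff scaleR_matrix_vector_assoc[symmetric]
          algebra_simps trace_def sum_distrib_left)
  qed
  have "\<exists>U\<in>admissible_covariances V C. \<Lambda> U \<in> T"
  proof (rule ccontr)
    assume "\<not> ?thesis"
    then have disj: "\<Lambda> ` admissible_covariances V C \<inter> T = {}" by auto
    have "0 \<in> admissible_covariances V C"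
      by (auto simp: admissible_covariances_def pos_semidef_def transpose_def vec_eq_iff)
    then have ne: "\<Lambda> ` admissible_covariances V C \<noteq> {}" by auto
    have cpt: "compact (\<Lambda> ` admissible_covariances V C)"
      using \<open>linear \<Lambda>\<close> compact_admissible_covariances
      by (intro compact_continuous_image linear_continuous_on) (simp_all add: linear_linear)
    have cvx: "convex (\<Lambda> ` admissible_covariances V C)"
      using \<open>linear \<Lambda>\<close> convex_admissible_covariances by (rule convex_linear_image)
    have "closed T"
      unfolding T_def
      by (intro closed_Collect_conj closed_Collect_all closed_Collect_le continuous_intros)
    moreover have "convex T"
    proof (rule convexI)
      fix p p' :: "(real^'t^'t) \<times> real" and u v :: real
      assume pT: "p \<in> T" "p' \<in> T" and uv: "0 \<le> u" "0 \<le> v" "u + v = 1"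
      have "(\<Sum>r\<in>UNIV. \<Sum>s\<in>UNIV. fst (u *\<^sub>R p + v *\<^sub>R p') $ r $ s * g $ r * g $ s) =
         u * (\<Sum>r\<in>UNIV. \<Sum>s\<in>UNIV. fst p $ r $ s * g $ r * g $ s) +
         v * (\<Sum>r\<in>UNIV. \<Sum>s\<in>UNIV. fst p' $ r $ s * g $ r * g $ s)" for g
        by (simp add: sum_distrib_left sum.distrib algebra_simps)
      moreover have "\<tau> \<le> u * snd p + v * snd p'"
        using convex_bound_le[of "- snd p" "- \<tau>" "- snd p'" u v] pT uv by (auto simp: T_def)
      ultimately show "u *\<^sub>R p + v *\<^sub>R p' \<in> T" using pT uv by (simp add: T_def)
    qed
    ultimately obtain a \<beta> where sepC: "\<And>U. U \<in> admissible_covariances V C \<Longrightarrow> a \<bullet> \<Lambda> U < \<beta>"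
      and sepT: "\<And>p. p \<in> T \<Longrightarrow> a \<bullet> p > \<beta>"
      using separating_hyperplane_compact_closed[OF cvx cpt ne _ _ disj] by blast
    define Y where "Y = fst a"
    define t0 where "t0 = snd a"
    have inner_a: "a \<bullet> (P, t) = Y \<bullet> P + t0 * t" for P t
      by (simp add: Y_def t0_def inner_prod_def)
    have t0\<tau>: "t0 * \<tau> > \<beta>" using sepT[of "(0, \<tau>)"] by (simp add: T_def inner_a)
    \<comment> \<open>\<open>T\<close> is unbounded towards larger traces, so the separating
      functional cannot decrease in that direction; \<open>s\<close> is where it would come down to
      \<open>\<beta>\<close>. The next claim is the same argument along the ray through
      \<open>P\<close>.\<close>
    have t0: "t0 \<ge> 0"
    proof (rule ccontr)
      assume "\<not> t0 \<ge> 0"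
      then have neg: "t0 < 0" by simp
      define s where "s = (t0 * \<tau> - \<beta>) / (- t0)"
      have "s \<ge> 0" using neg t0\<tau> by (simp add: s_def divide_nonneg_neg)
      then have "(0, \<tau> + s) \<in> T" by (simp add: T_def)
      from sepT[OF this] have "t0 * \<tau> + t0 * s > \<beta>" by (simp add: inner_a algebra_simps)
      moreover have "t0 * s = - (t0 * \<tau> - \<beta>)" using neg by (simp add: s_def)
      ultimately show False by simp
    qed
    have YP: "0 \<le> Y \<bullet> P" if P: "\<And>g. 0 \<le> (\<Sum>r\<in>UNIV. \<Sum>s\<in>UNIV. P $ r $ s * g $ r * g $ s)" for P
    proof (rule ccontr)
      assume "\<not> 0 \<le> Y \<bullet> P"
      then have neg: "Y \<bullet> P < 0" by simp
      define s where "s = (t0 * \<tau> - \<beta>) / (- (Y \<bullet> P))"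
      have "s \<ge> 0" using neg t0\<tau> by (simp add: s_def divide_nonneg_neg)
      have "(\<Sum>r\<in>UNIV. \<Sum>q\<in>UNIV. (s *\<^sub>R P) $ r $ q * g $ r * g $ q) =
          s * (\<Sum>r\<in>UNIV. \<Sum>q\<in>UNIV. P $ r $ q * g $ r * g $ q)" for g
        by (simp add: sum_distrib_left mult_ac)
      then have "(s *\<^sub>R P, \<tau>) \<in> T" using P \<open>s \<ge> 0\<close> by (simp add: T_def)
      from sepT[OF this] have "s * (Y \<bullet> P) + t0 * \<tau> > \<beta>" by (simp add: inner_a)
      moreover have "s * (Y \<bullet> P) = - (t0 * \<tau> - \<beta>)" using neg by (simp add: s_def)
      ultimately show False by simp
    qed
    have Yform: "0 \<le> z \<bullet> (Y *v z)" for z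
    proof -
      have "0 \<le> Y \<bullet> (\<chi> r s. z $ r * z $ s)"
      proof (rule YP)
        fix g :: "real^'t"
        have "(\<Sum>r\<in>UNIV. \<Sum>s\<in>UNIV. (\<chi> r s. z $ r * z $ s) $ r $ s * g $ r * g $ s) =
            (\<Sum>r\<in>UNIV. z $ r * g $ r) * (\<Sum>s\<in>UNIV. z $ s * g $ s)"
          by (simp add: sum_product mult_ac)
        then show "0 \<le> (\<Sum>r\<in>UNIV. \<Sum>s\<in>UNIV. (\<chi> r s. z $ r * z $ s) $ r $ s * g $ r * g $ s)"
          by simp
      qed
      then show ?thesis by (simp add: inner_matrix_vector_sum inner_matrix_sum mult_ac)
    qed
    \<comment> \<open>The test matrix is antisymmetric, so its form vanishes and it belongs to the
      cone. Because \<open>T\<close> does not demand symmetric matrices, such tests are available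
      and force \<open>Y\<close> itself to be symmetric.\<close>
    have Ysym: "Y $ r $ s \<le> Y $ s $ r" for r s
    proof -
      define P :: "real^'t^'t" where "P = (\<chi> i j. (if i = s \<and> j = r then 1 else 0) - (if i = r \<and> j = s then 1 else 0))"
      have *: "(\<Sum>i\<in>UNIV. \<Sum>j\<in>UNIV. (if i = a \<and> j = b then 1 else 0) * h i j) = h a b" for a b and h :: "'t \<Rightarrow> 't \<Rightarrow> real"
      proof -
        have "(\<Sum>i\<in>UNIV. \<Sum>j\<in>UNIV. (if i = a \<and> j = b then 1 else 0) * h i j) =
            (\<Sum>i\<in>UNIV. if i = a then h a b else 0)"
          by (intro sum.cong refl) (auto simp: if_distrib[of "\<lambda>x. x * _"] cong: if_cong)
        then show ?thesis by simp
      qed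
      have **: "(\<Sum>i\<in>UNIV. \<Sum>j\<in>UNIV. P $ i $ j * h i j) = h s r - h r s" for h :: "'t \<Rightarrow> 't \<Rightarrow> real"
        by (simp add: P_def left_diff_distrib sum_subtractf *)
      have "0 \<le> Y \<bullet> P"
        by (rule YP) (simp add: ** mult.assoc)
      then show ?thesis using **[of "\<lambda>i j. Y $ i $ j"] by (simp add: inner_matrix_sum mult.commute)
    qed
    have Y: "pos_semidef Y"
      using Yform Ysym by (auto simp: pos_semidef_def transpose_def vec_eq_iff intro: antisym)
    define Ic where "Ic \<kappa> = {r. r \<in> I \<and> cl r = \<kappa>}" for \<kappa>
    define P where "P \<kappa> B \<longleftrightarrow> finite B \<and> real (card B) \<le> real (card (Ic \<kappa>)) / \<alpha> \<kappa> \<and>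
        (\<forall>y. (\<forall>r. r \<notin> Ic \<kappa> \<longrightarrow> y $ r = 0) \<longrightarrow> (\<forall>b\<in>B. b \<bullet> y = 0) \<longrightarrow>
          y \<bullet> (Y *v y) \<le> \<alpha> \<kappa> * (\<Sum>r\<in>Ic \<kappa>. Y $ r $ r * (y $ r)\<^sup>2))" for \<kappa> and B :: "(real^'t) set"
    have "\<exists>B. P \<kappa> B" for \<kappa>
      unfolding P_def by (rule few_large_eigenvectors[OF Y \<alpha>[of \<kappa>], of "Ic \<kappa>"]) blast
    then obtain Bad where "\<And>\<kappa>. P \<kappa> (Bad \<kappa>)" by metis
    then have Bad: "\<And>\<kappa>. finite (Bad \<kappa>)" "\<And>\<kappa>. real (card (Bad \<kappa>)) \<le> real (card (Ic \<kappa>)) / \<alpha> \<kappa>"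
      "\<And>\<kappa> y. (\<forall>r. r \<notin> Ic \<kappa> \<longrightarrow> y $ r = 0) \<Longrightarrow> (\<forall>b\<in>Bad \<kappa>. b \<bullet> y = 0) \<Longrightarrow>
          y \<bullet> (Y *v y) \<le> \<alpha> \<kappa> * (\<Sum>r\<in>Ic \<kappa>. Y $ r $ r * (y $ r)\<^sup>2)"
      by (simp_all add: P_def)
    \<comment> \<open>\<open>pull \<kappa> b \<bullet> z\<close> is the inner product of
      \<open>b\<close> with the vector of all \<open>f r \<bullet> z\<close> in the class, so one
      linear condition on \<open>z\<close> disposes of one bad eigenvector.\<close>
    define pull where "pull \<kappa> b = (\<Sum>r\<in>Ic \<kappa>. b $ r *\<^sub>R f r)" for \<kappa> and b :: "real^'t"
    define W where "W = (C \<union> (\<Union>\<kappa>\<in>cl ` I. pull \<kappa> ` Bad \<kappa>)) \<union> (\<lambda>j. axis j 1) ` (- V)"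
    have finW: "finite W" using fin Bad(1) by (auto simp: W_def)
    have "card W \<le> (card C + card (\<Union>\<kappa>\<in>cl ` I. pull \<kappa> ` Bad \<kappa>)) + card ((\<lambda>j. axis j 1 :: real^'n) ` (- V))"
      unfolding W_def by (meson add_mono_thms_linordered_semiring(3) card_Un_le order_trans)
    moreover have "card ((\<lambda>j. axis j 1 :: real^'n) ` (- V)) \<le> CARD('n) - card V"
      using card_image_le[of "- V" "\<lambda>j. axis j 1 :: real^'n"] by (simp add: Compl_eq_Diff_UNIV card_Diff_subset)
    moreover have "card V \<le> CARD('n)" by (simp add: card_mono)
    moreover have "real (card (\<Union>\<kappa>\<in>cl ` I. pull \<kappa> ` Bad \<kappa>)) \<le> (\<Sum>r\<in>I. 1 / \<alpha> (cl r))"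
    proof -
      have "card (\<Union>\<kappa>\<in>cl ` I. pull \<kappa> ` Bad \<kappa>) \<le> (\<Sum>\<kappa>\<in>cl ` I. card (pull \<kappa> ` Bad \<kappa>))"
        by (rule card_UN_le) simp
      also have "\<dots> \<le> (\<Sum>\<kappa>\<in>cl ` I. card (Bad \<kappa>))" by (intro sum_mono card_image_le Bad)
      finally have "real (card (\<Union>\<kappa>\<in>cl ` I. pull \<kappa> ` Bad \<kappa>)) \<le> (\<Sum>\<kappa>\<in>cl ` I. real (card (Bad \<kappa>)))"
        unfolding of_nat_sum[symmetric] of_nat_le_iff .
      also have "\<dots> \<le> (\<Sum>\<kappa>\<in>cl ` I. real (card (Ic \<kappa>)) / \<alpha> \<kappa>)" by (intro sum_mono Bad)
      also have "\<dots> = (\<Sum>\<kappa>\<in>cl ` I. \<Sum>r | r \<in> I \<and> cl r = \<kappa>. 1 / \<alpha> (cl r))"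
        by (intro sum.cong refl) (simp add: Ic_def)
      also have "\<dots> = (\<Sum>r\<in>I. 1 / \<alpha> (cl r))"
        by (rule sum.image_gen[symmetric]) simp
      finally show ?thesis .
    qed
    ultimately have "real (card W) + \<tau> \<le> CARD('n)" using count by linarith
    \<comment> \<open>The projection onto \<open>H\<close> has trace \<open>dim H\<close>, and the
      hypothesis \<open>count\<close> says that this is at least \<open>\<tau>\<close>.\<close>
    define H where "H = {z. \<forall>w\<in>W. w \<bullet> z = 0}"
    have dimH: "real (dim H) \<ge> \<tau>"
      using dim_orthogonal_complement_ge[OF finW] \<open>real (card W) + \<tau> \<le> CARD('n)\<close> unfolding H_def by linarith
    have "subspace H" unfolding H_def by (auto simp: subspace_def inner_add_right)
    then obtain Z where Z: "Z \<subseteq> H" "pairwise orthogonal Z" "\<And>z. z \<in> Z \<Longrightarrow> norm z = 1"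
      "independent Z" "card Z = dim H"
      by (rule orthonormal_basis_subspace) blast
    have finZ: "finite Z" using Z(4) independent_imp_finite by blast
    define U :: "real^'n^'n" where "U = (\<Sum>z\<in>Z. (\<chi> i j. z $ i * z $ j))"
    have Uform: "x \<bullet> (U *v y) = (\<Sum>z\<in>Z. (x \<bullet> z) * (y \<bullet> z))" for x y
      unfolding U_def by (rule inner_gram_sum)
    have Uij: "U $ i $ j = (\<Sum>z\<in>Z. z $ i * z $ j)" for i j by (simp add: U_def)
    have UC: "U \<in> admissible_covariances V C"
      unfolding admissible_covariances_def
    proof (intro CollectI conjI allI impI ballI)
      show "pos_semidef U" using Uform by (auto simp: pos_semidef_def transpose_def vec_eq_iff Uij mult.commute sum_nonneg)
      fix i j assume ij: "\<not> (i \<in> V \<and> j \<in> V)"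
      have "z $ k = 0" if "z \<in> Z" "k \<notin> V" for z k
      proof -
        have "axis k 1 \<in> W" using that by (auto simp: W_def)
        then have "axis k 1 \<bullet> z = 0" using Z(1) that by (auto simp: H_def)
        then show ?thesis by (simp add: inner_axis')
      qed
      then show "U $ i $ j = 0" using ij by (auto simp: Uij intro!: sum.neutral)
    next
      fix c assume "c \<in> C"
      then have "c \<bullet> z = 0" if "z \<in> Z" for z using Z(1) that by (auto simp: H_def W_def)
      then have "axis i 1 \<bullet> (U *v c) = 0" for i unfolding Uform by simp
      then show "U *v c = 0" by (simp add: inner_axis' vec_eq_iff)
    next
      fix j
      have "U $ j $ j = (\<Sum>z\<in>Z. (axis j 1 \<bullet> z)\<^sup>2)" by (simp add: Uij inner_axis' power2_eq_square)
      also have "\<dots> \<le> axis j 1 \<bullet> (axis j 1 :: real^'n)" using Z finZ by (intro Bessel_inequality) auto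
      finally show "U $ j $ j \<le> 1" by (simp add: inner_axis_axis)
    qed
    have "trace U = (\<Sum>z\<in>Z. \<Sum>i\<in>UNIV. (z $ i)\<^sup>2)"
      unfolding trace_def Uij by (subst sum.swap) (simp add: power2_eq_square)
    also have "\<dots> = (\<Sum>z\<in>Z. 1)"
      using Z(3) by (intro sum.cong refl) (simp add: norm_vec_def L2_set_def)
    finally have trU: "trace U \<ge> \<tau>" using dimH Z(5) by simp
    \<comment> \<open>For a projection, \<open>Y \<bullet> M U\<close> splits into a sum over
      \<open>z \<in> Z\<close> and over classes of \<alpha> times the diagonal part of the form of
      \<open>Y\<close> minus the form itself, taken at the vector \<open>yv z \<kappa>\<close>. That
      vector avoids the bad eigenvectors, so no term is negative.\<close>
    have "0 \<le> Y \<bullet> M U"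
    proof -
      define yv where "yv z \<kappa> = (\<chi> r. if r \<in> Ic \<kappa> then f r \<bullet> z else 0)" for z \<kappa>
      have yv: "yv z \<kappa> \<bullet> (Y *v yv z \<kappa>) \<le> \<alpha> \<kappa> * (\<Sum>r\<in>Ic \<kappa>. Y $ r $ r * (f r \<bullet> z)\<^sup>2)"
        if "z \<in> Z" "\<kappa> \<in> cl ` I" for z \<kappa>
      proof -
        have "b \<bullet> yv z \<kappa> = 0" if b: "b \<in> Bad \<kappa>" for b
        proof -
          have "pull \<kappa> b \<in> W" using b \<open>\<kappa> \<in> cl ` I\<close> by (auto simp: W_def)
          then have "pull \<kappa> b \<bullet> z = 0" using Z(1) \<open>z \<in> Z\<close> by (auto simp: H_def)
          moreover have "b \<bullet> yv z \<kappa> = (\<Sum>r\<in>UNIV. if r \<in> Ic \<kappa> then b $ r * (f r \<bullet> z) else 0)"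
            unfolding inner_vec_def yv_def by (intro sum.cong) auto
          ultimately show ?thesis by (simp add: pull_def inner_sum_left flip: sum.inter_filter)
        qed
        then have "yv z \<kappa> \<bullet> (Y *v yv z \<kappa>) \<le> \<alpha> \<kappa> * (\<Sum>r\<in>Ic \<kappa>. Y $ r $ r * (yv z \<kappa> $ r)\<^sup>2)"
          by (intro Bad(3)) (auto simp: yv_def)
        then show ?thesis by (simp add: yv_def)
      qed
      have 1: "(\<Sum>r\<in>UNIV. \<Sum>s\<in>UNIV. Y $ r $ s * (if cl r = cl s then (f r \<bullet> z) * (f s \<bullet> z) else 0)) =
          (\<Sum>\<kappa>\<in>cl ` I. yv z \<kappa> \<bullet> (Y *v yv z \<kappa>))" for z
      proof -
        have "(\<Sum>\<kappa>\<in>cl ` I. yv z \<kappa> \<bullet> (Y *v yv z \<kappa>)) =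
            (\<Sum>r\<in>UNIV. \<Sum>s\<in>UNIV. \<Sum>\<kappa>\<in>cl ` I. Y $ r $ s * yv z \<kappa> $ r * yv z \<kappa> $ s)"
          unfolding inner_matrix_vector_sum by (simp add: sum.swap[of _ "cl ` I"])
        also have "\<dots> = (\<Sum>r\<in>UNIV. \<Sum>s\<in>UNIV. Y $ r $ s * (if cl r = cl s then (f r \<bullet> z) * (f s \<bullet> z) else 0))"
        proof (intro sum.cong refl)
          fix r s
          show "(\<Sum>\<kappa>\<in>cl ` I. Y $ r $ s * yv z \<kappa> $ r * yv z \<kappa> $ s) =
            Y $ r $ s * (if cl r = cl s then (f r \<bullet> z) * (f s \<bullet> z) else 0)"
          proof (cases "r \<in> I \<and> s \<in> I")
            case True
            then have "(\<Sum>\<kappa>\<in>cl ` I. Y $ r $ s * yv z \<kappa> $ r * yv z \<kappa> $ s) =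
               (\<Sum>\<kappa>\<in>cl ` I. if \<kappa> = cl r then Y $ r $ s * (if cl r = cl s then (f r \<bullet> z) * (f s \<bullet> z) else 0) else 0)"
              by (intro sum.cong refl) (auto simp: yv_def Ic_def)
            then show ?thesis using True by simp
          next
            case False
            then show ?thesis using fI by (auto simp: yv_def Ic_def intro!: sum.neutral)
          qed
        qed
        finally show ?thesis by simp
      qed
      have 2: "(\<Sum>r\<in>UNIV. Y $ r $ r * (\<alpha> (cl r) * (f r \<bullet> z)\<^sup>2)) =
          (\<Sum>\<kappa>\<in>cl ` I. \<alpha> \<kappa> * (\<Sum>r\<in>Ic \<kappa>. Y $ r $ r * (f r \<bullet> z)\<^sup>2))" for z
      proof -
        have "(\<Sum>r\<in>UNIV. Y $ r $ r * (\<alpha> (cl r) * (f r \<bullet> z)\<^sup>2)) = (\<Sum>r\<in>I. Y $ r $ r * (\<alpha> (cl r) * (f r \<bullet> z)\<^sup>2))"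
          using fI by (intro sum.mono_neutral_right) auto
        also have "\<dots> = (\<Sum>\<kappa>\<in>cl ` I. \<Sum>r | r \<in> I \<and> cl r = \<kappa>. Y $ r $ r * (\<alpha> (cl r) * (f r \<bullet> z)\<^sup>2))"
          by (rule sum.image_gen) simp
        also have "\<dots> = (\<Sum>\<kappa>\<in>cl ` I. \<alpha> \<kappa> * (\<Sum>r\<in>Ic \<kappa>. Y $ r $ r * (f r \<bullet> z)\<^sup>2))"
          unfolding Ic_def sum_distrib_left by (intro sum.cong refl) auto
        finally show ?thesis .
      qed
      have MU: "Y $ r $ s * M U $ r $ s = (\<Sum>z\<in>Z. (if s = r then Y $ r $ r * (\<alpha> (cl r) * (f r \<bullet> z)\<^sup>2) else 0)
           - Y $ r $ s * (if cl r = cl s then (f r \<bullet> z) * (f s \<bullet> z) else 0))" for r s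
        by (cases "s = r"; cases "cl r = cl s")
          (auto simp: M_def Uform sum_distrib_left sum_subtractf right_diff_distrib power2_eq_square
            simp flip: sum_negf)
      let ?d = "\<lambda>r s z. (if s = r then Y $ r $ r * (\<alpha> (cl r) * (f r \<bullet> z)\<^sup>2) else 0)
           - Y $ r $ s * (if cl r = cl s then (f r \<bullet> z) * (f s \<bullet> z) else 0)"
      have "Y \<bullet> M U = (\<Sum>r\<in>UNIV. \<Sum>s\<in>UNIV. \<Sum>z\<in>Z. ?d r s z)"
        unfolding inner_matrix_sum MU ..
      also have "\<dots> = (\<Sum>r\<in>UNIV. \<Sum>z\<in>Z. \<Sum>s\<in>UNIV. ?d r s z)"
        by (intro sum.cong refl sum.swap)
      also have "\<dots> = (\<Sum>z\<in>Z. \<Sum>r\<in>UNIV. \<Sum>s\<in>UNIV. ?d r s z)"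
        by (rule sum.swap)
      also have "\<dots> = (\<Sum>z\<in>Z. (\<Sum>r\<in>UNIV. Y $ r $ r * (\<alpha> (cl r) * (f r \<bullet> z)\<^sup>2)) -
         (\<Sum>r\<in>UNIV. \<Sum>s\<in>UNIV. Y $ r $ s * (if cl r = cl s then (f r \<bullet> z) * (f s \<bullet> z) else 0)))"
        by (simp add: sum_subtractf)
      also have "\<dots> \<ge> 0"
        unfolding 1 2 using yv by (intro sum_nonneg) (auto intro!: sum_mono)
      finally show ?thesis .
    qed
    then have "a \<bullet> \<Lambda> U \<ge> t0 * \<tau>"
      using mult_left_mono[OF trU t0] by (simp add: \<Lambda>_def inner_a)
    then show False using sepC[OF UC] t0\<tau> by simp
  qed
  then obtain U where U: "U \<in> admissible_covariances V C" "\<Lambda> U \<in> T" by blast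
  have tr: "trace U \<ge> \<tau>" using U(2) by (simp add: \<Lambda>_def T_def)
  have spec: "z \<bullet> (U *v z) \<le> \<alpha> \<kappa> * (\<Sum>r | r \<in> I \<and> cl r = \<kappa>. (g r)\<^sup>2 * (f r \<bullet> (U *v f r)))"
    if z: "z = (\<Sum>r | r \<in> I \<and> cl r = \<kappa>. g r *\<^sub>R f r)" for \<kappa> g z
  proof -
    let ?I = "{r. r \<in> I \<and> cl r = \<kappa>}"
    define h :: "real^'t" where "h = (\<chi> r. if r \<in> ?I then g r else 0)"
    have "0 \<le> (\<Sum>r\<in>UNIV. \<Sum>s\<in>UNIV. M U $ r $ s * h $ r * h $ s)"
      using U(2) by (simp add: \<Lambda>_def T_def)
    also have "\<dots> = (\<Sum>r\<in>?I. \<Sum>s\<in>UNIV. M U $ r $ s * h $ r * h $ s)"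
      by (rule sum.mono_neutral_right) (auto simp: h_def)
    also have "\<dots> = (\<Sum>r\<in>?I. \<Sum>s\<in>?I. M U $ r $ s * h $ r * h $ s)"
      by (intro sum.cong refl sum.mono_neutral_right) (auto simp: h_def)
    also have "\<dots> = (\<Sum>r\<in>?I. \<Sum>s\<in>?I. M U $ r $ s * g r * g s)"
      by (intro sum.cong refl) (simp add: h_def)
    also have "\<dots> = (\<Sum>r\<in>?I. \<Sum>s\<in>?I. (if s = r then \<alpha> \<kappa> * ((g r)\<^sup>2 * (f r \<bullet> (U *v f r))) else 0)
        - g r * g s * (f r \<bullet> (U *v f s)))"
      by (intro sum.cong refl) (auto simp: M_def algebra_simps power2_eq_square)
    also have "\<dots> = \<alpha> \<kappa> * (\<Sum>r\<in>?I. (g r)\<^sup>2 * (f r \<bullet> (U *v f r))) - (\<Sum>r\<in>?I. \<Sum>s\<in>?I. g r * g s * (f r \<bullet> (U *v f s)))"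
      by (simp add: sum_subtractf sum_distrib_left)
    also have "(\<Sum>r\<in>?I. \<Sum>s\<in>?I. g r * g s * (f r \<bullet> (U *v f s))) = z \<bullet> (U *v z)"
      unfolding z by (simp add: inner_sum_left inner_sum_right matrix_vector_mult_scaleR
          vec.linear_sum[OF matrix_vector_mul_linear_gen] sum_distrib_left mult_ac)
        (subst sum.swap, simp add: mult_ac)
    finally show ?thesis by simp
  qed
  show ?thesis by (rule that[OF U(1) tr spec])
qed

section \<open>Direction laws\<close>

text \<open>The law picks an eigenvector \<open>b\<close> with probability
  \<open>\<mu> b / trace U\<close> and gives it a random sign. An atom has
  \<open>\<mu> b \<noteq> 0\<close> and therefore lies in the range of \<open>U\<close>.\<close>

lemma direction_law_exists:
  fixes U :: "real ^ 'n ^ 'n::finite"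
  assumes psd: "pos_semidef U" and tr: "trace U > 0"
  obtains D where "direction_law U D"
proof -
  have symU: "transpose U = U" using psd by (simp add: pos_semidef_def)
  obtain B \<mu> where B: "finite B" "card B = CARD('n)" "pairwise orthogonal B" "\<forall>b\<in>B. norm b = 1"
    and ev: "\<And>b. b \<in> B \<Longrightarrow> U *v b = \<mu> b *\<^sub>R b"
    and form: "\<And>x y. x \<bullet> (U *v y) = (\<Sum>b\<in>B. \<mu> b * (x \<bullet> b) * (y \<bullet> b))"
    and trU: "trace U = (\<Sum>b\<in>B. \<mu> b)"
    by (rule spectral_decomposition[OF symU]) blast
  have \<mu>0: "\<mu> b \<ge> 0" if "b \<in> B" for b
  proof -
    have "0 \<le> b \<bullet> (U *v b)" using psd by (simp add: pos_semidef_def)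
    then show ?thesis using ev[OF that] B(4) that by (simp add: dot_square_norm)
  qed
  define w where "w b = \<mu> b / (2 * trace U)" for b
  have w0: "w b \<ge> 0" if "b \<in> B" for b using \<mu>0[OF that] tr by (simp add: w_def)
  define A where "A = B \<union> uminus ` B"
  have finA: "finite A" using B by (simp add: A_def)
  \<comment> \<open>As a sum over \<open>B\<close> this counts all weights correctly, without a
    discussion of which of the vectors \<open>b\<close> and \<open>- b'\<close> coincide.\<close>
  define f where "f v = (\<Sum>b\<in>B. w b * ((if v = b then 1 else 0) + (if v = - b then 1 else 0)))" for v
  have f0: "f v \<ge> 0" for v unfolding f_def using w0 by (intro sum_nonneg mult_nonneg_nonneg) auto
  have fA: "f v = 0" if "v \<notin> A" for v
    unfolding f_def using that by (intro sum.neutral) (auto simp: A_def)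
  have fsum: "(\<Sum>v\<in>A. f v * h v) = (\<Sum>b\<in>B. w b * (h b + h (- b)))" for h :: "real^'n \<Rightarrow> real"
  proof -
    have ite: "y * ((if P then 1 else 0) + (if Q then 1 else 0)) * c = y * ((if P then c else 0) + (if Q then c else 0))"
      for P Q and y c :: real by simp
    have "(\<Sum>v\<in>A. f v * h v) = (\<Sum>b\<in>B. \<Sum>v\<in>A. w b * ((if v = b then h v else 0) + (if v = - b then h v else 0)))"
      unfolding f_def sum_distrib_right by (subst sum.swap) (simp only: ite)
    also have "\<dots> = (\<Sum>b\<in>B. w b * (h b + h (- b)))"
    proof (intro sum.cong refl)
      fix b assume "b \<in> B"
      then have "b \<in> A" "- b \<in> A" by (auto simp: A_def)
      then show "(\<Sum>v\<in>A. w b * ((if v = b then h v else 0) + (if v = - b then h v else 0))) = w b * (h b + h (- b))"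
        using finA by (simp add: sum.distrib flip: sum_distrib_left)
    qed
    finally show ?thesis .
  qed
  have f1: "(\<Sum>v\<in>A. f v) = 1"
  proof -
    have "(\<Sum>v\<in>A. f v) = (\<Sum>b\<in>B. \<mu> b / trace U)" using fsum[of "\<lambda>_. 1"] by (simp add: w_def)
    also have "\<dots> = 1" using tr trU by (simp flip: sum_divide_distrib)
    finally show ?thesis .
  qed
  define D where "D = embed_pmf f"
  have "(\<integral>\<^sup>+ x. ennreal (f x) \<partial>count_space UNIV) = (\<Sum>v\<in>A. ennreal (f v))"
    using finA fA by (intro nn_integral_count_space') auto
  also have "\<dots> = 1" using f1 f0 by (simp add: sum_ennreal)
  finally have pmfD: "pmf D v = f v" for v
    unfolding D_def using f0 by (intro pmf_embed_pmf) auto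
  have setD: "set_pmf D \<subseteq> A" using fA by (force simp: set_pmf_iff pmfD)
  have expD: "measure_pmf.expectation D h = (\<Sum>b\<in>B. w b * (h b + h (- b)))" for h :: "real^'n \<Rightarrow> real"
    using fsum[of h] by (subst integral_measure_pmf[OF finA]) (use setD in \<open>auto simp: pmfD\<close>)
  have "direction_law U D"
    unfolding direction_law_def
  proof (intro conjI allI ballI)
    show "finite (set_pmf D)" using setD finA finite_subset by blast
    fix v
    show "pmf D (- v) = pmf D v"
      unfolding pmfD f_def by (intro sum.cong refl) (auto simp: minus_equation_iff[of v] add.commute)
  next
    fix v assume "v \<in> set_pmf D"
    then have "f v \<noteq> 0" by (simp add: set_pmf_iff pmfD)
    then obtain b where b: "b \<in> B" "w b * ((if v = b then 1 else 0) + (if v = - b then 1 else 0)) \<noteq> 0"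
      unfolding f_def by (rule sum.not_neutral_contains_not_neutral)
    then have v: "v = b \<or> v = - b" and wb: "w b \<noteq> 0" by (auto split: if_splits)
    then show "norm v = 1" using B(4) b(1) by auto
    have "\<mu> b \<noteq> 0" using wb by (auto simp: w_def)
    then have Ub: "U *v (b /\<^sub>R \<mu> b) = b" using ev[OF b(1)] by (simp add: matrix_vector_mult_scaleR)
    then have "U *v (- (b /\<^sub>R \<mu> b)) = - b"
      by (metis matrix_vector_mult_scaleR scaleR_minus1_left)
    then show "v \<in> range (\<lambda>z. U *v z)" using v Ub by (metis rangeI)
  next
    have mean: "measure_pmf.expectation D (\<lambda>v. v $ i) = 0" for i unfolding expD by simp
    show "covariance D = (1 / trace U) *\<^sub>R U"
    proof (simp add: vec_eq_iff covariance_def mean, intro allI)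
      fix i j
      have "measure_pmf.expectation D (\<lambda>v. v $ i * v $ j) = (\<Sum>b\<in>B. \<mu> b * b $ i * b $ j) / trace U"
        unfolding expD by (simp add: w_def sum_divide_distrib mult.assoc)
      also have "(\<Sum>b\<in>B. \<mu> b * b $ i * b $ j) = axis i 1 \<bullet> (U *v axis j 1)"
        unfolding form by (simp add: inner_axis')
      also have "\<dots> = U $ i $ j" by simp
      finally show "measure_pmf.expectation D (\<lambda>v. v $ i * v $ j) = U $ i $ j / trace U" .
    qed
  qed
  then show ?thesis by (rule that)
qed

text \<open>Central symmetry makes the law centred, so its covariance matrix is already the matrix
  of second moments.\<close>

lemma direction_law_moments:
  fixes U :: "real ^ 'n ^ 'n::finite"
  assumes D: "direction_law U D"
  shows "(\<Sum>v\<in>set_pmf D. pmf D v) = 1"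
    and "(\<Sum>v\<in>set_pmf D. pmf D v * (x \<bullet> v)) = 0"
    and "(\<Sum>v\<in>set_pmf D. pmf D v * (x \<bullet> v)\<^sup>2) = (x \<bullet> (U *v x)) / trace U"
proof -
  let ?S = "set_pmf D"
  have fin: "finite ?S" and sym: "\<And>v. pmf D (- v) = pmf D v"
    and cov: "covariance D = (1 / trace U) *\<^sub>R U"
    using D by (auto simp: direction_law_def)
  show "(\<Sum>v\<in>?S. pmf D v) = 1" using fin by (simp add: sum_pmf_eq_1)
  have exp: "measure_pmf.expectation D h = (\<Sum>v\<in>?S. pmf D v * h v)" for h :: "real^'n \<Rightarrow> real"
    by (subst integral_measure_pmf[OF fin]) auto
  have bij: "bij_betw uminus ?S ?S"
    by (rule bij_betw_byWitness[of _ uminus]) (auto simp: set_pmf_iff sym)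
  have 1: "(\<Sum>v\<in>?S. pmf D v * (x \<bullet> v)) = 0" for x
  proof -
    have "(\<Sum>v\<in>?S. pmf D v * (x \<bullet> v)) = (\<Sum>v\<in>?S. pmf D (- v) * (x \<bullet> (- v)))"
      by (rule sum.reindex_bij_betw[OF bij, symmetric])
    also have "\<dots> = - (\<Sum>v\<in>?S. pmf D v * (x \<bullet> v))" by (simp add: sym sum_negf)
    finally show ?thesis by simp
  qed
  then show "(\<Sum>v\<in>?S. pmf D v * (x \<bullet> v)) = 0" .
  have mean: "measure_pmf.expectation D (\<lambda>v. v $ i) = 0" for i
    unfolding exp using 1[of "axis i 1"] by (simp add: inner_axis')
  have ij: "(\<Sum>v\<in>?S. pmf D v * (v $ i * v $ j)) = U $ i $ j / trace U" for i j
  proof -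
    have "covariance D $ i $ j = U $ i $ j / trace U" using cov by simp
    then show ?thesis by (simp add: covariance_def mean exp)
  qed
  have "(\<Sum>v\<in>?S. pmf D v * (x \<bullet> v)\<^sup>2) = (\<Sum>v\<in>?S. \<Sum>i\<in>UNIV. \<Sum>j\<in>UNIV. x $ i * x $ j * (pmf D v * (v $ i * v $ j)))"
    by (intro sum.cong refl) (simp add: inner_vec_def power2_eq_square sum_product sum_distrib_left mult_ac)
  also have "\<dots> = (\<Sum>i\<in>UNIV. \<Sum>v\<in>?S. \<Sum>j\<in>UNIV. x $ i * x $ j * (pmf D v * (v $ i * v $ j)))"
    by (rule sum.swap)
  also have "\<dots> = (\<Sum>i\<in>UNIV. \<Sum>j\<in>UNIV. \<Sum>v\<in>?S. x $ i * x $ j * (pmf D v * (v $ i * v $ j)))"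
    by (intro sum.cong refl sum.swap)
  also have "\<dots> = (\<Sum>i\<in>UNIV. \<Sum>j\<in>UNIV. x $ i * x $ j * (U $ i $ j / trace U))"
    by (simp add: ij flip: sum_distrib_left)
  also have "\<dots> = (x \<bullet> (U *v x)) / trace U"
    by (simp add: inner_matrix_vector_sum sum_divide_distrib mult_ac)
  finally show "(\<Sum>v\<in>?S. pmf D v * (x \<bullet> v)\<^sup>2) = (x \<bullet> (U *v x)) / trace U" .
qed

section \<open>The drift inequality\<close>

text \<open>The Lagrange remainder is \<open>exp t / 2 * x\<^sup>2\<close> with
  \<open>\<bar>t\<bar> \<le> d\<close>. It is used with \<open>d = 1/2\<close>, \<open>c = 1\<close>
  for the inner exponentials and with \<open>d = 1/10\<close>, \<open>c = 56/100\<close> for the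
  outer one.\<close>

lemma exp_le_quadratic:
  fixes x :: real
  assumes "\<bar>x\<bar> \<le> d" "exp d \<le> 2 * c"
  shows "exp x \<le> 1 + x + c * x\<^sup>2"
proof -
  obtain t where t: "\<bar>t\<bar> \<le> \<bar>x\<bar>" "exp x = (\<Sum>m<2. x ^ m / fact m) + exp t / fact 2 * x ^ 2"
    using Maclaurin_exp_le[of x 2] by blast
  have "exp t \<le> exp d" using t(1) assms(1) by simp
  then have "exp t / 2 \<le> c" using assms(2) by linarith
  then have "exp t / 2 * x\<^sup>2 \<le> c * x\<^sup>2" by (intro mult_right_mono) auto
  then show ?thesis using t(2) by (simp add: numeral_2_eq_2)
qed

text \<open>
  The drift \<open>- lam \<beta> E Q\<close> pays for three things: the second-order term of each inner exponential
  (at most 5/16 of it), the variance of the weighted sum (at most 0.616), and the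
  \<open>O(\<gamma>\<^sup>2)\<close> errors.
\<close>

lemma expected_exp_sum_le_one:
  fixes p :: "'v \<Rightarrow> real" and l Q :: "'r \<Rightarrow> 'v \<Rightarrow> real" and a :: "'r \<Rightarrow> real"
  assumes fin: "finite S" "finite I" and p0: "\<And>v. v \<in> S \<Longrightarrow> 0 \<le> p v" and p1: "(\<Sum>v\<in>S. p v) = 1"
    and a0: "\<And>r. r \<in> I \<Longrightarrow> 0 \<le> a r"
    and mean: "\<And>r. r \<in> I \<Longrightarrow> (\<Sum>v\<in>S. p v * l r v) = 0"
    and var: "\<And>r. r \<in> I \<Longrightarrow> (\<Sum>v\<in>S. p v * (l r v)\<^sup>2) \<le> 122/9 * (\<Sum>v\<in>S. p v * Q r v)"
    and joint: "(\<Sum>v\<in>S. p v * (\<Sum>r\<in>I. a r * l r v)\<^sup>2) \<le> \<Gamma> * (\<Sum>r\<in>I. a r * (\<Sum>v\<in>S. p v * Q r v))"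
    and lb: "\<And>r v. r \<in> I \<Longrightarrow> v \<in> S \<Longrightarrow> \<bar>l r v\<bar> \<le> P"
    and Qb: "\<And>r v. r \<in> I \<Longrightarrow> v \<in> S \<Longrightarrow> 0 \<le> Q r v" "\<And>r v. r \<in> I \<Longrightarrow> v \<in> S \<Longrightarrow> Q r v \<le> qmax"
    and N: "(\<Sum>r\<in>I. a r) \<le> N"
    and pos: "lam > 0" "\<beta> > 0" "P \<ge> 0" "qmax \<ge> 0" "N \<ge> 0"
    and lb1: "122/9 * lam \<le> \<beta> / 4" and lb2: "lam * \<Gamma> \<le> \<beta>"
    and G0: "G0 = lam * \<beta> * qmax + 5/4 * lam\<^sup>2 * P\<^sup>2 + 5 * lam\<^sup>2 * \<beta>\<^sup>2 * qmax\<^sup>2"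
    and \<gamma>: "0 < \<gamma>" "\<gamma> \<le> 1" "lam * (\<gamma> * P + \<gamma>\<^sup>2 * \<beta> * qmax) \<le> 1/2"
      "\<gamma> * (lam * N * P) + \<gamma>\<^sup>2 * (N * G0) \<le> 1/10"
      "\<gamma>\<^sup>2 * (5 * lam\<^sup>2 * \<beta>\<^sup>2 * qmax + 616/100 * N * G0 * (21/16 * lam * \<beta> + 5 * lam\<^sup>2 * \<beta>\<^sup>2 * qmax)) \<le> lam * \<beta> / 20"
  shows "(\<Sum>v\<in>S. p v * exp (\<Sum>r\<in>I. a r * (exp (lam * (\<gamma> * l r v - \<gamma>\<^sup>2 * \<beta> * Q r v)) - 1))) \<le> 1"
proof -
  let ?w = "\<lambda>v. \<Sum>r\<in>I. a r * (exp (lam * (\<gamma> * l r v - \<gamma>\<^sup>2 * \<beta> * Q r v)) - 1)"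
  \<comment> \<open>\<open>g\<close> is the second-order part of one inner exponential and
    \<open>g'\<close> bounds its size. \<open>A1\<close> and \<open>A2\<close> are the final
    coefficients of drift and variance, once the square of the total second-order part has been
    absorbed.\<close>
  define g where "g r v = - lam * \<beta> * Q r v + 5/4 * lam\<^sup>2 * (l r v)\<^sup>2 + 5 * lam\<^sup>2 * \<gamma>\<^sup>2 * \<beta>\<^sup>2 * (Q r v)\<^sup>2" for r v
  define g' where "g' r v = (lam * \<beta> + 5 * lam\<^sup>2 * \<beta>\<^sup>2 * qmax) * Q r v + 5/4 * lam\<^sup>2 * (l r v)\<^sup>2" for r v
  define A1 where "A1 = - lam * \<beta> + 5 * lam\<^sup>2 * \<gamma>\<^sup>2 * \<beta>\<^sup>2 * qmax + 616/100 * \<gamma>\<^sup>2 * N * G0 * (lam * \<beta> + 5 * lam\<^sup>2 * \<beta>\<^sup>2 * qmax)"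
  define A2 where "A2 = 5/4 * lam\<^sup>2 + 616/100 * \<gamma>\<^sup>2 * N * G0 * (5/4 * lam\<^sup>2)"
  have \<gamma>2: "\<gamma>\<^sup>2 \<le> 1" using \<gamma> by (simp add: power_le_one)
  have G0nn: "G0 \<ge> 0" unfolding G0 using pos by (intro add_nonneg_nonneg mult_nonneg_nonneg) auto
  have Q2: "(Q r v)\<^sup>2 \<le> qmax * Q r v" if "r \<in> I" "v \<in> S" for r v
    unfolding power2_eq_square using Qb that by (intro mult_right_mono) auto
  have inner: "exp (lam * (\<gamma> * l r v - \<gamma>\<^sup>2 * \<beta> * Q r v)) - 1 \<le> \<gamma> * (lam * l r v) + \<gamma>\<^sup>2 * g r v"
    if rv: "r \<in> I" "v \<in> S" for r v
  proof -
    define x where "x = \<gamma> * l r v"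
    define y where "y = \<gamma>\<^sup>2 * \<beta> * Q r v"
    have "\<bar>x - y\<bar> \<le> \<bar>x\<bar> + \<bar>y\<bar>" by simp
    also have "\<bar>x\<bar> \<le> \<gamma> * P" using lb[OF rv] \<gamma> by (simp add: x_def abs_mult)
    also have "\<bar>y\<bar> = \<gamma>\<^sup>2 * \<beta> * Q r v" using Qb(1)[OF rv] pos by (simp add: y_def abs_mult)
    also have "\<dots> \<le> \<gamma>\<^sup>2 * \<beta> * qmax" using Qb[OF rv] pos by (intro mult_left_mono) auto
    finally have "lam * \<bar>x - y\<bar> \<le> lam * (\<gamma> * P + \<gamma>\<^sup>2 * \<beta> * qmax)" using pos by (intro mult_left_mono) auto
    then have "\<bar>lam * (x - y)\<bar> \<le> 1/2" using \<gamma>(3) pos by (simp only: abs_mult abs_of_pos)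
    moreover have "exp (1/2::real) \<le> 2 * 1" using exp_bound[of "1/2"] by (simp add: power2_eq_square)
    ultimately have "exp (lam * (x - y)) \<le> 1 + lam * (x - y) + 1 * (lam * (x - y))\<^sup>2"
      by (rule exp_le_quadratic)
    moreover have "(lam * (x - y))\<^sup>2 \<le> lam\<^sup>2 * (5/4 * x\<^sup>2 + 5 * y\<^sup>2)"
    proof -
      have "0 \<le> (x / 2 + 2 * y)\<^sup>2" by simp
      then have "(x - y)\<^sup>2 \<le> 5/4 * x\<^sup>2 + 5 * y\<^sup>2" by (simp add: power2_eq_square field_simps)
      then show ?thesis by (simp add: power_mult_distrib mult_left_mono)
    qed
    moreover have "lam * (x - y) + lam\<^sup>2 * (5/4 * x\<^sup>2 + 5 * y\<^sup>2) = \<gamma> * (lam * l r v) + \<gamma>\<^sup>2 * g r v"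
      by (simp add: x_def y_def g_def power_mult_distrib algebra_simps)
    ultimately show ?thesis by (simp add: x_def y_def)
  qed
  have gg': "\<bar>g r v\<bar> \<le> g' r v" and g'G0: "g' r v \<le> G0"
    and gle: "g r v \<le> (- lam * \<beta> + 5 * lam\<^sup>2 * \<gamma>\<^sup>2 * \<beta>\<^sup>2 * qmax) * Q r v + 5/4 * lam\<^sup>2 * (l r v)\<^sup>2"
    if rv: "r \<in> I" "v \<in> S" for r v
  proof -
    have k: "5 * lam\<^sup>2 * \<gamma>\<^sup>2 * \<beta>\<^sup>2 * (Q r v)\<^sup>2 \<le> 5 * lam\<^sup>2 * \<gamma>\<^sup>2 * \<beta>\<^sup>2 * (qmax * Q r v)"
      using Q2[OF rv] by (intro mult_left_mono) auto
    then show "g r v \<le> (- lam * \<beta> + 5 * lam\<^sup>2 * \<gamma>\<^sup>2 * \<beta>\<^sup>2 * qmax) * Q r v + 5/4 * lam\<^sup>2 * (l r v)\<^sup>2"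
      by (simp add: g_def algebra_simps)
    have k2: "5 * lam\<^sup>2 * \<gamma>\<^sup>2 * \<beta>\<^sup>2 * (qmax * Q r v) \<le> 5 * lam\<^sup>2 * \<beta>\<^sup>2 * (qmax * Q r v)"
      using mult_right_mono[OF \<gamma>2, of "5 * lam\<^sup>2 * \<beta>\<^sup>2 * (qmax * Q r v)"] Qb(1)[OF rv] pos
      by (simp add: mult_ac)
    have nn: "0 \<le> lam * \<beta> * Q r v" "0 \<le> 5/4 * lam\<^sup>2 * (l r v)\<^sup>2" "0 \<le> 5 * lam\<^sup>2 * \<gamma>\<^sup>2 * \<beta>\<^sup>2 * (Q r v)\<^sup>2"
      "0 \<le> 5 * lam\<^sup>2 * \<beta>\<^sup>2 * (qmax * Q r v)"
      using pos Qb(1)[OF rv] by auto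
    have g'e: "g' r v = lam * \<beta> * Q r v + 5/4 * lam\<^sup>2 * (l r v)\<^sup>2 + 5 * lam\<^sup>2 * \<beta>\<^sup>2 * (qmax * Q r v)"
      by (simp add: g'_def algebra_simps)
    show "\<bar>g r v\<bar> \<le> g' r v"
      unfolding g'e g_def abs_le_iff using k k2 nn by (intro conjI; linarith)
    have "lam * \<beta> * Q r v \<le> lam * \<beta> * qmax" using pos Qb(2)[OF rv] by (intro mult_left_mono) auto
    moreover have "5 * lam\<^sup>2 * \<beta>\<^sup>2 * (qmax * Q r v) \<le> 5 * lam\<^sup>2 * \<beta>\<^sup>2 * (qmax * qmax)"
      using pos Qb(2)[OF rv] by (intro mult_left_mono) auto
    moreover have "5/4 * lam\<^sup>2 * (l r v)\<^sup>2 \<le> 5/4 * lam\<^sup>2 * P\<^sup>2"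
      using lb[OF rv] pos by (intro mult_left_mono) (auto simp: abs_le_square_iff[symmetric])
    ultimately show "g' r v \<le> G0" unfolding g'e G0 by (simp add: power2_eq_square)
  qed
  define L where "L v = (\<Sum>r\<in>I. a r * l r v)" for v
  define G where "G v = (\<Sum>r\<in>I. a r * g r v)" for v
  define G' where "G' v = (\<Sum>r\<in>I. a r * g' r v)" for v
  let ?m = "\<lambda>v. \<Sum>r\<in>I. a r * (A1 * Q r v + A2 * (l r v)\<^sup>2)"
  have pointwise: "exp (?w v) \<le>
      1 + \<gamma> * lam * L v + \<gamma>\<^sup>2 * ?m v + 616/1000 * \<gamma>\<^sup>2 * lam\<^sup>2 * (L v)\<^sup>2"
    if v: "v \<in> S" for v
  proof -
    define x where "x = \<gamma> * (lam * L v)"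
    define y where "y = \<gamma>\<^sup>2 * G v"
    have G'nn: "G' v \<ge> 0" unfolding G'_def using a0 gg' v
      by (intro sum_nonneg mult_nonneg_nonneg) (auto intro: order_trans[OF abs_ge_zero])
    have "?w v
        \<le> (\<Sum>r\<in>I. a r * (\<gamma> * (lam * l r v) + \<gamma>\<^sup>2 * g r v))"
      using a0 inner v by (intro sum_mono mult_left_mono) auto
    also have "\<dots> = x + y"
      by (simp add: x_def y_def L_def G_def sum_distrib_left sum.distrib algebra_simps)
    finally have W: "?w v \<le> x + y" .
    have Lb: "\<bar>L v\<bar> \<le> N * P"
    proof -
      have "\<bar>L v\<bar> \<le> (\<Sum>r\<in>I. \<bar>a r * l r v\<bar>)" unfolding L_def by (rule sum_abs)
      also have "\<dots> \<le> (\<Sum>r\<in>I. a r * P)"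
        using a0 lb v by (intro sum_mono) (auto simp: abs_mult intro!: mult_left_mono)
      also have "\<dots> \<le> N * P" using N pos by (simp add: mult_right_mono flip: sum_distrib_right)
      finally show ?thesis .
    qed
    have GG': "\<bar>G v\<bar> \<le> G' v"
    proof -
      have "\<bar>G v\<bar> \<le> (\<Sum>r\<in>I. \<bar>a r * g r v\<bar>)" unfolding G_def by (rule sum_abs)
      also have "\<dots> \<le> G' v" unfolding G'_def
        using a0 gg' v by (intro sum_mono) (auto simp: abs_mult intro!: mult_left_mono)
      finally show ?thesis .
    qed
    have G'N: "G' v \<le> N * G0"
    proof -
      have "G' v \<le> (\<Sum>r\<in>I. a r * G0)" unfolding G'_def
        using a0 g'G0 v by (intro sum_mono mult_left_mono) auto
      also have "\<dots> \<le> N * G0" using N G0nn by (simp add: mult_right_mono flip: sum_distrib_right)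
      finally show ?thesis .
    qed
    have "\<bar>x\<bar> = \<gamma> * lam * \<bar>L v\<bar>" using \<gamma> pos by (simp add: x_def abs_mult)
    also have "\<dots> \<le> \<gamma> * lam * (N * P)" using Lb \<gamma> pos by (intro mult_left_mono) auto
    finally have xb: "\<bar>x\<bar> \<le> \<gamma> * (lam * N * P)" by (simp add: mult_ac)
    have yb: "\<bar>y\<bar> \<le> \<gamma>\<^sup>2 * (N * G0)"
      unfolding y_def abs_mult using GG' G'N by (simp add: mult_left_mono)
    have "\<bar>x + y\<bar> \<le> 1/10" using xb yb \<gamma>(4) by linarith
    moreover have "exp (1/10::real) \<le> 2 * (56/100)" using exp_bound[of "1/10"] by (simp add: power2_eq_square)
    ultimately have "exp (x + y) \<le> 1 + (x + y) + 56/100 * (x + y)\<^sup>2" by (rule exp_le_quadratic)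
    \<comment> \<open>With the 56/100 of the outer Taylor bound this uneven split yields the
      constants 616/1000 and 616/100: the first-order part keeps almost its own size, while the
      large factor falls on \<open>y\<^sup>2\<close>, which is of order
      \<open>\<gamma> ^ 4\<close>.\<close>
    moreover have "(x + y)\<^sup>2 \<le> 11/10 * x\<^sup>2 + 11 * y\<^sup>2"
    proof -
      have "0 \<le> (x - 10 * y)\<^sup>2" by simp
      then show ?thesis by (simp add: power2_eq_square algebra_simps)
    qed
    moreover have "y\<^sup>2 \<le> \<gamma>\<^sup>2 * (\<gamma>\<^sup>2 * N * G0 * G' v)"
    proof -
      have "(G v)\<^sup>2 = \<bar>G v\<bar> * \<bar>G v\<bar>" by (simp add: power2_eq_square)
      also have "\<dots> \<le> (N * G0) * G' v" using GG' G'N G'nn by (intro mult_mono) auto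
      finally have "\<gamma>\<^sup>2 * (\<gamma>\<^sup>2 * (G v)\<^sup>2) \<le> \<gamma>\<^sup>2 * (\<gamma>\<^sup>2 * ((N * G0) * G' v))"
        by (intro mult_left_mono) auto
      then show ?thesis by (simp add: y_def power_mult_distrib power2_eq_square mult_ac)
    qed
    ultimately have "exp (x + y) \<le> 1 + x + (y + 616/100 * \<gamma>\<^sup>2 * (\<gamma>\<^sup>2 * N * G0 * G' v)) + 616/1000 * x\<^sup>2"
      by linarith
    also have "y + 616/100 * \<gamma>\<^sup>2 * (\<gamma>\<^sup>2 * N * G0 * G' v) =
        \<gamma>\<^sup>2 * (\<Sum>r\<in>I. a r * (g r v + 616/100 * \<gamma>\<^sup>2 * N * G0 * g' r v))"
      by (simp add: y_def G_def G'_def sum_distrib_left sum.distrib algebra_simps)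
    also have "\<dots> \<le> \<gamma>\<^sup>2 * ?m v"
    proof (intro mult_left_mono sum_mono)
      fix r assume r: "r \<in> I"
      have "g r v + 616/100 * \<gamma>\<^sup>2 * N * G0 * g' r v \<le>
          (- lam * \<beta> + 5 * lam\<^sup>2 * \<gamma>\<^sup>2 * \<beta>\<^sup>2 * qmax) * Q r v + 5/4 * lam\<^sup>2 * (l r v)\<^sup>2 + 616/100 * \<gamma>\<^sup>2 * N * G0 * g' r v"
        using gle[OF r v] by simp
      also have "\<dots> = A1 * Q r v + A2 * (l r v)\<^sup>2"
        by (simp add: A1_def A2_def g'_def algebra_simps)
      finally show "g r v + 616/100 * \<gamma>\<^sup>2 * N * G0 * g' r v \<le> A1 * Q r v + A2 * (l r v)\<^sup>2" .
    qed (use a0 in auto)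
    finally have "exp (x + y) \<le> 1 + x + \<gamma>\<^sup>2 * ?m v + 616/1000 * x\<^sup>2"
      by simp
    moreover have "exp (?w v) \<le> exp (x + y)"
      using W by simp
    moreover have "x = \<gamma> * lam * L v" "616/1000 * x\<^sup>2 = 616/1000 * \<gamma>\<^sup>2 * lam\<^sup>2 * (L v)\<^sup>2"
      by (simp_all add: x_def power_mult_distrib)
    ultimately show ?thesis by linarith
  qed
  define d where "d r = (\<Sum>v\<in>S. p v * Q r v)" for r
  let ?e = "\<Sum>r\<in>I. a r * (A1 * d r + A2 * (\<Sum>v\<in>S. p v * (l r v)\<^sup>2))"
  have d0: "d r \<ge> 0" if "r \<in> I" for r
    unfolding d_def using p0 Qb(1) that by (intro sum_nonneg mult_nonneg_nonneg) auto
  have "(\<Sum>v\<in>S. p v * exp (?w v)) \<le>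
    (\<Sum>v\<in>S. p v * (1 + \<gamma> * lam * L v + \<gamma>\<^sup>2 * ?m v + 616/1000 * \<gamma>\<^sup>2 * lam\<^sup>2 * (L v)\<^sup>2))"
    using p0 pointwise by (intro sum_mono mult_left_mono) auto
  also have "\<dots> = (\<Sum>v\<in>S. p v) + \<gamma> * lam * (\<Sum>v\<in>S. p v * L v)
      + \<gamma>\<^sup>2 * (\<Sum>v\<in>S. p v * ?m v)
      + 616/1000 * \<gamma>\<^sup>2 * lam\<^sup>2 * (\<Sum>v\<in>S. p v * (L v)\<^sup>2)"
    by (simp add: sum_distrib_left sum.distrib distrib_left mult_ac)
  also have "(\<Sum>v\<in>S. p v * L v) = 0"
  proof -
    have "(\<Sum>v\<in>S. p v * L v) = (\<Sum>r\<in>I. a r * (\<Sum>v\<in>S. p v * l r v))"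
      unfolding L_def sum_distrib_left by (subst sum.swap) (simp add: mult_ac)
    then show ?thesis using mean by simp
  qed
  also have "(\<Sum>v\<in>S. p v * ?m v) =
      ?e"
    unfolding d_def sum_distrib_left by (subst sum.swap) (simp add: distrib_left sum.distrib sum_distrib_left mult_ac)
  also have "(\<Sum>v\<in>S. p v) + \<gamma> * lam * 0 + \<gamma>\<^sup>2 * ?e
      + 616/1000 * \<gamma>\<^sup>2 * lam\<^sup>2 * (\<Sum>v\<in>S. p v * (L v)\<^sup>2) \<le> 1"
  proof -
    define s where "s = (\<Sum>r\<in>I. a r * d r)"
    have s0: "s \<ge> 0" unfolding s_def using a0 d0 by (intro sum_nonneg mult_nonneg_nonneg) auto
    have A2: "A2 \<ge> 0" unfolding A2_def using pos G0nn by (intro add_nonneg_nonneg mult_nonneg_nonneg) auto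
    have "?e \<le> (\<Sum>r\<in>I. a r * (A1 * d r + A2 * (122/9 * d r)))"
      using a0 var A2 by (intro sum_mono mult_left_mono add_left_mono) (auto simp: d_def)
    also have "\<dots> = (\<Sum>r\<in>I. (A1 + A2 * (122/9)) * (a r * d r))"
      by (intro sum.cong refl) (simp add: algebra_simps)
    also have "\<dots> = (A1 + A2 * (122/9)) * s" unfolding s_def sum_distrib_left ..
    finally have 1: "?e \<le> (A1 + A2 * (122/9)) * s" .
    have 2: "(\<Sum>v\<in>S. p v * (L v)\<^sup>2) \<le> \<Gamma> * s" using joint by (simp add: L_def s_def d_def)
    have 3: "lam\<^sup>2 * (\<Sum>v\<in>S. p v * (L v)\<^sup>2) \<le> lam * \<beta> * s"
    proof -
      have "lam\<^sup>2 * (\<Sum>v\<in>S. p v * (L v)\<^sup>2) \<le> lam\<^sup>2 * (\<Gamma> * s)" using 2 by (intro mult_left_mono) auto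
      also have "\<dots> = lam * s * (lam * \<Gamma>)" by (simp add: power2_eq_square)
      also have "\<dots> \<le> lam * s * \<beta>" using lb2 s0 pos by (intro mult_left_mono) auto
      finally show ?thesis by (simp add: mult_ac)
    qed
    \<comment> \<open>The balance in units of \<open>lam * \<beta>\<close>: -1 from the drift, 5/16
      = 5/4 * 1/4 from the inner second-order terms, 1/20 from all higher-order errors and 616/1000
      from the joint variance. The total is -0.0215.\<close>
    have 4: "A1 + A2 * (122/9) + 616/1000 * lam * \<beta> \<le> 0"
    proof -
      define w where "w = 616/100 * \<gamma>\<^sup>2 * N * G0"
      have w0: "w \<ge> 0" unfolding w_def using pos G0nn by auto
      have l2: "lam\<^sup>2 * (122/9) \<le> lam * \<beta> / 4"
        using mult_left_mono[OF lb1, of lam] pos by (simp add: power2_eq_square)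
      have "A2 * (122/9) = (5/4 + w * (5/4)) * (lam\<^sup>2 * (122/9))"
        by (simp add: A2_def w_def algebra_simps)
      also have "\<dots> \<le> (5/4 + w * (5/4)) * (lam * \<beta> / 4)" using l2 w0 by (intro mult_left_mono) auto
      finally have A2': "A2 * (122/9) \<le> 5/16 * (lam * \<beta>) + w * (5/16 * (lam * \<beta>))" by (simp add: algebra_simps)
      have A1': "A1 = - lam * \<beta> + 5 * lam\<^sup>2 * \<gamma>\<^sup>2 * \<beta>\<^sup>2 * qmax + w * (lam * \<beta> + 5 * lam\<^sup>2 * \<beta>\<^sup>2 * qmax)"
        by (simp add: A1_def w_def)
      have e: "\<gamma>\<^sup>2 * (5 * lam\<^sup>2 * \<beta>\<^sup>2 * qmax + 616/100 * N * G0 * (21/16 * lam * \<beta> + 5 * lam\<^sup>2 * \<beta>\<^sup>2 * qmax)) =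
          5 * lam\<^sup>2 * \<gamma>\<^sup>2 * \<beta>\<^sup>2 * qmax + w * (lam * \<beta> + 5 * lam\<^sup>2 * \<beta>\<^sup>2 * qmax) + w * (5/16 * (lam * \<beta>))"
        by (simp add: w_def field_simps)
      have "lam * \<beta> > 0" using pos by simp
      then show ?thesis using \<gamma>(5) A1' A2' unfolding e by linarith
    qed
    have "\<gamma>\<^sup>2 * ?e
        + 616/1000 * \<gamma>\<^sup>2 * lam\<^sup>2 * (\<Sum>v\<in>S. p v * (L v)\<^sup>2)
      = \<gamma>\<^sup>2 * (?e + 616/1000 * (lam\<^sup>2 * (\<Sum>v\<in>S. p v * (L v)\<^sup>2)))"
      by (simp add: algebra_simps)
    also have "\<dots> \<le> \<gamma>\<^sup>2 * ((A1 + A2 * (122/9)) * s + 616/1000 * (lam * \<beta> * s))"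
      using 1 3 by (intro mult_left_mono) auto
    also have "\<dots> = \<gamma>\<^sup>2 * (s * (A1 + A2 * (122/9) + 616/1000 * lam * \<beta>))" by (simp add: algebra_simps)
    also have "\<dots> \<le> 0" using 4 s0 by (simp add: mult_nonneg_nonpos)
    finally show ?thesis using p1 by simp
  qed
  finally show ?thesis .
qed

section \<open>Parameters\<close>

lemma s_par_pos: "s_par k > 0" by (simp add: s_par_def)
lemma s_par_Suc: "s_par (Suc k) = s_par k / 2" by (simp add: s_par_def)
lemma s_par_le: "s_par k \<le> 60/7" by (simp add: s_par_def power_le_one)

lemma w_par_pos: "w_par k > 0" by (simp add: w_par_def)

lemma w_par_le: "w_par k \<le> 17/140"
proof -
  have "(15/17 :: real) ^ (k - 1) \<le> 1" by (rule power_le_one) auto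
  then show ?thesis by (simp add: w_par_def)
qed

text \<open>The weights share out the dimensions granted to dangerous records among the classes;
  their infinite sum is exactly 1.\<close>

lemma sum_w_par_le_one: "(\<Sum>k\<le>K. w_par k) \<le> 1"
proof -
  have "(\<Sum>k\<le>K. w_par k) = 1 - 123/140 * (15/17) ^ K"
    by (induction K) (simp_all add: w_par_def)
  then show ?thesis by simp
qed

lemma delta_par_pos: "delta_par k > 0" by (simp add: delta_par_def w_par_pos)
lemma delta_par_le: "delta_par k \<le> 1/10" using w_par_le[of k] by (simp add: delta_par_def)

lemma exp_L_par: "exp (L_par k) = 32 / (delta_par k * s_par k)"
  using delta_par_pos[of k] s_par_pos[of k] by (simp add: L_par_def)

lemma L_par_ge_one: "L_par k \<ge> 1"
proof -
  have "delta_par k * s_par k \<le> 1/10 * (60/7)"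
    using delta_par_le s_par_le s_par_pos[of k] by (intro mult_mono) (auto intro: less_imp_le)
  then have "3 \<le> 32 / (delta_par k * s_par k)"
    using delta_par_pos[of k] s_par_pos[of k] by (simp add: field_simps)
  with exp_le have "exp 1 \<le> exp (L_par k)" unfolding exp_L_par by linarith
  then show ?thesis by simp
qed

text \<open>Needed for the initial potential, where each column contributes at most this
  sum.\<close>

lemma sum_exp_neg_L_par: "(\<Sum>k\<le>K. exp (- L_par k)) \<le> 1"
proof -
  have "(\<Sum>k\<le>K. exp (- L_par k)) \<le> (\<Sum>k\<le>K. 1/2 * (1/2) ^ k)"
  proof (rule sum_mono)
    fix k
    have "exp (- L_par k) = delta_par k * s_par k / 32"
      using delta_par_pos[of k] s_par_pos[of k] by (simp add: exp_minus exp_L_par)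
    also have "\<dots> \<le> 1/10 * s_par k / 32"
      using delta_par_le[of k] s_par_pos[of k] by (intro divide_right_mono mult_right_mono) auto
    also have "\<dots> \<le> 1/2 * (1/2) ^ k" by (simp add: s_par_def)
    finally show "exp (- L_par k) \<le> 1/2 * (1/2) ^ k" .
  qed
  also have "\<dots> = 1 - (1/2) ^ Suc K" by (induction K) simp_all
  finally show ?thesis by (smt (verit) zero_le_power zero_le_divide_1_iff)
qed

lemma B_par_bounds:
  assumes R: "R \<ge> 0"
  shows B_par_pos: "B_par R k > 0"
    and B_par_square: "976/9 * s_par k * L_par k \<le> (B_par R k)\<^sup>2"
    and B_par_fourth: "1925648/675 * (s_par k * L_par k * (L_par k + R) / delta_par k) \<le> (B_par R k) ^ 4"
proof -
  define X where "X = 1925648/675 * (s_par k * L_par k * (L_par k + R) / delta_par k)"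
  define Y where "Y = 244/9 * s_par k * L_par k"
  note p = s_par_pos[of k] L_par_ge_one[of k] delta_par_pos[of k] delta_par_le[of k] s_par_le[of k]
  have X: "X > 0" unfolding X_def using p R by (intro mult_pos_pos divide_pos_pos add_pos_nonneg) auto
  have Y: "Y > 0" unfolding Y_def using p by simp
  define x where "x = X powr (1/4)"
  define y where "y = sqrt Y"
  have Bxy: "B_par R k = x + y" by (simp add: B_par_def x_def y_def X_def Y_def)
  have x: "x > 0" using X by (simp add: x_def)
  have y: "y > 0" using Y by (simp add: y_def)
  show "B_par R k > 0" using x y Bxy by simp
  have x4: "x ^ 4 = X" using X by (simp add: x_def powr_powr flip: powr_numeral)
  have y2: "y ^ 2 = Y" using Y by (simp add: y_def)
  have "x ^ 4 \<le> (x + y) ^ 4" using x y by (intro power_mono) auto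
  then show "1925648/675 * (s_par k * L_par k * (L_par k + R) / delta_par k) \<le> (B_par R k) ^ 4"
    unfolding x4 Bxy by (simp add: X_def)
  \<comment> \<open>This gives \<open>y \<le> x\<close>, hence \<open>2 * y \<le> x + y\<close>;
    squaring gains the factor 4 between 244/9 in the definition of \<open>B_par\<close> and 976/9 in
    the claim.\<close>
  have "Y\<^sup>2 \<le> X"
  proof -
    have "s_par k * delta_par k \<le> 60/7 * (1/10)" using p by (intro mult_mono) auto
    then have 1: "s_par k \<le> 6/7 / delta_par k" using p by (simp add: field_simps)
    have "Y\<^sup>2 = (244/9)\<^sup>2 * (s_par k * L_par k * L_par k) * s_par k"
      by (simp add: Y_def power2_eq_square)
    also have "\<dots> \<le> (244/9)\<^sup>2 * (s_par k * L_par k * L_par k) * (6/7 / delta_par k)"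
      using 1 p by (intro mult_left_mono) auto
    also have "\<dots> = ((244/9)\<^sup>2 * (6/7)) * (s_par k * L_par k * L_par k / delta_par k)" by simp
    also have "\<dots> \<le> 1925648/675 * (s_par k * L_par k * L_par k / delta_par k)"
      using p by (intro mult_right_mono) (auto simp: power2_eq_square)
    also have "\<dots> \<le> X"
      unfolding X_def using p R by (intro mult_left_mono divide_right_mono) auto
    finally show ?thesis .
  qed
  then have "(y\<^sup>2)\<^sup>2 \<le> (x\<^sup>2)\<^sup>2" using x4 y2 by (simp flip: power_mult)
  then have "y\<^sup>2 \<le> x\<^sup>2" by (rule power2_le_imp_le) simp
  then have "y \<le> x" by (rule power2_le_imp_le) (use x in simp)
  then have "(2 * y)\<^sup>2 \<le> (x + y)\<^sup>2" using y by (intro power_mono) auto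
  then show "976/9 * s_par k * L_par k \<le> (B_par R k)\<^sup>2"
    using y2 by (simp add: Bxy Y_def power_mult_distrib)
qed

text \<open>The constants of \<open>B_par\<close> are made for the two drift conditions: 976/9 = 8 *
  122/9 for the inner one, and 1925648/675 = 2 * 32 * 1973/100 * 122/9 * 1/6 for the outer one. Here
  32 comes from \<open>exp_L_par\<close>, 1/6 from the exponent of the potential, and 122/9 is four
  times 61/18.\<close>

lemma lambda_beta_par:
  assumes R: "R \<ge> 0"
  shows lambda_par_pos: "lambda_par R k > 0" and beta_par_pos: "beta_par R k > 0"
    and lambda_par_B: "lambda_par R k * B_par R k = L_par k"
    and beta_par_s: "beta_par R k * s_par k = B_par R k / 2"
    and inner_drift_par: "122/9 * lambda_par R k \<le> beta_par R k / 4"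
    and outer_drift_par: "lambda_par R k * (1973 / (100 * s_par k) * (122/9) *
      ((L_par k + R) / 6 * (exp (L_par k) * (s_par k / B_par R k)\<^sup>2))) \<le> beta_par R k"
proof -
  note p = s_par_pos[of k] L_par_ge_one[of k] delta_par_pos[of k] B_par_pos[OF R, of k]
  show "lambda_par R k > 0" "beta_par R k > 0" using p by (auto simp: lambda_par_def beta_par_def)
  show "lambda_par R k * B_par R k = L_par k" using p by (simp add: lambda_par_def)
  show "beta_par R k * s_par k = B_par R k / 2" using p by (simp add: beta_par_def)
  show "122/9 * lambda_par R k \<le> beta_par R k / 4"
    using B_par_square[OF R, of k] p by (simp add: lambda_par_def beta_par_def field_simps power2_eq_square)
  define s where "s = s_par k"
  define d where "d = delta_par k"
  define L where "L = L_par k"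
  define B where "B = B_par R k"
  have q: "s > 0" "d > 0" "B > 0" using p by (simp_all add: s_def d_def B_def)
  have "1925648/675 * (s * L * (L + R) / d) \<le> B ^ 4"
    using B_par_fourth[OF R, of k] by (simp add: s_def d_def L_def B_def)
  then have "1925648/675 * (s * L * (L + R) / d) / (2 * s * B ^ 3) \<le> B ^ 4 / (2 * s * B ^ 3)"
    using q by (intro divide_right_mono) auto
  also have "B ^ 4 / (2 * s * B ^ 3) = B / (2 * s)" using q by (simp add: power_numeral_reduce)
  also have "1925648/675 * (s * L * (L + R) / d) / (2 * s * B ^ 3) =
    L / B * (1973 / (100 * s) * (122/9) * ((L + R) / 6 * (32 / (d * s) * (s / B)\<^sup>2)))"
    using q by (simp add: field_simps power_numeral_reduce power2_eq_square)
  finally show "lambda_par R k * (1973 / (100 * s_par k) * (122/9) *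
      ((L_par k + R) / 6 * (exp (L_par k) * (s_par k / B_par R k)\<^sup>2))) \<le> beta_par R k"
    by (simp add: lambda_par_def beta_par_def exp_L_par s_def d_def L_def B_def)
qed

section \<open>Summing the thresholds \<open>B_par\<close> over the classes\<close>

lemma sum_arith_geo_le:
  fixes x a c :: real
  assumes "0 \<le> x" "x < 1" "0 \<le> a" "0 \<le> c"
  shows "(\<Sum>k<n. x ^ k * (a + c * real k)) \<le> a / (1 - x) + c * x / (1 - x)\<^sup>2"
proof -
  have nz: "1 - x \<noteq> 0" using assms by simp
  define y where "y = 1 / (1 - x)"
  have y: "y = 1 + x * y" using nz by (simp add: y_def field_simps)
  \<comment> \<open>\<open>(a + c * real n) * y + c * x * y * y\<close> is the infinite tail divided
    by \<open>x ^ n\<close>; partial sum plus tail does not depend on \<open>n\<close>.\<close>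
  have step: "x ^ n * (a + c * real n) + x ^ Suc n * ((a + c * (real n + 1)) * y + c * x * y * y) =
      x ^ n * ((a + c * real n) * y + c * x * y * y)" for n
  proof -
    have "x ^ n * ((a + c * real n) * y + c * x * y * y) =
        x ^ n * ((a + c * real n) * (1 + x * y) + c * x * y * (1 + x * y))"
      using y by simp
    also have "\<dots> = x ^ n * (a + c * real n) + x ^ Suc n * ((a + c * (real n + 1)) * y + c * x * y * y)"
      by (simp add: algebra_simps)
    finally show ?thesis by simp
  qed
  have "(\<Sum>k<n. x ^ k * (a + c * real k)) + x ^ n * ((a + c * real n) * y + c * x * y * y) = a * y + c * x * y * y"
  proof (induction n)
    case (Suc n)
    then show ?case using step[of n] by (simp add: algebra_simps)
  qed simp
  moreover have "x ^ n * ((a + c * real n) * y + c * x * y * y) \<ge> 0"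
    using assms by (simp add: y_def)
  ultimately show ?thesis by (simp add: y_def power2_eq_square)
qed

lemma exp_86_ge: "exp (86/100 :: real) \<ge> 34/15 * (102/100)"
proof -
  have "1 + 43/100 + (43/100)\<^sup>2 / 2 \<le> exp (43/100::real)" by (rule exp_lower_Taylor_quadratic) simp
  then have "(1 + 43/100 + (43/100)\<^sup>2 / 2) ^ 2 \<le> exp (43/100::real) ^ 2" by (intro power_mono) auto
  also have "\<dots> = exp (86/100)" by (simp flip: exp_of_nat_mult)
  finally show ?thesis by (simp add: power2_eq_square)
qed

lemma exp_41_ge: "exp (41/10 :: real) \<ge> 59"
proof -
  have "1 + 41/400 + (41/400)\<^sup>2 / 2 \<le> exp (41/400::real)" by (rule exp_lower_Taylor_quadratic) simp
  then have "(11077/10000::real) \<le> exp (41/400)" by (simp add: power2_eq_square)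
  then have "(11077/10000) ^ 40 \<le> exp (41/400::real) ^ 40" by (intro power_mono) auto
  also have "\<dots> = exp (41/10)" by (simp flip: exp_of_nat_mult)
  finally have "(11077/10000) ^ 40 \<le> exp (41/10 :: real)" .
  moreover have "(59::real) \<le> (11077/10000) ^ 40" by (simp add: field_simps)
  ultimately show ?thesis by linarith
qed

text \<open>From class 1 on, \<open>exp (L_par k)\<close> grows by 34/15 = 2 * 17/15 per class. The
  irregular first ratio \<open>w_par 0 / w_par 1\<close> is absorbed by the slack in 59 and by the
  factor 102/100.\<close>

lemma L_par_le: "L_par k \<le> 41/10 + 86/100 * real k"
proof -
  have "exp (L_par k) \<le> exp (41/10 + 86/100 * real k)"
  proof (cases k)
    case 0
    then have "exp (L_par k) \<le> 59"
      by (simp add: exp_L_par delta_par_def w_par_def s_par_def)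
    then have "exp (L_par k) \<le> exp (41/10)" using exp_41_ge by linarith
    then show ?thesis using 0 by simp
  next
    case (Suc n)
    have "exp (L_par k) = 32 / (43/80 * (123/1190) * (60/7) / 2 * (15/17 * (1/2)) ^ n)"
      unfolding Suc exp_L_par by (simp only: power_mult_distrib) (simp add: delta_par_def w_par_def s_par_def)
    also have "\<dots> = 32 / (43/80 * (123/1190) * (60/7) / 2) * (34/15) ^ n"
      by (simp add: power_divide)
    also have "\<dots> \<le> 59 * (34/15 * (102/100)) * (34/15 * (102/100)) ^ n"
      by (intro mult_mono power_mono) auto
    also have "\<dots> = 59 * (34/15 * (102/100)) ^ k" by (simp add: Suc)
    also have "\<dots> \<le> exp (41/10) * exp (86/100) ^ k"
      using exp_41_ge exp_86_ge by (intro mult_mono power_mono) auto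
    also have "\<dots> = exp (41/10 + 86/100 * real k)" by (simp only: exp_add exp_of_nat2_mult)
    finally show ?thesis .
  qed
  then show ?thesis by simp
qed

lemma s_par_over_delta_le: "s_par k / delta_par k \<le> 137 * (17/30) ^ k"
proof (cases k)
  case 0
  then show ?thesis by (simp add: delta_par_def w_par_def s_par_def)
next
  case (Suc n)
  have "s_par k / delta_par k = (60/7 / 2) / (43/80 * (123/1190)) * (17/30) ^ n"
    by (simp add: Suc delta_par_def w_par_def s_par_def power_divide field_simps flip: power_mult_distrib)
  also have "\<dots> \<le> (137 * (17/30)) * (17/30) ^ n" by (intro mult_right_mono) auto
  finally show ?thesis by (simp add: Suc)
qed

lemma B_par_le:
  assumes R: "R \<ge> 0"
  shows "B_par R k \<le> (1 + R) powr (1/4) *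
    (251/10 * ((217/250) ^ k * (11/5 + 3/20 * real k)) + 153/10 * ((7072/10000) ^ k * (11/5 + 3/20 * real k)))"
proof -
  define u where "u = 11/5 + 3/20 * real k"
  define t where "t = (1 + R) powr (1/4)"
  note p = s_par_pos[of k] L_par_ge_one[of k] delta_par_pos[of k]
  have u: "u > 0" by (simp add: u_def)
  have t: "t \<ge> 1" unfolding t_def using R by (simp add: ge_one_powr_ge_zero)
  have t4: "t ^ 4 = 1 + R" using R by (simp add: t_def powr_powr flip: powr_numeral)
  \<comment> \<open>The tangent of the square root at 9 is \<open>L / 6 + 3/2\<close>; it replaces
    the root of \<open>L_par k\<close> by an expression linear in \<open>k\<close>.\<close>
  have Lu: "L_par k \<le> u\<^sup>2"
  proof -
    have "L_par k / 6 + 3/2 \<le> u" using L_par_le[of k] by (simp add: u_def)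
    moreover have "L_par k \<le> (L_par k / 6 + 3/2)\<^sup>2"
      using sum_power2_ge_zero[of "L_par k / 6 - 3/2" 0] by (simp add: power2_eq_square algebra_simps)
    moreover have "(L_par k / 6 + 3/2)\<^sup>2 \<le> u\<^sup>2"
      using calculation p by (intro power_mono) auto
    ultimately show ?thesis by linarith
  qed
  define T where "T = 251/10 * ((217/250) ^ k * u)"
  have T: "T > 0" using u by (simp add: T_def)
  have "1925648/675 * (s_par k * L_par k * (L_par k + R) / delta_par k)
      = 1925648/675 * (s_par k / delta_par k) * (L_par k * (L_par k + R))" by simp
  also have "\<dots> \<le> 1925648/675 * (137 * (17/30) ^ k) * (u\<^sup>2 * (u\<^sup>2 * (1 + R)))"
  proof (intro mult_mono mult_left_mono s_par_over_delta_le Lu)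
    have "L_par k + R \<le> L_par k * (1 + R)" using mult_right_mono[OF p(2) R] by (simp add: algebra_simps)
    also have "\<dots> \<le> u\<^sup>2 * (1 + R)" using Lu R by (intro mult_right_mono) auto
    finally show "L_par k + R \<le> u\<^sup>2 * (1 + R)" .
  qed (use p R in auto)
  also have "\<dots> = (1925648/675 * 137) * ((17/30) ^ k * u ^ 4 * (1 + R))"
    by (simp add: power_numeral_reduce)
  \<comment> \<open>217/250 and 251/10 are rational upper bounds for the fourth roots of 17/30 and
    of the constant. In the square-root term, 7072/10000 and 153/10 play the same part for 1/2 and
    244/9 * 60/7.\<close>
  also have "\<dots> \<le> (251/10) ^ 4 * (((217/250) ^ 4) ^ k * u ^ 4 * (1 + R))"
    using R u by (intro mult_mono power_mono) (auto simp: power_numeral_reduce)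
  also have "\<dots> = (T * t) ^ 4"
    by (simp only: T_def t4 power_mult_distrib power_mult[symmetric]) (simp add: mult_ac)
  finally have "(1925648/675 * (s_par k * L_par k * (L_par k + R) / delta_par k)) powr (1/4) \<le> ((T * t) ^ 4) powr (1/4)"
    using p R by (intro powr_mono2) auto
  also have "\<dots> = T * t" using T t by (simp add: powr_powr flip: powr_numeral)
  finally have 1: "(1925648/675 * (s_par k * L_par k * (L_par k + R) / delta_par k)) powr (1/4) \<le> T * t" .
  define V where "V = 153/10 * ((7072/10000) ^ k * u)"
  have V: "V > 0" using u by (simp add: V_def)
  have "244/9 * s_par k * L_par k \<le> 244/9 * s_par k * u\<^sup>2" using Lu p by (intro mult_left_mono) auto
  also have "\<dots> = (244/9 * (60/7)) * ((1/2) ^ k * u\<^sup>2)" by (simp add: s_par_def)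
  also have "\<dots> \<le> (153/10)\<^sup>2 * (((7072/10000)\<^sup>2) ^ k * u\<^sup>2)"
    using u by (intro mult_mono power_mono) (auto simp: power2_eq_square)
  also have "\<dots> = V\<^sup>2"
    unfolding V_def power_mult_distrib power_mult[symmetric] by (simp only: mult.commute[of k 2])
  finally have "sqrt (244/9 * s_par k * L_par k) \<le> V" using V by (intro real_le_lsqrt) auto
  also have "V \<le> V * t" using V t by simp
  finally show ?thesis using 1 by (simp add: B_par_def T_def V_def u_def t_def algebra_simps)
qed

text \<open>The left-hand side dominates the discrepancy of a row: 26/10 of the threshold per class
  as in \<open>budget\<close>, while the 4 covers the 1 in \<open>budget\<close> and the 2 in
  \<open>good_discrepancy_le\<close>.\<close>

lemma sum_B_par_le:
  assumes R: "R \<ge> 0"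
  shows "(\<Sum>k<n. 26/10 * B_par R k) + 4 \<le> 2395 * (1 + R) powr (1/4)"
proof -
  define t where "t = (1 + R) powr (1/4)"
  have t: "t \<ge> 1" unfolding t_def using R by (simp add: ge_one_powr_ge_zero)
  have "(\<Sum>k<n. B_par R k) \<le> (\<Sum>k<n. t *
    (251/10 * ((217/250) ^ k * (11/5 + 3/20 * real k)) + 153/10 * ((7072/10000) ^ k * (11/5 + 3/20 * real k))))"
    unfolding t_def by (intro sum_mono B_par_le R)
  also have "\<dots> = t * (251/10 * (\<Sum>k<n. (217/250) ^ k * (11/5 + 3/20 * real k))
      + 153/10 * (\<Sum>k<n. (7072/10000) ^ k * (11/5 + 3/20 * real k)))"
    by (simp only: sum_distrib_left sum.distrib distrib_left)
  also have "\<dots> \<le> t * (251/10 * (11/5 / (1 - 217/250) + 3/20 * (217/250) / (1 - 217/250)\<^sup>2)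
      + 153/10 * (11/5 / (1 - 7072/10000) + 3/20 * (7072/10000) / (1 - 7072/10000)\<^sup>2))"
    using t by (intro mult_left_mono add_mono sum_arith_geo_le) auto
  also have "\<dots> \<le> t * 760" using t by (intro mult_left_mono) (auto simp: power2_eq_square)
  finally have "(\<Sum>k<n. B_par R k) \<le> t * 760" .
  moreover have "(\<Sum>k<n. 26/10 * B_par R k) = 26/10 * (\<Sum>k<n. B_par R k)" by (simp only: sum_distrib_left)
  ultimately show ?thesis using t unfolding t_def by linarith
qed

section \<open>Normalization\<close>

lemma restrict_to_nth [simp]: "restrict_to S v $ j = (if j \<in> S then v $ j else 0)"
  by (simp add: restrict_to_def)

lemma norm_square_vec: "(norm (v :: real ^ 'n::finite))\<^sup>2 = (\<Sum>j\<in>UNIV. (v $ j)\<^sup>2)"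
  by (simp add: norm_vec_def L2_set_def sum_nonneg)

text \<open>
  Every peeled entry exceeds \<open>s/B\<close>, so \<open>\<bar>t\<^sub>j\<bar> \<le> t\<^sub>j\<^sup>2 B/s\<close>.  Hence a peeled vector costs at most
  \<open>2 B\<close>, and only \<open>B\<close> if more than half of the energy survives the peeling.
\<close>

lemma peeled_inner_le:
  fixes v d :: "real ^ 'n::finite"
  assumes s: "s > 0" and B: "B > 0" and d: "\<And>j. \<bar>d $ j\<bar> \<le> 2"
  defines "t \<equiv> restrict_to {j. \<bar>v $ j\<bar> > s / B} v"
  shows "\<bar>t \<bullet> d\<bar> \<le> 2 * B / s * ((norm v)\<^sup>2 - (norm (v - t))\<^sup>2)"
proof -
  have "\<bar>t \<bullet> d\<bar> \<le> (\<Sum>j\<in>UNIV. \<bar>t $ j * d $ j\<bar>)" unfolding inner_vec_def by (simp add: sum_abs)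
  also have "\<dots> \<le> (\<Sum>j\<in>UNIV. 2 * B / s * ((v $ j)\<^sup>2 - ((v - t) $ j)\<^sup>2))"
  proof (rule sum_mono)
    fix j
    show "\<bar>t $ j * d $ j\<bar> \<le> 2 * B / s * ((v $ j)\<^sup>2 - ((v - t) $ j)\<^sup>2)"
    proof (cases "\<bar>v $ j\<bar> > s / B")
      case True
      then have "1 \<le> B / s * \<bar>v $ j\<bar>" using s B by (simp add: field_simps)
      then have "\<bar>v $ j\<bar> * 1 \<le> \<bar>v $ j\<bar> * (B / s * \<bar>v $ j\<bar>)" by (intro mult_left_mono) auto
      moreover have "2 * (\<bar>v $ j\<bar> * (B / s * \<bar>v $ j\<bar>)) = 2 * B / s * (v $ j)\<^sup>2"
        by (simp add: power2_eq_square)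
      ultimately have "\<bar>v $ j\<bar> * 2 \<le> 2 * B / s * (v $ j)\<^sup>2" by linarith
      moreover have "\<bar>v $ j\<bar> * \<bar>d $ j\<bar> \<le> \<bar>v $ j\<bar> * 2" using d by (intro mult_left_mono) auto
      ultimately show ?thesis using True by (simp add: t_def abs_mult)
    qed (simp add: t_def)
  qed
  also have "\<dots> = 2 * B / s * ((norm v)\<^sup>2 - (norm (v - t))\<^sup>2)"
    unfolding norm_square_vec by (simp only: sum_subtractf sum_distrib_left[symmetric])
  finally show ?thesis .
qed

text \<open>The peeled vectors are paid for at once, against every displacement with entries at most
  2, which is the width of the cube. They never have to be followed along the walk.\<close>

definition normalized_ok ::
    "real \<Rightarrow> nat \<Rightarrow> real ^ 'n \<Rightarrow> nat \<Rightarrow> real ^ 'n::finite \<Rightarrow> 'n row_status \<Rightarrow> bool" where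
  "normalized_ok R K u p v st =
    (case st of
       Large \<Rightarrow> False
     | Active c \<Rightarrow> p \<le> cls c \<and> cls c \<le> K \<and> anchor c = u \<and>
         (\<forall>j. coef c $ j = 0 \<or> coef c $ j = v $ j) \<and>
         (\<forall>j. \<bar>coef c $ j\<bar> \<le> s_par (cls c) / B_par R (cls c)) \<and>
         s_par (cls c) / 2 < (norm (coef c))\<^sup>2 \<and> (norm (coef c))\<^sup>2 \<le> s_par (cls c) \<and>
         (\<forall>y. (\<forall>j. \<bar>(y - u) $ j\<bar> \<le> 2) \<longrightarrow>
            \<bar>v \<bullet> (y - u) - coef c \<bullet> (y - u)\<bar> \<le> (\<Sum>k=p..<cls c. 2 * B_par R k) + B_par R (cls c))
     | Terminal w u' \<Rightarrow> u' = u \<and> (\<forall>j. w $ j = 0 \<or> w $ j = v $ j) \<and> (norm w)\<^sup>2 \<le> s_par (Suc K) \<and>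
         (\<forall>y. (\<forall>j. \<bar>(y - u) $ j\<bar> \<le> 2) \<longrightarrow>
            \<bar>v \<bullet> (y - u) - w \<bullet> (y - u)\<bar> \<le> (\<Sum>k=p..<Suc K. 2 * B_par R k)))"

lemma normalized_ok_step:
  assumes ok: "normalized_ok R K u (Suc p) v' st" and p: "p \<le> K"
    and c: "\<And>j. v' $ j = 0 \<or> v' $ j = v $ j"
    and d: "\<And>y. (\<forall>j. \<bar>(y - u) $ j\<bar> \<le> 2) \<Longrightarrow> \<bar>v \<bullet> (y - u) - v' \<bullet> (y - u)\<bar> \<le> 2 * B_par R p"
  shows "normalized_ok R K u p v st"
proof (cases st)
  case Large
  then show ?thesis using ok by (simp add: normalized_ok_def)
next
  case (Active q)
  have *: "Suc p \<le> cls q" using ok Active by (simp add: normalized_ok_def)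
  have e: "(\<Sum>k=p..<cls q. 2 * B_par R k) = 2 * B_par R p + (\<Sum>k=Suc p..<cls q. 2 * B_par R k)"
    using * by (simp add: sum.atLeast_Suc_lessThan)
  have "\<bar>v \<bullet> (y - u) - coef q \<bullet> (y - u)\<bar> \<le> (\<Sum>k=p..<cls q. 2 * B_par R k) + B_par R (cls q)"
    if y: "\<forall>j. \<bar>(y - u) $ j\<bar> \<le> 2" for y
  proof -
    have "\<bar>v' \<bullet> (y - u) - coef q \<bullet> (y - u)\<bar> \<le> (\<Sum>k=Suc p..<cls q. 2 * B_par R k) + B_par R (cls q)"
      using ok Active y by (simp add: normalized_ok_def)
    then show ?thesis using d[OF y] unfolding e by linarith
  qed
  moreover have "coef q $ j = 0 \<or> coef q $ j = v $ j" for j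
    using ok Active c[of j] by (auto simp: normalized_ok_def dest: spec[of _ j])
  ultimately show ?thesis using ok Active * by (simp add: normalized_ok_def)
next
  case (Terminal w u')
  have e: "(\<Sum>k=p..<Suc K. 2 * B_par R k) = 2 * B_par R p + (\<Sum>k=Suc p..<Suc K. 2 * B_par R k)"
    using p by (subst sum.atLeast_Suc_lessThan) auto
  have "\<bar>v \<bullet> (y - u) - w \<bullet> (y - u)\<bar> \<le> (\<Sum>k=p..<Suc K. 2 * B_par R k)"
    if y: "\<forall>j. \<bar>(y - u) $ j\<bar> \<le> 2" for y
  proof -
    have "\<bar>v' \<bullet> (y - u) - w \<bullet> (y - u)\<bar> \<le> (\<Sum>k=Suc p..<Suc K. 2 * B_par R k)"
      using ok Terminal y by (simp add: normalized_ok_def)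
    then show ?thesis using d[OF y] unfolding e by linarith
  qed
  moreover have "w $ j = 0 \<or> w $ j = v $ j" for j
    using ok Terminal c[of j] by (auto simp: normalized_ok_def dest: spec[of _ j])
  ultimately show ?thesis using ok Terminal by (simp add: normalized_ok_def)
qed

lemma normalize_ok:
  assumes R: "R \<ge> 0"
  shows "p \<le> Suc K \<Longrightarrow> (norm v)\<^sup>2 \<le> s_par p \<Longrightarrow> normalized_ok R K u p v (snd (normalize R K u p v))"
proof (induction "Suc K - p" arbitrary: p v)
  case 0
  then have p: "p = Suc K" by simp
  have "normalize R K u (Suc K) v = ([], Terminal v u)" by (subst normalize.simps) simp
  then show ?case using 0 by (simp add: p normalized_ok_def)
next
  case (Suc n)
  then have p: "p \<le> K" by simp
  have IH: "normalized_ok R K u (Suc p) v' (snd (normalize R K u (Suc p) v'))"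
    if "(norm v')\<^sup>2 \<le> s_par (Suc p)" for v'
    using Suc.hyps p that by (intro Suc.hyps(1)) auto
  note Bp = B_par_pos[OF R, of p]
  define t where "t = restrict_to {j. \<bar>v $ j\<bar> > s_par p / B_par R p} v"
  have nv: "normalize R K u p v =
     (if (norm v)\<^sup>2 \<le> s_par (Suc p) then normalize R K u (Suc p) v
      else if (norm (v - t))\<^sup>2 > s_par (Suc p) then ([Piece p t u], Active (Piece p (v - t) u))
          else (case normalize R K u (Suc p) (v - t) of
                  (ps, st) \<Rightarrow> (Piece p t u # ps, st)))"
    using p by (subst normalize.simps) (simp add: t_def Let_def)
  have t: "\<bar>v \<bullet> (y - u) - (v - t) \<bullet> (y - u)\<bar> \<le> 2 * B_par R p / s_par p * (s_par p - (norm (v - t))\<^sup>2)"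
    if "\<forall>j. \<bar>(y - u) $ j\<bar> \<le> 2" for y
  proof -
    have "\<bar>t \<bullet> (y - u)\<bar> \<le> 2 * B_par R p / s_par p * ((norm v)\<^sup>2 - (norm (v - t))\<^sup>2)"
      unfolding t_def using that by (intro peeled_inner_le s_par_pos Bp) auto
    also have "\<dots> \<le> 2 * B_par R p / s_par p * (s_par p - (norm (v - t))\<^sup>2)"
      using Suc.prems Bp s_par_pos[of p] by (intro mult_left_mono) auto
    finally show ?thesis by (simp add: inner_diff_left)
  qed
  consider (skip) "(norm v)\<^sup>2 \<le> s_par (Suc p)"
    | (active) "\<not> (norm v)\<^sup>2 \<le> s_par (Suc p)" "(norm (v - t))\<^sup>2 > s_par (Suc p)"
    | (down) "\<not> (norm v)\<^sup>2 \<le> s_par (Suc p)" "(norm (v - t))\<^sup>2 \<le> s_par (Suc p)" by linarith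
  then show ?case
  proof cases
    case skip
    have "normalized_ok R K u p v (snd (normalize R K u (Suc p) v))"
      by (rule normalized_ok_step[OF IH[OF skip] p]) (use Bp in auto)
    then show ?thesis using skip by (simp add: nv)
  next
    case active
    have "(norm (v - t))\<^sup>2 \<le> (norm v)\<^sup>2"
      unfolding norm_square_vec by (intro sum_mono) (simp add: t_def)
    then have le: "(norm (v - t))\<^sup>2 \<le> s_par p" using Suc.prems(2) by (rule order_trans)
    have "\<bar>v \<bullet> (y - u) - (v - t) \<bullet> (y - u)\<bar> \<le> B_par R p" if y: "\<forall>j. \<bar>(y - u) $ j\<bar> \<le> 2" for y
    proof -
      have "2 * B_par R p / s_par p * (s_par p - (norm (v - t))\<^sup>2) \<le> 2 * B_par R p / s_par p * (s_par p / 2)"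
        using active(2) Bp s_par_pos[of p] by (intro mult_left_mono) (auto simp: s_par_Suc)
      also have "\<dots> = B_par R p" using s_par_pos[of p] by simp
      finally show ?thesis using t[OF y] by linarith
    qed
    moreover have "\<bar>(v - t) $ j\<bar> \<le> s_par p / B_par R p" for j
      using Bp s_par_pos[of p] by (simp add: t_def)
    ultimately show ?thesis
      using active p le by (auto simp: nv normalized_ok_def t_def s_par_Suc)
  next
    case down
    have "normalized_ok R K u p v (snd (normalize R K u (Suc p) (v - t)))"
    proof (rule normalized_ok_step[OF IH[OF down(2)] p])
      fix y assume y: "\<forall>j. \<bar>(y - u) $ j\<bar> \<le> 2"
      have "2 * B_par R p / s_par p * (s_par p - (norm (v - t))\<^sup>2) \<le> 2 * B_par R p / s_par p * s_par p"
        using Bp s_par_pos[of p] by (intro mult_left_mono) auto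
      also have "\<dots> = 2 * B_par R p" using s_par_pos[of p] by simp
      finally show "\<bar>v \<bullet> (y - u) - (v - t) \<bullet> (y - u)\<bar> \<le> 2 * B_par R p" using t[OF y] by linarith
    qed (simp add: t_def)
    then show ?thesis using down by (simp add: nv case_prod_beta)
  qed
qed

section \<open>The mesh\<close>

text \<open>The exponent of the column potential and the largest weight of one record in it.\<close>

definition theta_par :: "real \<Rightarrow> nat \<Rightarrow> real" where
  "theta_par R k = (L_par k + R) / 6"

definition weight_par :: "real \<Rightarrow> nat \<Rightarrow> real" where
  "weight_par R k = theta_par R k * (exp (L_par k) * (s_par k / B_par R k)\<^sup>2)"

text \<open>The first three conditions are those on \<gamma> in
  \<open>expected_exp_sum_le_one\<close>. The last two say that the linear part of one step moves
  \<open>Z\<close> by at most \<open>B / 20\<close> and that rounding the dead coordinates costs at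
  most \<open>B / 20\<close>. \<open>N\<close> stands for the total weight of all records of the
  class.\<close>

definition small_mesh :: "real \<Rightarrow> nat \<Rightarrow> real \<Rightarrow> nat \<Rightarrow> real \<Rightarrow> bool" where
  "small_mesh R q N k \<gamma> \<longleftrightarrow>
     (let l = lambda_par R k; \<beta> = beta_par R k; P = 2 * sqrt (s_par k); s = s_par k;
          G0 = l * \<beta> * s + 5/4 * l\<^sup>2 * P\<^sup>2 + 5 * l\<^sup>2 * \<beta>\<^sup>2 * s\<^sup>2
      in l * (\<gamma> * P + \<gamma>\<^sup>2 * \<beta> * s) \<le> 1/2 \<and>
         \<gamma> * (l * N * P) + \<gamma>\<^sup>2 * (N * G0) \<le> 1/10 \<and>
         \<gamma>\<^sup>2 * (5 * l\<^sup>2 * \<beta>\<^sup>2 * s + 616/100 * N * G0 * (21/16 * l * \<beta> + 5 * l\<^sup>2 * \<beta>\<^sup>2 * s)) \<le> l * \<beta> / 20 \<and>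
         \<gamma> * P \<le> B_par R k / 20 \<and> \<gamma> * real q \<le> B_par R k / 20)"

text \<open>Each condition has the form \<open>\<gamma> * c + \<gamma>\<^sup>2 * d \<le> e\<close>
  with \<open>e > 0\<close>, so it holds for all small \<gamma>.\<close>

lemma eventually_small_mesh:
  assumes R: "R \<ge> 0"
  shows "eventually (small_mesh R q N k) (at_right 0)"
proof -
  have lin: "eventually (\<lambda>\<gamma>. \<gamma> * c + \<gamma>\<^sup>2 * d \<le> e) (at_right 0)" if "e > 0" for c d e :: real
  proof -
    have "((\<lambda>\<gamma>. \<gamma> * c + \<gamma>\<^sup>2 * d) \<longlongrightarrow> 0 * c + 0\<^sup>2 * d) (at_right 0)"
      by (intro tendsto_intros)
    then have "eventually (\<lambda>\<gamma>. \<gamma> * c + \<gamma>\<^sup>2 * d < e) (at_right 0)"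
      using that by (intro order_tendstoD) auto
    then show ?thesis by (rule eventually_mono) simp
  qed
  define l where "l = lambda_par R k"
  define \<beta> where "\<beta> = beta_par R k"
  define P where "P = 2 * sqrt (s_par k)"
  define s where "s = s_par k"
  define G0 where "G0 = l * \<beta> * s + 5/4 * l\<^sup>2 * P\<^sup>2 + 5 * l\<^sup>2 * \<beta>\<^sup>2 * s\<^sup>2"
  have pos: "l > 0" "\<beta> > 0" "B_par R k > 0"
    using lambda_par_pos[OF R] beta_par_pos[OF R] B_par_pos[OF R] by (auto simp: l_def \<beta>_def)
  have 1: "eventually (\<lambda>\<gamma>. \<gamma> * (l * P) + \<gamma>\<^sup>2 * (l * \<beta> * s) \<le> 1/2) (at_right 0)" by (rule lin) simp
  have 2: "eventually (\<lambda>\<gamma>. \<gamma> * (l * N * P) + \<gamma>\<^sup>2 * (N * G0) \<le> 1/10) (at_right 0)" by (rule lin) simp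
  have 3: "eventually (\<lambda>\<gamma>. \<gamma> * 0 + \<gamma>\<^sup>2 * (5 * l\<^sup>2 * \<beta>\<^sup>2 * s + 616/100 * N * G0 * (21/16 * l * \<beta> + 5 * l\<^sup>2 * \<beta>\<^sup>2 * s)) \<le> l * \<beta> / 20) (at_right 0)"
    by (rule lin) (use pos in simp)
  have 4: "eventually (\<lambda>\<gamma>. \<gamma> * P + \<gamma>\<^sup>2 * 0 \<le> B_par R k / 20) (at_right 0)" by (rule lin) (use pos in simp)
  have 5: "eventually (\<lambda>\<gamma>. \<gamma> * real q + \<gamma>\<^sup>2 * 0 \<le> B_par R k / 20) (at_right 0)" by (rule lin) (use pos in simp)
  show ?thesis
    using 1 2 3 4 5
  proof eventually_elim
    case (elim \<gamma>)
    have "l * (\<gamma> * P + \<gamma>\<^sup>2 * \<beta> * s) = \<gamma> * (l * P) + \<gamma>\<^sup>2 * (l * \<beta> * s)" by (simp add: algebra_simps)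
    then show ?case using elim
      unfolding small_mesh_def Let_def l_def \<beta>_def P_def s_def G0_def by simp
  qed
qed

lemma mesh_exists:
  assumes R: "R \<ge> 0" and fin: "finite J" and J: "\<And>j. j \<in> J \<Longrightarrow> f j < (1::real)"
  obtains \<gamma> where "0 < \<gamma>" "\<gamma> < 1/2" "\<And>j. j \<in> J \<Longrightarrow> \<gamma> < 1 - f j" "\<gamma> * real q \<le> 1"
    "\<And>k. k \<le> K \<Longrightarrow> small_mesh R q (N k) k \<gamma>"
proof -
  have lt: "eventually (\<lambda>\<gamma>::real. \<gamma> < c) (at_right 0)" if "c > 0" for c
    using that by (rule eventually_at_right_real[THEN eventually_mono]) auto
  have "eventually (\<lambda>\<gamma>::real. 0 < \<gamma>) (at_right 0)" by (simp add: eventually_at_right_less)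
  moreover have "eventually (\<lambda>\<gamma>::real. \<gamma> < 1/2) (at_right 0)" by (rule lt) simp
  moreover have "eventually (\<lambda>\<gamma>::real. \<forall>j\<in>J. \<gamma> < 1 - f j) (at_right 0)"
    using fin J lt by (intro eventually_ball_finite) auto
  moreover have "eventually (\<lambda>\<gamma>::real. \<gamma> < 1 / (real q + 1)) (at_right 0)" by (rule lt) simp
  moreover have "eventually (\<lambda>\<gamma>::real. \<forall>k\<in>{..K}. small_mesh R q (N k) k \<gamma>) (at_right 0)"
    using eventually_small_mesh[OF R] by (intro eventually_ball_finite) auto
  ultimately have "eventually (\<lambda>\<gamma>::real. 0 < \<gamma> \<and> \<gamma> < 1/2 \<and> (\<forall>j\<in>J. \<gamma> < 1 - f j) \<and> \<gamma> * real q \<le> 1 \<and>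
      (\<forall>k\<in>{..K}. small_mesh R q (N k) k \<gamma>)) (at_right 0)"
  proof eventually_elim
    case (elim \<gamma>)
    then have "\<gamma> * (real q + 1) < 1" by (simp add: field_simps)
    then show ?case using elim by (simp add: algebra_simps)
  qed
  then obtain \<gamma> where "0 < \<gamma> \<and> \<gamma> < 1/2 \<and> (\<forall>j\<in>J. \<gamma> < 1 - f j) \<and> \<gamma> * real q \<le> 1 \<and>
      (\<forall>k\<in>{..K}. small_mesh R q (N k) k \<gamma>)"
    using eventually_happens'[OF trivial_limit_at_right_real] by blast
  then show ?thesis by (intro that[of \<gamma>]) auto
qed

text \<open>\<open>Z\<close> is a quadratic polynomial with gradient \<open>e_vec\<close>, so the
  expansion is exact. Its second-order term has a fixed sign and is the source of the negative
  drift.\<close>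

lemma Z_val_step:
  "Z_val R p \<epsilon> (x + \<gamma> *\<^sub>R v) - Z_val R p \<epsilon> x =
     \<gamma> * (e_vec R p \<epsilon> x \<bullet> v) - \<gamma>\<^sup>2 * beta_par R (cls p) * (\<Sum>j\<in>UNIV. (coef p $ j)\<^sup>2 * (v $ j)\<^sup>2)"
proof -
  have 1: "(\<Sum>j\<in>UNIV. (coef p $ j)\<^sup>2 * ((anchor p $ j)\<^sup>2 - ((x + \<gamma> *\<^sub>R v) $ j)\<^sup>2)) =
     (\<Sum>j\<in>UNIV. (coef p $ j)\<^sup>2 * ((anchor p $ j)\<^sup>2 - (x $ j)\<^sup>2))
     - 2 * \<gamma> * (\<Sum>j\<in>UNIV. (coef p $ j)\<^sup>2 * x $ j * v $ j) - \<gamma>\<^sup>2 * (\<Sum>j\<in>UNIV. (coef p $ j)\<^sup>2 * (v $ j)\<^sup>2)"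
    unfolding sum_distrib_left sum_subtractf[symmetric]
    by (intro sum.cong refl) (simp add: power2_eq_square algebra_simps)
  have 2: "e_vec R p \<epsilon> x \<bullet> v = sign_of \<epsilon> * (coef p \<bullet> v) - 2 * beta_par R (cls p) * (\<Sum>j\<in>UNIV. (coef p $ j)\<^sup>2 * x $ j * v $ j)"
    unfolding inner_vec_def sum_distrib_left sum_subtractf[symmetric]
    by (intro sum.cong refl) (simp add: e_vec_def algebra_simps)
  show ?thesis
    unfolding Z_val_def 1 2 by (simp add: inner_diff_right inner_add_right algebra_simps)
qed

text \<open>The peeling threshold \<open>s / B\<close> and \<open>\<beta> = B / (2 * s)\<close> are
  matched: twice their product is 1, so the correction in the gradient never exceeds the main
  term.\<close>

lemma e_vec_le:
  assumes R: "R \<ge> 0" and c: "\<And>j. \<bar>coef p $ j\<bar> \<le> s_par (cls p) / B_par R (cls p)" and x: "\<And>j. \<bar>x $ j\<bar> \<le> 1"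
  shows "\<bar>e_vec R p \<epsilon> x $ j\<bar> \<le> 2 * \<bar>coef p $ j\<bar>"
proof -
  let ?c = "coef p $ j" and ?\<beta> = "beta_par R (cls p)"
  note pos = s_par_pos[of "cls p"] B_par_pos[OF R, of "cls p"] beta_par_pos[OF R, of "cls p"]
  have "2 * ?\<beta> * \<bar>?c\<bar> \<le> 2 * ?\<beta> * (s_par (cls p) / B_par R (cls p))"
    using c[of j] pos by (intro mult_left_mono) auto
  also have "\<dots> = 1" using pos by (simp add: beta_par_def)
  finally have "2 * ?\<beta> * \<bar>?c\<bar> * \<bar>x $ j\<bar> \<le> 1 * 1" using x[of j] pos by (intro mult_mono) auto
  then have "\<bar>?c\<bar> * (2 * ?\<beta> * \<bar>?c\<bar> * \<bar>x $ j\<bar>) \<le> \<bar>?c\<bar> * 1" by (intro mult_left_mono) auto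
  moreover have "\<bar>2 * ?\<beta> * (?c\<^sup>2 * x $ j)\<bar> = \<bar>?c\<bar> * (2 * ?\<beta> * \<bar>?c\<bar> * \<bar>x $ j\<bar>)"
    using pos by (simp add: abs_mult power2_eq_square)
  moreover have "\<bar>sign_of \<epsilon> * ?c\<bar> = \<bar>?c\<bar>" by (simp add: sign_of_def)
  ultimately show ?thesis
    unfolding e_vec_def using abs_triangle_ineq4[of "sign_of \<epsilon> * ?c" "2 * ?\<beta> * (?c\<^sup>2 * x $ j)"] by simp
qed

section \<open>Discrepancy along the walk\<close>

text \<open>The data are already cut down to \<open>J\<close>, so \<open>a\<close> and
  \<open>b\<close> vanish outside it. In \<open>mesh\<close>, at most two signed records per row are
  in play in a class, each of weight at most \<open>weight_par R k\<close>.\<close>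

locale rounding_walk =
  fixes J :: "'n::finite set" and a :: "real ^ 'n ^ 'm::finite" and b :: "real ^ 'n"
    and R :: real and K :: nat and \<gamma> :: real
  assumes R: "R \<ge> 0" and card_J: "card J > 8"
    and cols: "\<And>j. (\<Sum>i\<in>UNIV. (a $ i $ j)\<^sup>2) \<le> 1"
    and supp: "\<And>i j. j \<notin> J \<Longrightarrow> a $ i $ j = 0"
    and b_in: "\<And>j. j \<in> J \<Longrightarrow> \<gamma> < 1 - \<bar>b $ j\<bar>" and b_out: "\<And>j. j \<notin> J \<Longrightarrow> b $ j = 0"
    and K: "s_par (Suc K) \<le> 1 / real (card J)"
    and \<gamma>: "0 < \<gamma>" "\<gamma> < 1/2" "\<gamma> * real (card J) \<le> 1"
    and mesh: "\<And>k. k \<le> K \<Longrightarrow> small_mesh R (card J) (2 * real CARD('m) * weight_par R k) k \<gamma>"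
begin

lemma entry_le: "\<bar>a $ i $ j\<bar> \<le> 1"
proof -
  have "(a $ i $ j)\<^sup>2 \<le> (\<Sum>i\<in>UNIV. (a $ i $ j)\<^sup>2)" by (rule member_le_sum) auto
  then have "(a $ i $ j)\<^sup>2 \<le> 1" using cols[of j] by linarith
  then show ?thesis by (simp add: abs_square_le_1)
qed

text \<open>\<open>near x y\<close> holds for everything that the dead coordinates of \<open>x\<close> may still be rounded to.\<close>

definition near :: "real ^ 'n \<Rightarrow> real ^ 'n \<Rightarrow> bool" where
  "near x y \<longleftrightarrow> (\<forall>j. \<bar>y $ j\<bar> \<le> 1) \<and> (\<forall>j\<in>J. j \<notin> alive J \<gamma> x \<longrightarrow> \<bar>y $ j - x $ j\<bar> \<le> \<gamma>)"

text \<open>26/10 = 1 + 21/20 + 1/2 + 1/20: the peeled vector stored at a birth, the largest value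
  of \<open>Z\<close>, the compensator inside \<open>Z\<close>, and the rounding of coordinates that
  died meanwhile. The leading 1 pays for those that died while the row was large.\<close>

definition budget :: "nat \<Rightarrow> real" where
  "budget k = 1 + (\<Sum>k'<k. 26/10 * B_par R k')"

lemma budget_add:
  assumes "p \<le> k"
  shows "budget p + (\<Sum>l=p..<k. 2 * B_par R l) \<le> budget k"
proof -
  have "(\<Sum>l<k. 26/10 * B_par R l) = (\<Sum>l<p. 26/10 * B_par R l) + (\<Sum>l=p..<k. 26/10 * B_par R l)"
    using assms by (simp add: lessThan_atLeast0 sum.atLeastLessThan_concat)
  moreover have "(\<Sum>l=p..<k. 2 * B_par R l) \<le> (\<Sum>l=p..<k. 26/10 * B_par R l)"
    using B_par_pos[OF R] by (intro sum_mono) (simp add: less_imp_le)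
  ultimately show ?thesis by (simp add: budget_def)
qed

text \<open>The discrepancy bounds range over all \<open>y\<close> near \<open>x\<close>, so later
  rounding of coordinates that are already dead is included. A dangerous value may exceed
  \<open>B\<close> by the overshoot \<open>B / 20\<close> of the step that made it dangerous; it
  never grows afterwards. The last conjunct confines dangerous records to current restrictions, the
  only ones that \<open>card_dangerous_rows_le\<close> counts.\<close>

definition row_ok :: "real ^ 'n \<Rightarrow> 'm \<Rightarrow> 'n row_status \<Rightarrow> ('n piece \<Rightarrow> bool \<Rightarrow> signed_record option) \<Rightarrow> bool" where
  "row_ok x i st rc \<longleftrightarrow>
    (case st of
       Large \<Rightarrow> M_par < alive_energy J \<gamma> x (a $ i) \<and> a $ i \<bullet> (x - b) = 0
     | Active p \<Rightarrow> cls p \<le> K \<and> (\<forall>j. coef p $ j = 0 \<or> coef p $ j = a $ i $ j) \<and>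
         (\<forall>j. \<bar>coef p $ j\<bar> \<le> s_par (cls p) / B_par R (cls p)) \<and>
         (norm (coef p))\<^sup>2 \<le> s_par (cls p) \<and>
         s_par (cls p) / 2 < alive_energy J \<gamma> x (coef p) \<and> (\<forall>j. \<bar>anchor p $ j\<bar> \<le> 1) \<and>
         (\<forall>\<epsilon>. \<exists>rs X. rc p \<epsilon> = Some (SRec rs X) \<and>
            (rs = Live \<and> Z_val R p \<epsilon> x < B_par R (cls p) \<or>
             rs = Dangerous \<and> Z_val R p \<epsilon> x \<le> 21/20 * B_par R (cls p))) \<and>
         (\<forall>y. near x y \<longrightarrow>
            \<bar>a $ i \<bullet> (y - b) - coef p \<bullet> (y - anchor p)\<bar> \<le> budget (cls p) + B_par R (cls p))
     | Terminal w u \<Rightarrow> (\<forall>j. w $ j = 0 \<or> w $ j = a $ i $ j) \<and> (norm w)\<^sup>2 \<le> s_par (Suc K) \<and>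
         (\<forall>j. \<bar>u $ j\<bar> \<le> 1) \<and>
         (\<forall>y. near x y \<longrightarrow> \<bar>a $ i \<bullet> (y - b) - w \<bullet> (y - u)\<bar> \<le> budget (Suc K))) \<and>
    (\<forall>p \<epsilon> X. rc p \<epsilon> = Some (SRec Dangerous X) \<longrightarrow> st = Active p)"

lemma alive_energy_eq_norm:
  assumes "\<And>j. j \<notin> alive J \<gamma> x \<Longrightarrow> c $ j = 0"
  shows "alive_energy J \<gamma> x c = (norm c)\<^sup>2"
  unfolding alive_energy_def norm_square_vec using assms by (intro sum.mono_neutral_left) auto

lemma norm_restrict_alive: "(norm (restrict_to (alive J \<gamma> x) c))\<^sup>2 = alive_energy J \<gamma> x c"
proof -
  have "alive_energy J \<gamma> x (restrict_to (alive J \<gamma> x) c) = (norm (restrict_to (alive J \<gamma> x) c))\<^sup>2"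
    by (rule alive_energy_eq_norm) simp
  then show ?thesis by (simp add: alive_energy_def)
qed

text \<open>Serves all births: at the start, of a large row that has become small, and after a
  retirement. \<open>acc\<close> is the discrepancy charged before class \<open>p\<close>. A newborn
  has \<open>Z = 0\<close>, because its anchor is the current point.\<close>

lemma normalized_row_ok:
  assumes x: "\<And>j. \<bar>x $ j\<bar> \<le> 1"
    and z: "\<And>j. z $ j = 0 \<or> z $ j = a $ i $ j" "\<And>j. j \<notin> alive J \<gamma> x \<Longrightarrow> z $ j = 0"
    and p: "p \<le> Suc K" "(norm z)\<^sup>2 \<le> s_par p"
    and acc: "\<And>y. near x y \<Longrightarrow> \<bar>a $ i \<bullet> (y - b) - z \<bullet> (y - x)\<bar> \<le> budget p"
    and st: "st = snd (normalize R K x p z)"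
    and rc: "\<And>c \<epsilon>. st = Active c \<Longrightarrow> rc c \<epsilon> = Some (SRec Live 1)"
      "\<And>c \<epsilon> X. rc c \<epsilon> \<noteq> Some (SRec Dangerous X)"
  shows "row_ok x i st rc"
proof -
  have ok: "normalized_ok R K x p z st" unfolding st by (rule normalize_ok[OF R p])
  have near2: "\<forall>j. \<bar>(y - x) $ j\<bar> \<le> 2" if "near x y" for y
  proof
    fix j
    have "\<bar>y $ j\<bar> \<le> 1" using that by (simp add: near_def)
    with x[of j] show "\<bar>(y - x) $ j\<bar> \<le> 2" by simp
  qed
  show ?thesis
  proof (cases st)
    case Large
    then show ?thesis using ok by (simp add: normalized_ok_def)
  next
    case (Active c)
    note o = ok[unfolded normalized_ok_def Active row_status.case]
    have cz: "coef c $ j = 0 \<or> coef c $ j = z $ j" for j using o by blast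
    then have "alive_energy J \<gamma> x (coef c) = (norm (coef c))\<^sup>2"
      using z(2) by (intro alive_energy_eq_norm) metis
    moreover have "coef c $ j = 0 \<or> coef c $ j = a $ i $ j" for j using cz[of j] z(1)[of j] by auto
    moreover have "\<bar>a $ i \<bullet> (y - b) - coef c \<bullet> (y - x)\<bar> \<le> budget (cls c) + B_par R (cls c)" if y: "near x y" for y
    proof -
      have "\<bar>z \<bullet> (y - x) - coef c \<bullet> (y - x)\<bar> \<le> (\<Sum>k=p..<cls c. 2 * B_par R k) + B_par R (cls c)"
        using o near2[OF y] by simp
      moreover have "budget p + (\<Sum>l=p..<cls c. 2 * B_par R l) \<le> budget (cls c)"
        using o by (intro budget_add) simp
      ultimately show ?thesis using acc[OF y] by linarith
    qed
    moreover have "Z_val R c \<epsilon> x < B_par R (cls c)" for \<epsilon>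
      using o B_par_pos[OF R, of "cls c"] by (simp add: Z_val_def)
    ultimately show ?thesis using o x rc(1)[OF Active] rc(2) by (simp add: row_ok_def Active)
  next
    case (Terminal w u)
    note o = ok[unfolded normalized_ok_def Terminal row_status.case]
    have cz: "w $ j = 0 \<or> w $ j = z $ j" for j using o by blast
    have "w $ j = 0 \<or> w $ j = a $ i $ j" for j using cz[of j] z(1)[of j] by auto
    moreover have "\<bar>a $ i \<bullet> (y - b) - w \<bullet> (y - x)\<bar> \<le> budget (Suc K)" if y: "near x y" for y
    proof -
      have "\<bar>z \<bullet> (y - x) - w \<bullet> (y - x)\<bar> \<le> (\<Sum>k=p..<Suc K. 2 * B_par R k)"
        using ok near2[OF y] by (simp add: normalized_ok_def Terminal)
      moreover have "budget p + (\<Sum>l=p..<Suc K. 2 * B_par R l) \<le> budget (Suc K)"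
        using p by (intro budget_add) simp
      ultimately show ?thesis using acc[OF y] by linarith
    qed
    ultimately show ?thesis using ok x rc(2) by (simp add: row_ok_def normalized_ok_def Terminal)
  qed
qed

lemma dead_inner_le:
  assumes c: "\<And>j. \<bar>c $ j\<bar> \<le> 1" "\<And>j. j \<notin> J \<Longrightarrow> c $ j = 0" "\<And>j. j \<in> alive J \<gamma> x \<Longrightarrow> c $ j = 0"
    and y: "near x y"
  shows "\<bar>c \<bullet> (y - x)\<bar> \<le> \<gamma> * real (card J)"
proof -
  have "\<bar>c \<bullet> (y - x)\<bar> \<le> (\<Sum>j\<in>UNIV. \<bar>c $ j * (y - x) $ j\<bar>)" by (simp add: inner_vec_def sum_abs)
  also have "\<dots> = (\<Sum>j\<in>J. \<bar>c $ j * (y - x) $ j\<bar>)" using c(2) by (intro sum.mono_neutral_right) auto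
  also have "\<dots> \<le> (\<Sum>j\<in>J. \<gamma>)"
  proof (rule sum_mono)
    fix j assume j: "j \<in> J"
    show "\<bar>c $ j * (y - x) $ j\<bar> \<le> \<gamma>"
    proof (cases "j \<in> alive J \<gamma> x")
      case True
      then show ?thesis using c(3) \<gamma> by simp
    next
      case False
      then have "\<bar>y $ j - x $ j\<bar> \<le> \<gamma>" using y j by (simp add: near_def)
      then have "\<bar>c $ j\<bar> * \<bar>y $ j - x $ j\<bar> \<le> 1 * \<gamma>" using c(1)[of j] \<gamma> by (intro mult_mono) auto
      then show ?thesis by (simp add: abs_mult)
    qed
  qed
  finally show ?thesis by (simp add: mult.commute)
qed

lemma abs_inner_e_vec_le:
  assumes x: "\<And>j. \<bar>x $ j\<bar> \<le> 1" and c: "\<And>j. \<bar>coef p $ j\<bar> \<le> s_par (cls p) / B_par R (cls p)"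
    and n: "(norm (coef p))\<^sup>2 \<le> s_par (cls p)" and v: "norm v \<le> 1"
  shows "\<bar>e_vec R p \<epsilon> x \<bullet> v\<bar> \<le> 2 * sqrt (s_par (cls p))"
proof -
  have "norm (e_vec R p \<epsilon> x) \<le> norm (2 *\<^sub>R coef p)"
    using e_vec_le[OF R c x] by (intro norm_le_componentwise_cart) (simp add: abs_mult)
  also have "\<dots> = 2 * sqrt ((norm (coef p))\<^sup>2)" by simp
  also have "\<dots> \<le> 2 * sqrt (s_par (cls p))" using n by (intro mult_left_mono real_sqrt_le_mono) auto
  finally have "norm (e_vec R p \<epsilon> x) \<le> 2 * sqrt (s_par (cls p))" .
  moreover have "\<bar>e_vec R p \<epsilon> x \<bullet> v\<bar> \<le> norm (e_vec R p \<epsilon> x) * norm v" by (rule Cauchy_Schwarz_ineq2)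
  moreover have "norm (e_vec R p \<epsilon> x) * norm v \<le> norm (e_vec R p \<epsilon> x) * 1" using v by (intro mult_left_mono) auto
  ultimately show ?thesis by linarith
qed

text \<open>The compensator in \<open>Z\<close> is at least \<open>- \<beta> * s = - B / 2\<close>,
  so upper bounds on \<open>Z\<close> for both signs bound the linear part from both sides.\<close>

lemma abs_coef_inner_le:
  assumes Z: "\<And>\<epsilon>. Z_val R p \<epsilon> x \<le> z" and x: "\<And>j. \<bar>x $ j\<bar> \<le> 1"
    and n: "(norm (coef p))\<^sup>2 \<le> s_par (cls p)"
  shows "\<bar>coef p \<bullet> (x - anchor p)\<bar> \<le> z + B_par R (cls p) / 2"
proof -
  let ?S = "\<Sum>j\<in>UNIV. (coef p $ j)\<^sup>2 * ((anchor p $ j)\<^sup>2 - (x $ j)\<^sup>2)"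
  note \<beta> = beta_par_pos[OF R, of "cls p"]
  have "- s_par (cls p) \<le> (\<Sum>j\<in>UNIV. (coef p $ j)\<^sup>2 * (- 1))"
    using n by (simp add: norm_square_vec sum_negf)
  also have "\<dots> \<le> ?S"
  proof (intro sum_mono mult_left_mono)
    fix j
    have "(x $ j)\<^sup>2 \<le> 1" using x by (simp add: abs_square_le_1)
    then show "- 1 \<le> (anchor p $ j)\<^sup>2 - (x $ j)\<^sup>2" using zero_le_power2[of "anchor p $ j"] by linarith
  qed simp
  finally have "beta_par R (cls p) * (- s_par (cls p)) \<le> beta_par R (cls p) * ?S"
    using \<beta> by (intro mult_left_mono) auto
  then have "- (B_par R (cls p) / 2) \<le> beta_par R (cls p) * ?S"
    using beta_par_s[OF R, of "cls p"] by simp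
  then show ?thesis using Z[of True] Z[of False] by (simp add: Z_val_def sign_of_def abs_le_iff)
qed

end

section \<open>A single step along a unit vector supported on the alive coordinates\<close>

locale walk_step = rounding_walk J a b R K \<gamma>
  for J :: "'n::finite set" and a :: "real ^ 'n ^ 'm::finite" and b R K \<gamma> +
  fixes x v :: "real ^ 'n"
  assumes x_cube: "\<And>j. \<bar>x $ j\<bar> \<le> 1"
    and v_norm: "norm v = 1" and v_supp: "\<And>j. j \<notin> alive J \<gamma> x \<Longrightarrow> v $ j = 0"
begin

abbreviation x' :: "real ^ 'n" where "x' \<equiv> x + \<gamma> *\<^sub>R v"

lemma v_le: "\<bar>v $ j\<bar> \<le> 1"
  using component_le_norm_cart[of v j] v_norm by simp

lemma x'_cube: "\<bar>x' $ j\<bar> \<le> 1"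
proof (cases "j \<in> alive J \<gamma> x")
  case True
  then have "\<bar>x $ j\<bar> < 1 - \<gamma>" by (simp add: alive_def)
  moreover have "\<gamma> * \<bar>v $ j\<bar> \<le> \<gamma> * 1" using v_le[of j] \<gamma> by (intro mult_left_mono) auto
  then have "\<bar>\<gamma> * v $ j\<bar> \<le> \<gamma>" using \<gamma> by (simp add: abs_mult)
  ultimately show ?thesis by simp
next
  case False
  then show ?thesis using v_supp x_cube[of j] by simp
qed

text \<open>A step does not move dead coordinates, so each of them stays where it died.\<close>

lemma alive_x': "alive J \<gamma> x' \<subseteq> alive J \<gamma> x"
proof
  fix j assume "j \<in> alive J \<gamma> x'"
  then show "j \<in> alive J \<gamma> x" using v_supp[of j] by (cases "j \<in> alive J \<gamma> x") (auto simp: alive_def)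
qed

lemma near_x': "near x' y \<Longrightarrow> near x y"
  unfolding near_def using alive_x' v_supp by force

lemma inner_restrict_v: "restrict_to (alive J \<gamma> x) c \<bullet> v = c \<bullet> v"
  unfolding inner_vec_def using v_supp by (intro sum.cong) auto

lemma Z_val_x'_le: "Z_val R p \<epsilon> x' \<le> Z_val R p \<epsilon> x + \<gamma> * (e_vec R p \<epsilon> x \<bullet> v)"
proof -
  have "0 \<le> \<gamma>\<^sup>2 * beta_par R (cls p) * (\<Sum>j\<in>UNIV. (coef p $ j)\<^sup>2 * (v $ j)\<^sup>2)"
    using beta_par_pos[OF R, of "cls p"] by (intro mult_nonneg_nonneg sum_nonneg) auto
  then show ?thesis using Z_val_step[of R p \<epsilon> x \<gamma> v] by simp
qed

text \<open>A live record starts below \<open>B\<close> and rises by at most the mesh allowance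
  \<open>B / 20\<close>. For a dangerous one the gradient is orthogonal to \<open>v\<close>, so only
  the nonpositive second-order term acts.\<close>

lemma active_Z_val_x'_le:
  assumes ok: "row_ok x i (Active p) rc"
    and dangerous: "\<And>\<epsilon> X. rc p \<epsilon> = Some (SRec Dangerous X) \<Longrightarrow> e_vec R p \<epsilon> x \<bullet> v = 0"
  shows "Z_val R p \<epsilon> x' \<le> 21/20 * B_par R (cls p)"
proof -
  note o = ok[unfolded row_ok_def row_status.case]
  have m: "\<gamma> * (2 * sqrt (s_par (cls p))) \<le> B_par R (cls p) / 20"
    using mesh[of "cls p"] o by (simp add: small_mesh_def Let_def)
  obtain rs X where r: "rc p \<epsilon> = Some (SRec rs X)"
    "rs = Live \<and> Z_val R p \<epsilon> x < B_par R (cls p) \<or> rs = Dangerous \<and> Z_val R p \<epsilon> x \<le> 21/20 * B_par R (cls p)"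
    using o by blast
  from r(2) show ?thesis
  proof
    assume *: "rs = Live \<and> Z_val R p \<epsilon> x < B_par R (cls p)"
    have "\<bar>e_vec R p \<epsilon> x \<bullet> v\<bar> \<le> 2 * sqrt (s_par (cls p))"
      using o x_cube v_norm by (intro abs_inner_e_vec_le) auto
    then have "\<gamma> * (e_vec R p \<epsilon> x \<bullet> v) \<le> \<gamma> * (2 * sqrt (s_par (cls p)))"
      using \<gamma> by (intro mult_left_mono) auto
    then show ?thesis using Z_val_x'_le[of p \<epsilon>] m * by linarith
  next
    assume *: "rs = Dangerous \<and> Z_val R p \<epsilon> x \<le> 21/20 * B_par R (cls p)"
    then have "e_vec R p \<epsilon> x \<bullet> v = 0" using dangerous r(1) by auto
    then show ?thesis using Z_val_x'_le[of p \<epsilon>] * by simp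
  qed
qed

lemma successor_row_none:
  assumes "point S = x" "to_normalize J a \<gamma> S x' i = None"
  shows "rowst (successor J a R K \<gamma> S v) i = rowst S i"
    and "recs (successor J a R K \<gamma> S v) i p \<epsilon> =
      map_option (update_record J R \<gamma> x x' (rowst S i = Active p) p \<epsilon>) (recs S i p \<epsilon>)"
  using assms by (auto simp: successor_def Let_def)

lemma successor_row_some:
  assumes "point S = x" "to_normalize J a \<gamma> S x' i = Some (k, z)"
  shows "rowst (successor J a R K \<gamma> S v) i = snd (normalize R K x' k z)"
    and "recs (successor J a R K \<gamma> S v) i p \<epsilon> =
      (case born_records (snd (normalize R K x' k z)) p \<epsilon> of
         None \<Rightarrow> map_option (update_record J R \<gamma> x x' (rowst S i = Active p) p \<epsilon>) (recs S i p \<epsilon>)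
       | Some r \<Rightarrow> Some r)"
  using assms by (auto simp: successor_def Let_def case_prod_beta)

lemma step_row_ok:
  assumes S: "point S = x" and ok: "row_ok x i (rowst S i) (recs S i)"
    and large: "rowst S i = Large \<Longrightarrow> a $ i \<bullet> v = 0"
    and dangerous: "\<And>p \<epsilon> X. recs S i p \<epsilon> = Some (SRec Dangerous X) \<Longrightarrow> e_vec R p \<epsilon> x \<bullet> v = 0"
  shows "row_ok x' i (rowst (successor J a R K \<gamma> S v) i) (recs (successor J a R K \<gamma> S v) i)"
proof -
  define S' where "S' = successor J a R K \<gamma> S v"
  define old where "old p \<epsilon> = map_option (update_record J R \<gamma> x x' (rowst S i = Active p) p \<epsilon>) (recs S i p \<epsilon>)" for p \<epsilon>
  have none: "rowst S' i = rowst S i \<and> recs S' i = old" if "to_normalize J a \<gamma> S x' i = None"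
    using successor_row_none[OF S that] by (simp add: S'_def old_def fun_eq_iff)
  have some: "rowst S' i = snd (normalize R K x' k z) \<and>
      recs S' i = (\<lambda>p \<epsilon>. case born_records (snd (normalize R K x' k z)) p \<epsilon> of None \<Rightarrow> old p \<epsilon> | Some r \<Rightarrow> Some r)"
    if "to_normalize J a \<gamma> S x' i = Some (k, z)" for k z
    using successor_row_some[OF S that] by (simp add: S'_def old_def fun_eq_iff split: option.split)
  \<comment> \<open>The update leaves the status of a restriction that is not active unchanged, so
    it cannot create a dangerous record there.\<close>
  have old_dangerous: "\<exists>X. recs S i p \<epsilon> = Some (SRec Dangerous X)"
    if "old p \<epsilon> = Some (SRec Dangerous X')" "rowst S i \<noteq> Active p" for p \<epsilon> X'
    using that by (auto simp: old_def update_record_def split: if_splits) (metis signed_record.collapse)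
  have ok_dangerous: "rowst S i = Active p" if "recs S i p \<epsilon> = Some (SRec Dangerous X)" for p \<epsilon> X
    using ok that by (auto simp: row_ok_def)
  have old_act: "rowst S i = Active p" if "old p \<epsilon> = Some (SRec Dangerous X)" for p \<epsilon> X
    using that old_dangerous ok_dangerous by blast
  have renormalized: "row_ok x' i (rowst S' i) (recs S' i)"
    if tn: "to_normalize J a \<gamma> S x' i = Some (k, z)"
      and z: "\<And>j. z $ j = 0 \<or> z $ j = a $ i $ j" "\<And>j. j \<notin> alive J \<gamma> x' \<Longrightarrow> z $ j = 0"
      and k: "k \<le> Suc K" "(norm z)\<^sup>2 \<le> s_par k"
      and acc: "\<And>y. near x' y \<Longrightarrow> \<bar>a $ i \<bullet> (y - b) - z \<bullet> (y - x')\<bar> \<le> budget k"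
      and od: "\<And>p \<epsilon> X. old p \<epsilon> \<noteq> Some (SRec Dangerous X)" for k z
  proof (rule normalized_row_ok[OF x'_cube z k acc])
    show "rowst S' i = snd (normalize R K x' k z)" using some[OF tn] by simp
    show "recs S' i c \<epsilon> = Some (SRec Live 1)" if "rowst S' i = Active c" for c \<epsilon>
      using some[OF tn] that by (simp add: born_records_def)
    show "recs S' i c \<epsilon> \<noteq> Some (SRec Dangerous X)" for c \<epsilon> X
      using some[OF tn] od by (simp add: born_records_def)
  qed
  have "row_ok x' i (rowst S' i) (recs S' i)"
  proof (cases "rowst S i")
    case Large
    note o = ok[unfolded row_ok_def Large row_status.case]
    have ax: "a $ i \<bullet> (x' - b) = 0"
      using o large[OF Large] by (simp add: inner_diff_right inner_add_right)
    have od: "old p \<epsilon> \<noteq> Some (SRec Dangerous X)" for p \<epsilon> X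
      using old_act[of p \<epsilon> X] Large by auto
    show ?thesis
    proof (cases "alive_energy J \<gamma> x' (a $ i) \<le> M_par")
      case True
      let ?z = "restrict_to (alive J \<gamma> x') (a $ i)"
      have tn: "to_normalize J a \<gamma> S x' i = Some (0, ?z)" using Large True by (simp add: to_normalize_def)
      have nz: "(norm ?z)\<^sup>2 \<le> s_par 0" using True by (simp add: norm_restrict_alive M_par_def s_par_def)
      have acc: "\<bar>a $ i \<bullet> (y - b) - ?z \<bullet> (y - x')\<bar> \<le> budget 0" if y: "near x' y" for y
      proof -
        have "a $ i \<bullet> (y - b) = a $ i \<bullet> (y - x') + a $ i \<bullet> (x' - b)" by (simp add: inner_diff_right)
        then have "a $ i \<bullet> (y - b) - ?z \<bullet> (y - x') = (a $ i - ?z) \<bullet> (y - x')"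
          by (simp only: ax inner_diff_left)
        moreover have "\<bar>(a $ i - ?z) \<bullet> (y - x')\<bar> \<le> \<gamma> * real (card J)"
          using entry_le supp by (intro dead_inner_le y) auto
        ultimately show ?thesis using \<gamma> by (simp add: budget_def)
      qed
      show ?thesis by (rule renormalized[OF tn _ _ _ nz acc od]) auto
    next
      case False
      then have "to_normalize J a \<gamma> S x' i = None" using Large by (simp add: to_normalize_def)
      with none have e: "rowst S' i = Large" "recs S' i = old" using Large by auto
      show ?thesis unfolding e row_ok_def using False ax od by simp
    qed
  next
    case (Terminal w u)
    note o = ok[unfolded row_ok_def Terminal row_status.case]
    have od: "old p \<epsilon> \<noteq> Some (SRec Dangerous X)" for p \<epsilon> X
      using old_act[of p \<epsilon> X] Terminal by auto
    have "to_normalize J a \<gamma> S x' i = None" using Terminal by (simp add: to_normalize_def)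
    with none have e: "rowst S' i = Terminal w u" "recs S' i = old" using Terminal by auto
    show ?thesis unfolding e row_ok_def using od o near_x' by simp
  next
    case (Active p)
    note ok' = ok[unfolded Active]
    note o = ok'[unfolded row_ok_def row_status.case]
    have Zle: "Z_val R p \<epsilon> x' \<le> 21/20 * B_par R (cls p)" for \<epsilon>
      by (rule active_Z_val_x'_le[OF ok' dangerous])
    have coef_le: "\<bar>coef p $ j\<bar> \<le> 1" for j
    proof -
      have "coef p $ j = 0 \<or> coef p $ j = a $ i $ j" using o by blast
      then show ?thesis using entry_le[of i j] by auto
    qed
    have coef_J: "coef p $ j = 0" if "j \<notin> J" for j
    proof -
      have "coef p $ j = 0 \<or> coef p $ j = a $ i $ j" using o by blast
      then show ?thesis using supp[OF that] by auto
    qed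
    show ?thesis
    proof (cases "retires J \<gamma> x' p")
      case True
      let ?z = "restrict_to (alive J \<gamma> x') (coef p)"
      have tn: "to_normalize J a \<gamma> S x' i = Some (Suc (cls p), ?z)" using Active True by (simp add: to_normalize_def)
      have nz: "(norm ?z)\<^sup>2 \<le> s_par (Suc (cls p))"
        using True by (simp add: norm_restrict_alive retires_def s_par_Suc)
      have acc: "\<bar>a $ i \<bullet> (y - b) - ?z \<bullet> (y - x')\<bar> \<le> budget (Suc (cls p))" if y: "near x' y" for y
      proof -
        have 1: "\<bar>a $ i \<bullet> (y - b) - coef p \<bullet> (y - anchor p)\<bar> \<le> budget (cls p) + B_par R (cls p)"
          using o near_x'[OF y] by blast
        have 2: "\<bar>coef p \<bullet> (x' - anchor p)\<bar> \<le> 21/20 * B_par R (cls p) + B_par R (cls p) / 2"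
          using Zle x'_cube o by (intro abs_coef_inner_le) auto
        have "\<bar>(coef p - ?z) \<bullet> (y - x')\<bar> \<le> \<gamma> * real (card J)"
          using coef_le coef_J by (intro dead_inner_le y) auto
        moreover have "\<gamma> * real (card J) \<le> B_par R (cls p) / 20"
          using mesh[of "cls p"] o by (simp add: small_mesh_def Let_def)
        \<comment> \<open>The three parts cost \<open>B\<close> beyond the old budget,
          \<open>31/20 * B\<close> and \<open>B / 20\<close>: together the increment
          \<open>26/10 * B\<close> of \<open>budget\<close>.\<close>
        moreover have "a $ i \<bullet> (y - b) - ?z \<bullet> (y - x') =
            (a $ i \<bullet> (y - b) - coef p \<bullet> (y - anchor p)) + coef p \<bullet> (x' - anchor p) + (coef p - ?z) \<bullet> (y - x')"
          by (simp add: inner_diff_left inner_diff_right)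
        moreover have "budget (Suc (cls p)) = budget (cls p) + 26/10 * B_par R (cls p)" by (simp add: budget_def)
        ultimately show ?thesis using 1 2 by linarith
      qed
      have od: "old p' \<epsilon> \<noteq> Some (SRec Dangerous X)" for p' \<epsilon> X
      proof
        assume *: "old p' \<epsilon> = Some (SRec Dangerous X)"
        then have "p' = p" using old_act Active by auto
        then show False using * True Active by (auto simp: old_def update_record_def)
      qed
      show ?thesis
      proof (rule renormalized[OF tn _ _ _ nz acc od])
        show "?z $ j = 0 \<or> ?z $ j = a $ i $ j" for j using o by auto
        show "Suc (cls p) \<le> Suc K" using o by simp
      qed simp_all
    next
      case False
      then have "to_normalize J a \<gamma> S x' i = None" using Active by (simp add: to_normalize_def)
      with none have e: "rowst S' i = Active p" "recs S' i = old" using Active by auto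
      have recp: "\<exists>rs X. old p \<epsilon> = Some (SRec rs X) \<and>
            (rs = Live \<and> Z_val R p \<epsilon> x' < B_par R (cls p) \<or>
             rs = Dangerous \<and> Z_val R p \<epsilon> x' \<le> 21/20 * B_par R (cls p))" for \<epsilon>
      proof -
        obtain rs X where r: "recs S i p \<epsilon> = Some (SRec rs X)" "rs = Live \<or> rs = Dangerous" using o by blast
        then show ?thesis using False Active Zle[of \<epsilon>] by (auto simp: old_def update_record_def)
      qed
      have en: "s_par (cls p) / 2 < alive_energy J \<gamma> x' (coef p)" using False by (simp add: retires_def)
      have dg: "\<And>p' \<epsilon> X. old p' \<epsilon> = Some (SRec Dangerous X) \<Longrightarrow> Active p = Active p'"
        using old_act Active by fastforce
      have ac: "\<And>y. near x' y \<Longrightarrow>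
            \<bar>a $ i \<bullet> (y - b) - coef p \<bullet> (y - anchor p)\<bar> \<le> budget (cls p) + B_par R (cls p)"
        using o near_x' by blast
      show ?thesis unfolding e row_ok_def using o recp en dg ac by simp
    qed
  qed
  then show ?thesis by (simp add: S'_def)
qed

end

section \<open>Load and potential\<close>

context rounding_walk
begin

text \<open>For an active restriction this is the stored value: while a record is live,
  \<open>Z\<close> stays below \<open>B\<close> and the updates telescope to the exponential without
  meeting the cap; a record that turns dangerous stops at the cap. Working with \<open>Z\<close>
  spares an invariant about stored values.\<close>

definition chi :: "('m, 'n) state \<Rightarrow> 'm \<Rightarrow> 'n piece \<Rightarrow> bool \<Rightarrow> real" where
  "chi S i p \<epsilon> = (case recs S i p \<epsilon> of None \<Rightarrow> 0
     | Some r \<Rightarrow> if rstat r = Live then exp (lambda_par R (cls p) * Z_val R p \<epsilon> (point S))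
                else exp (L_par (cls p)))"

text \<open>
  Rows that have not yet reached class \<open>k\<close> are charged with the value at a future birth, rows
  that have left it with nothing; hence births and retirements never increase the load.
\<close>

definition row_load :: "('m, 'n) state \<Rightarrow> nat \<Rightarrow> 'n \<Rightarrow> 'm \<Rightarrow> real" where
  "row_load S k j i = (case rowst S i of
       Large \<Rightarrow> 2 * (a $ i $ j)\<^sup>2
     | Active p \<Rightarrow> if cls p < k then 2 * (a $ i $ j)\<^sup>2
         else if cls p = k then (chi S i p True + chi S i p False) * (coef p $ j)\<^sup>2 else 0
     | Terminal _ _ \<Rightarrow> 0)"

definition load :: "('m, 'n) state \<Rightarrow> nat \<Rightarrow> 'n \<Rightarrow> real" where
  "load S k j = (\<Sum>i\<in>UNIV. row_load S k j i)"

definition potential :: "('m, 'n) state \<Rightarrow> real" where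
  "potential S = (\<Sum>k\<le>K. exp (- L_par k) *
     (\<Sum>j\<in>alive J \<gamma> (point S). exp (theta_par R k * (load S k j - 2))))"

text \<open>Like the next two definitions, padded with zeros over all pairs of a row and a sign, so
  that sums run over a whole type and match the rows of \<open>E_mat\<close>. Dangerous records get
  weight 0, as their share of the load is frozen.\<close>

definition live_weight :: "('m, 'n) state \<Rightarrow> nat \<Rightarrow> 'n \<Rightarrow> 'm \<times> bool \<Rightarrow> real" where
  "live_weight S k j r = (case rowst S (fst r) of
       Active p \<Rightarrow> if cls p = k \<and> (\<exists>X. recs S (fst r) p (snd r) = Some (SRec Live X))
         then exp (lambda_par R k * Z_val R p (snd r) (point S)) * (coef p $ j)\<^sup>2 else 0
     | _ \<Rightarrow> 0)"

definition class_e_vec :: "('m, 'n) state \<Rightarrow> nat \<Rightarrow> 'm \<times> bool \<Rightarrow> real ^ 'n" where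
  "class_e_vec S k r = (case rowst S (fst r) of
       Active p \<Rightarrow> if cls p = k then e_vec R p (snd r) (point S) else 0
     | _ \<Rightarrow> 0)"

definition class_coef :: "('m, 'n) state \<Rightarrow> nat \<Rightarrow> 'm \<times> bool \<Rightarrow> real ^ 'n" where
  "class_coef S k r = (case rowst S (fst r) of
       Active p \<Rightarrow> if cls p = k then coef p else 0 | _ \<Rightarrow> 0)"

end

context walk_step
begin

definition growth :: "('m, 'n) state \<Rightarrow> nat \<Rightarrow> 'm \<times> bool \<Rightarrow> real" where
  "growth S k r = exp (lambda_par R k * (\<gamma> * (class_e_vec S k r \<bullet> v)
     - \<gamma>\<^sup>2 * beta_par R k * (\<Sum>l\<in>UNIV. (class_coef S k r $ l)\<^sup>2 * (v $ l)\<^sup>2))) - 1"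

text \<open>Only live records of class \<open>k\<close> really move. A birth replaces the prepaid
  \<open>2 * (a $ i $ j)\<^sup>2\<close> by two records of value 1 whose coefficients are entries of
  the row or 0, and a retirement removes the row from class \<open>k\<close> for good. A record
  turning dangerous has reached \<open>exp (L_par k)\<close>, as
  \<open>lambda_par R k * B_par R k = L_par k\<close>, and is cut back to it.\<close>

lemma row_load_step:
  assumes S: "point S = x" and ok: "row_ok x i (rowst S i) (recs S i)"
  shows "row_load (successor J a R K \<gamma> S v) k j i \<le>
     row_load S k j i + (\<Sum>\<epsilon>\<in>UNIV. live_weight S k j (i, \<epsilon>) * growth S k (i, \<epsilon>))"
proof -
  define S' where "S' = successor J a R K \<gamma> S v"
  have pS': "point S' = x'" by (simp add: S'_def successor_def Let_def S)
  have newborn: "row_load S' k j i \<le> 2 * (a $ i $ j)\<^sup>2" "p > k \<Longrightarrow> row_load S' k j i = 0"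
    if tn: "to_normalize J a \<gamma> S x' i = Some (p, z)" and p: "p \<le> Suc K" "(norm z)\<^sup>2 \<le> s_par p"
      and z: "\<And>j. z $ j = 0 \<or> z $ j = a $ i $ j" for p z
  proof -
    have st: "rowst S' i = snd (normalize R K x' p z)" using successor_row_some[OF S tn] by (simp add: S'_def)
    have no: "normalized_ok R K x' p z (rowst S' i)" unfolding st by (rule normalize_ok[OF R p])
    have "row_load S' k j i \<le> 2 * (a $ i $ j)\<^sup>2 \<and> (p > k \<longrightarrow> row_load S' k j i = 0)"
    proof (cases "rowst S' i")
      case (Active c)
      note o = no[unfolded normalized_ok_def Active row_status.case]
      have "recs S' i c \<epsilon> = Some (SRec Live 1)" for \<epsilon>
        using successor_row_some(2)[OF S tn, of c \<epsilon>] Active st by (simp add: S'_def born_records_def)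
      moreover have "Z_val R c \<epsilon> x' = 0" for \<epsilon> using o by (simp add: Z_val_def)
      ultimately have "chi S' i c \<epsilon> = 1" for \<epsilon> by (simp add: chi_def pS')
      moreover have "(coef c $ j)\<^sup>2 \<le> (a $ i $ j)\<^sup>2"
      proof -
        have "coef c $ j = 0 \<or> coef c $ j = z $ j" using o by blast
        then show ?thesis using z[of j] by auto
      qed
      ultimately show ?thesis using o by (auto simp: row_load_def Active)
    next
      case Large
      then show ?thesis using no by (simp add: normalized_ok_def)
    qed (simp add: row_load_def)
    then show "row_load S' k j i \<le> 2 * (a $ i $ j)\<^sup>2" "p > k \<Longrightarrow> row_load S' k j i = 0" by auto
  qed
  have "row_load S' k j i \<le> row_load S k j i + (\<Sum>\<epsilon>\<in>UNIV. live_weight S k j (i, \<epsilon>) * growth S k (i, \<epsilon>))"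
  proof (cases "rowst S i")
    case Large
    have rhs: "row_load S k j i + (\<Sum>\<epsilon>\<in>UNIV. live_weight S k j (i, \<epsilon>) * growth S k (i, \<epsilon>)) = 2 * (a $ i $ j)\<^sup>2"
      by (simp add: row_load_def live_weight_def Large)
    show ?thesis unfolding rhs
    proof (cases "alive_energy J \<gamma> x' (a $ i) \<le> M_par")
      case True
      have "to_normalize J a \<gamma> S x' i = Some (0, restrict_to (alive J \<gamma> x') (a $ i))"
        using Large True by (simp add: to_normalize_def)
      then show "row_load S' k j i \<le> 2 * (a $ i $ j)\<^sup>2"
        by (rule newborn) (use True in \<open>auto simp: norm_restrict_alive M_par_def s_par_def\<close>)
    next
      case False
      then have "to_normalize J a \<gamma> S x' i = None" using Large by (simp add: to_normalize_def)
      from successor_row_none[OF S this] show "row_load S' k j i \<le> 2 * (a $ i $ j)\<^sup>2"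
        by (simp add: row_load_def S'_def Large)
    qed
  next
    case (Terminal w u)
    then have "to_normalize J a \<gamma> S x' i = None" by (simp add: to_normalize_def)
    from successor_row_none[OF S this] show ?thesis
      by (simp add: row_load_def live_weight_def S'_def Terminal)
  next
    case (Active p)
    note o = ok[unfolded row_ok_def Active row_status.case]
    have ret: "row_load S' k j i \<le> 2 * (a $ i $ j)\<^sup>2" "cls p \<ge> k \<Longrightarrow> row_load S' k j i = 0" if "retires J \<gamma> x' p"
    proof -
      let ?z = "restrict_to (alive J \<gamma> x') (coef p)"
      have tn: "to_normalize J a \<gamma> S x' i = Some (Suc (cls p), ?z)"
        using Active that by (simp add: to_normalize_def)
      have *: "Suc (cls p) \<le> Suc K" "(norm ?z)\<^sup>2 \<le> s_par (Suc (cls p))"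
        using that o by (auto simp: norm_restrict_alive retires_def s_par_Suc)
      have z: "?z $ l = 0 \<or> ?z $ l = a $ i $ l" for l
        using o by auto
      show "row_load S' k j i \<le> 2 * (a $ i $ j)\<^sup>2" by (rule newborn(1)[OF tn * z])
      show "row_load S' k j i = 0" if "cls p \<ge> k" by (rule newborn(2)[OF tn * z]) (use that in simp)
    qed
    have keep: "rowst S' i = Active p" "recs S' i p' \<epsilon> =
      map_option (update_record J R \<gamma> x x' (p = p') p' \<epsilon>) (recs S i p' \<epsilon>)" if "\<not> retires J \<gamma> x' p" for p' \<epsilon>
    proof -
      have "to_normalize J a \<gamma> S x' i = None" using Active that by (simp add: to_normalize_def)
      from successor_row_none[OF S this] show "rowst S' i = Active p" "recs S' i p' \<epsilon> =
        map_option (update_record J R \<gamma> x x' (p = p') p' \<epsilon>) (recs S i p' \<epsilon>)"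
        by (simp_all add: S'_def Active)
    qed
    consider "cls p < k" | "cls p = k" | "cls p > k" by linarith
    then show ?thesis
    proof cases
      case 1
      then have rhs: "row_load S k j i + (\<Sum>\<epsilon>\<in>UNIV. live_weight S k j (i, \<epsilon>) * growth S k (i, \<epsilon>)) = 2 * (a $ i $ j)\<^sup>2"
        by (simp add: row_load_def live_weight_def Active)
      show ?thesis unfolding rhs
        using ret(1) keep(1) 1 by (cases "retires J \<gamma> x' p") (auto simp: row_load_def)
    next
      case 3
      then have rhs: "row_load S k j i + (\<Sum>\<epsilon>\<in>UNIV. live_weight S k j (i, \<epsilon>) * growth S k (i, \<epsilon>)) = 0"
        by (simp add: row_load_def live_weight_def Active)
      show ?thesis unfolding rhs
        using ret(2) keep(1) 3 by (cases "retires J \<gamma> x' p") (auto simp: row_load_def)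
    next
      case 2
      \<comment> \<open>The value of a record after the move, but before births, retirements and
        status changes.\<close>
      define \<psi> where "\<psi> \<epsilon> = (if \<exists>X. recs S i p \<epsilon> = Some (SRec Live X) then exp (lambda_par R k * Z_val R p \<epsilon> x') else exp (L_par k))" for \<epsilon>
      have \<psi>: "chi S i p \<epsilon> * (coef p $ j)\<^sup>2 + live_weight S k j (i, \<epsilon>) * growth S k (i, \<epsilon>) = \<psi> \<epsilon> * (coef p $ j)\<^sup>2" for \<epsilon>
      proof -
        obtain rs X where r: "recs S i p \<epsilon> = Some (SRec rs X)" "rs = Live \<or> rs = Dangerous" using o by blast
        have g: "growth S k (i, \<epsilon>) = exp (lambda_par R k * (Z_val R p \<epsilon> x' - Z_val R p \<epsilon> x)) - 1"
          unfolding Z_val_step by (simp add: growth_def class_e_vec_def class_coef_def Active 2 S)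
        have "exp (lambda_par R k * Z_val R p \<epsilon> x) * exp (lambda_par R k * (Z_val R p \<epsilon> x' - Z_val R p \<epsilon> x))
            = exp (lambda_par R k * Z_val R p \<epsilon> x')"
          by (simp add: right_diff_distrib flip: exp_add)
        then show ?thesis
          using r 2 by (auto simp: chi_def live_weight_def Active S g \<psi>_def algebra_simps)
      qed
      have rhs: "row_load S k j i + (\<Sum>\<epsilon>\<in>UNIV. live_weight S k j (i, \<epsilon>) * growth S k (i, \<epsilon>)) =
          (\<psi> True + \<psi> False) * (coef p $ j)\<^sup>2"
        using \<psi>[of True] \<psi>[of False] 2 by (simp add: row_load_def Active UNIV_bool algebra_simps)
      show ?thesis
      proof (cases "retires J \<gamma> x' p")
        case True
        have "0 \<le> (\<psi> True + \<psi> False) * (coef p $ j)\<^sup>2" by (simp add: \<psi>_def)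
        then show ?thesis unfolding rhs using ret(2)[OF True] 2 by simp
      next
        case False
        have "chi S' i p \<epsilon> \<le> \<psi> \<epsilon>" for \<epsilon>
        proof -
          obtain rs X where r: "recs S i p \<epsilon> = Some (SRec rs X)" "rs = Live \<or> rs = Dangerous" using o by blast
          have "exp (L_par k) \<le> exp (lambda_par R k * Z_val R p \<epsilon> x')" if "B_par R k \<le> Z_val R p \<epsilon> x'"
            using mult_left_mono[OF that, of "lambda_par R k"] lambda_par_pos[OF R, of k] lambda_par_B[OF R, of k] by simp
          then show ?thesis
            using r False 2 by (auto simp: chi_def keep(2)[OF False] update_record_def \<psi>_def pS')
        qed
        then have "(chi S' i p True + chi S' i p False) * (coef p $ j)\<^sup>2 \<le> (\<psi> True + \<psi> False) * (coef p $ j)\<^sup>2"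
          by (intro mult_right_mono add_mono) auto
        then show ?thesis unfolding rhs using keep(1)[OF False] 2 by (simp add: row_load_def)
      qed
    qed
  qed
  then show ?thesis by (simp add: S'_def)
qed

lemma load_step:
  assumes S: "point S = x" and ok: "\<And>i. row_ok x i (rowst S i) (recs S i)"
  shows "load (successor J a R K \<gamma> S v) k j \<le> load S k j + (\<Sum>r\<in>UNIV. live_weight S k j r * growth S k r)"
proof -
  have "load (successor J a R K \<gamma> S v) k j \<le>
      (\<Sum>i\<in>UNIV. row_load S k j i + (\<Sum>\<epsilon>\<in>UNIV. live_weight S k j (i, \<epsilon>) * growth S k (i, \<epsilon>)))"
    unfolding load_def by (intro sum_mono row_load_step S ok)
  also have "\<dots> = load S k j + (\<Sum>r\<in>UNIV. live_weight S k j r * growth S k r)"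
    by (simp add: load_def sum.distrib sum.cartesian_product flip: UNIV_Times_UNIV)
  finally show ?thesis .
qed

end

section \<open>Drift of the potential\<close>

lemma diag_part_form:
  fixes P :: "real ^ 'a ^ 'a::finite"
  shows "z \<bullet> ((c *\<^sub>R diag_part P - P) *v z) = c * (\<Sum>i\<in>UNIV. P $ i $ i * (z $ i)\<^sup>2) - z \<bullet> (P *v z)"
proof -
  have "diag_part P *v z = (\<chi> i. P $ i $ i * z $ i)"
    by (simp add: vec_eq_iff matrix_vector_mult_def diag_part_def if_distrib[of "\<lambda>x. x * _"] cong: if_cong)
  then have "z \<bullet> (diag_part P *v z) = (\<Sum>i\<in>UNIV. P $ i $ i * (z $ i)\<^sup>2)"
    by (simp add: inner_vec_def power2_eq_square mult_ac)
  then show ?thesis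
    by (simp add: matrix_vector_mult_diff_rdistrib inner_diff_right scaleR_matrix_vector_assoc[symmetric])
qed

lemma loewner_diag_form:
  fixes P :: "real ^ 'a ^ 'a::finite"
  assumes "loewner_le P (c *\<^sub>R diag_part P)"
  shows "z \<bullet> (P *v z) \<le> c * (\<Sum>i\<in>UNIV. P $ i $ i * (z $ i)\<^sup>2)"
proof -
  have "0 \<le> z \<bullet> ((c *\<^sub>R diag_part P - P) *v z)"
    using assms by (simp add: loewner_le_def pos_semidef_def)
  then show ?thesis unfolding diag_part_form by simp
qed

lemma loewner_diagI:
  fixes P :: "real ^ 'a ^ 'a::finite"
  assumes sym: "transpose P = P"
    and le: "\<And>z. z \<bullet> (P *v z) \<le> c * (\<Sum>i\<in>UNIV. P $ i $ i * (z $ i)\<^sup>2)"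
  shows "loewner_le P (c *\<^sub>R diag_part P)"
  unfolding loewner_le_def pos_semidef_def diag_part_form
proof (intro conjI allI)
  have "P $ j $ i = P $ i $ j" for i j
    using sym by (simp add: transpose_def vec_eq_iff)
  then show "transpose (c *\<^sub>R diag_part P - P) = c *\<^sub>R diag_part P - P"
    by (auto simp: vec_eq_iff transpose_def diag_part_def)
qed (simp add: le)

lemma transpose_mult_vec_sum:
  fixes E :: "real ^ 'n::finite ^ 'r::finite"
  shows "transpose E *v y = (\<Sum>r\<in>UNIV. y $ r *\<^sub>R E $ r)"
  by (simp add: vec_eq_iff matrix_vector_mult_def transpose_def mult.commute)

lemma congruence_form:
  fixes E :: "real ^ 'n::finite ^ 'r::finite" and U :: "real ^ 'n ^ 'n"
  defines "G \<equiv> E ** U ** transpose E"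
  shows "y \<bullet> (G *v y) = (\<Sum>r\<in>UNIV. y $ r *\<^sub>R E $ r) \<bullet> (U *v (\<Sum>r\<in>UNIV. y $ r *\<^sub>R E $ r))"
    and "G $ r $ r = E $ r \<bullet> (U *v E $ r)"
proof -
  have form: "y \<bullet> (G *v y) = (\<Sum>r\<in>UNIV. y $ r *\<^sub>R E $ r) \<bullet> (U *v (\<Sum>r\<in>UNIV. y $ r *\<^sub>R E $ r))" for y
  proof -
    have "y \<bullet> (G *v y) = y \<bullet> (E *v (U *v (transpose E *v y)))"
      by (simp only: G_def matrix_vector_mul_assoc[symmetric])
    also have "\<dots> = (transpose E *v y) \<bullet> (U *v (transpose E *v y))"
      by (simp only: dot_lmul_matrix[symmetric] transpose_matrix_vector)
    finally show ?thesis unfolding transpose_mult_vec_sum .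
  qed
  then show "y \<bullet> (G *v y) = (\<Sum>r\<in>UNIV. y $ r *\<^sub>R E $ r) \<bullet> (U *v (\<Sum>r\<in>UNIV. y $ r *\<^sub>R E $ r))" .
  have "(\<Sum>r'\<in>UNIV. axis r 1 $ r' *\<^sub>R E $ r') = (\<Sum>r'\<in>UNIV. if r' = r then E $ r else 0)"
    by (intro sum.cong) (auto simp: axis_def)
  then have "axis r 1 \<bullet> (G *v axis r 1) = E $ r \<bullet> (U *v E $ r)" unfolding form by simp
  then show "G $ r $ r = E $ r \<bullet> (U *v E $ r)" by simp
qed

lemma restrict_form:
  fixes U :: "real ^ 'n ^ 'n::finite"
  assumes "\<And>i j. \<not> (i \<in> V \<and> j \<in> V) \<Longrightarrow> U $ i $ j = 0"
  shows "restrict_to V c \<bullet> (U *v restrict_to V d) = c \<bullet> (U *v d)"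
  unfolding inner_matrix_vector_sum using assms by (intro sum.cong refl) auto

lemma restrict_to_sum: "restrict_to V (\<Sum>r\<in>I. y r *\<^sub>R f r) = (\<Sum>r\<in>I. y r *\<^sub>R restrict_to V (f r))"
  by (simp add: vec_eq_iff)

context rounding_walk
begin

text \<open>An atom lies in the range of the symmetric matrix \<open>U\<close> and is thus
  orthogonal to its kernel: each vector killed by a feasible covariance is an exact linear
  constraint on the step.\<close>

lemma atom_step:
  assumes U: "feasible_covariance J a R K \<gamma> S U" and D: "direction_law U D" and v: "v \<in> set_pmf D"
    and x: "\<And>j. \<bar>point S $ j\<bar> \<le> 1"
  shows atom_walk_step: "walk_step J a b R K \<gamma> (point S) v"
    and atom_large: "rowst S i = Large \<Longrightarrow> a $ i \<bullet> v = 0"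
    and atom_dangerous: "recs S i p \<epsilon> = Some (SRec Dangerous X) \<Longrightarrow> e_vec R p \<epsilon> (point S) \<bullet> v = 0"
    and atom_point: "point S \<bullet> v = 0"
proof -
  let ?V = "alive J \<gamma> (point S)"
  have psd: "pos_semidef U" and supp: "\<And>i j. \<not> (i \<in> ?V \<and> j \<in> ?V) \<Longrightarrow> U $ i $ j = 0"
    and L: "\<And>i. rowst S i = Large \<Longrightarrow> U *v restrict_to ?V (a $ i) = 0"
    and Dg: "\<And>i p \<epsilon> X. recs S i p \<epsilon> = Some (SRec Dangerous X) \<Longrightarrow> U *v restrict_to ?V (e_vec R p \<epsilon> (point S)) = 0"
    and P: "U *v restrict_to ?V (point S) = 0"
    using U unfolding feasible_covariance_def Let_def by blast+
  obtain z where z: "v = U *v z" and n: "norm v = 1"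
    using D v by (auto simp: direction_law_def)
  have vs: "v $ j = 0" if "j \<notin> ?V" for j
    unfolding z matrix_vector_mult_def using supp that by simp
  show ws: "walk_step J a b R K \<gamma> (point S) v"
    by unfold_locales (use x n vs in auto)
  have kill: "c \<bullet> v = 0" if "U *v restrict_to ?V c = 0" for c
  proof -
    have "c \<bullet> v = restrict_to ?V c \<bullet> (U *v z)"
      using walk_step.inner_restrict_v[OF ws, of c] z by simp
    also have "\<dots> = (U *v restrict_to ?V c) \<bullet> z"
      using psd by (intro inner_symmetric_matrix) (simp add: pos_semidef_def)
    finally show ?thesis using that by simp
  qed
  show "rowst S i = Large \<Longrightarrow> a $ i \<bullet> v = 0" using kill L by blast
  show "recs S i p \<epsilon> = Some (SRec Dangerous X) \<Longrightarrow> e_vec R p \<epsilon> (point S) \<bullet> v = 0" using kill Dg by blast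
  show "point S \<bullet> v = 0" using kill P by blast
qed

lemma class_coef_bounds:
  assumes ok: "\<And>i. row_ok (point S) i (rowst S i) (recs S i)"
  shows "\<bar>class_coef S k r $ j\<bar> \<le> s_par k / B_par R k" and "(norm (class_coef S k r))\<^sup>2 \<le> s_par k"
proof -
  have pos: "0 \<le> s_par k / B_par R k" "0 \<le> s_par k"
    using B_par_pos[OF R, of k] s_par_pos[of k] by (auto intro: less_imp_le)
  have "\<bar>class_coef S k r $ j\<bar> \<le> s_par k / B_par R k \<and> (norm (class_coef S k r))\<^sup>2 \<le> s_par k"
  proof (cases "\<exists>p. rowst S (fst r) = Active p \<and> cls p = k")
    case True
    then obtain p where p: "rowst S (fst r) = Active p" "cls p = k" by blast
    note o = ok[of "fst r", unfolded row_ok_def p row_status.case]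
    show ?thesis using o p by (simp add: class_coef_def)
  next
    case False
    then show ?thesis using pos by (auto simp: class_coef_def split: row_status.split)
  qed
  then show "\<bar>class_coef S k r $ j\<bar> \<le> s_par k / B_par R k" "(norm (class_coef S k r))\<^sup>2 \<le> s_par k" by auto
qed

lemma class_e_vec_le:
  assumes ok: "\<And>i. row_ok (point S) i (rowst S i) (recs S i)" and x: "\<And>j. \<bar>point S $ j\<bar> \<le> 1"
  shows "\<bar>class_e_vec S k r $ j\<bar> \<le> 2 * \<bar>class_coef S k r $ j\<bar>"
proof (cases "\<exists>p. rowst S (fst r) = Active p \<and> cls p = k")
  case True
  then obtain p where p: "rowst S (fst r) = Active p" "cls p = k" by blast
  note o = ok[of "fst r", unfolded row_ok_def p row_status.case]
  have "\<bar>e_vec R p (snd r) (point S) $ j\<bar> \<le> 2 * \<bar>coef p $ j\<bar>" using o by (intro e_vec_le R x) (auto simp: p)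
  then show ?thesis using p by (simp add: class_e_vec_def class_coef_def)
next
  case False
  then show ?thesis by (auto simp: class_e_vec_def split: row_status.split)
qed

lemma live_weight_bounds:
  assumes ok: "\<And>i. row_ok (point S) i (rowst S i) (recs S i)"
  shows "0 \<le> live_weight S k j r" and "theta_par R k * live_weight S k j r \<le> weight_par R k"
proof -
  have \<theta>: "theta_par R k \<ge> 0" using L_par_ge_one[of k] R by (simp add: theta_par_def)
  show "0 \<le> live_weight S k j r" by (auto simp: live_weight_def split: row_status.split)
  have "live_weight S k j r \<le> exp (L_par k) * (s_par k / B_par R k)\<^sup>2"
  proof (cases "\<exists>p X. rowst S (fst r) = Active p \<and> cls p = k \<and> recs S (fst r) p (snd r) = Some (SRec Live X)")
    case True
    then obtain p X where p: "rowst S (fst r) = Active p" "cls p = k" "recs S (fst r) p (snd r) = Some (SRec Live X)" by blast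
    note o = ok[of "fst r", unfolded row_ok_def p row_status.case]
    obtain rs X' where "recs S (fst r) p (snd r) = Some (SRec rs X')"
      "rs = Live \<and> Z_val R p (snd r) (point S) < B_par R k \<or> rs = Dangerous \<and> Z_val R p (snd r) (point S) \<le> 21/20 * B_par R k"
      using o p(2) by blast
    then have "Z_val R p (snd r) (point S) < B_par R k" using p(3) by auto
    then have "lambda_par R k * Z_val R p (snd r) (point S) \<le> lambda_par R k * B_par R k"
      using lambda_par_pos[OF R, of k] by (intro mult_left_mono) auto
    then have "exp (lambda_par R k * Z_val R p (snd r) (point S)) \<le> exp (L_par k)"
      by (simp add: lambda_par_B[OF R])
    moreover have "(coef p $ j)\<^sup>2 \<le> (s_par k / B_par R k)\<^sup>2"
    proof -
      have "\<bar>coef p $ j\<bar> \<le> s_par k / B_par R k" using o p(2) by auto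
      then show ?thesis by (metis abs_ge_zero power2_abs power_mono)
    qed
    ultimately have "exp (lambda_par R k * Z_val R p (snd r) (point S)) * (coef p $ j)\<^sup>2 \<le> exp (L_par k) * (s_par k / B_par R k)\<^sup>2"
      by (intro mult_mono) auto
    then show ?thesis using p by (simp add: live_weight_def)
  next
    case False
    then have "live_weight S k j r = 0" by (auto simp: live_weight_def split: row_status.split)
    then show ?thesis by simp
  qed
  then show "theta_par R k * live_weight S k j r \<le> weight_par R k"
    unfolding weight_par_def using \<theta> by (intro mult_left_mono) auto
qed

text \<open>The drift inequality is applied to every class and column separately; the spectral
  condition enters through the one combination of gradients with weights \<open>W\<close>.\<close>

lemma load_drift:
  assumes U: "feasible_covariance J a R K \<gamma> S U" and D: "direction_law U D"
    and x: "\<And>j. \<bar>point S $ j\<bar> \<le> 1" and ok: "\<And>i. row_ok (point S) i (rowst S i) (recs S i)"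
    and k: "k \<le> K"
  shows "(\<Sum>v\<in>set_pmf D. pmf D v * exp (theta_par R k * (load (successor J a R K \<gamma> S v) k j - 2)))
    \<le> exp (theta_par R k * (load S k j - 2))"
proof -
  let ?step = "successor J a R K \<gamma> S"
  let ?E = "E_mat J R \<gamma> S k"
  let ?V = "alive J \<gamma> (point S)"
  let ?S = "set_pmf D" and ?\<theta> = "theta_par R k" and ?l = "\<lambda>r v. class_e_vec S k r \<bullet> v"
  let ?Q = "\<lambda>r v. \<Sum>i\<in>UNIV. (class_coef S k r $ i)\<^sup>2 * (v $ i)\<^sup>2"
  let ?\<alpha> = "1973 / (100 * s_par k)"
  define W where "W r = ?\<theta> * live_weight S k j r" for r
  have \<theta>: "?\<theta> > 0" using L_par_ge_one[of k] R by (simp add: theta_par_def)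
  have wp: "weight_par R k \<ge> 0" using \<theta> by (simp add: weight_par_def)
  note wb = live_weight_bounds[OF ok]
  let ?w = "\<lambda>v. \<Sum>r\<in>UNIV. W r * (exp (lambda_par R k * (\<gamma> * ?l r v - \<gamma>\<^sup>2 * beta_par R k * ?Q r v)) - 1)"
  have W0: "0 \<le> W r" for r using wb(1) \<theta> by (simp add: W_def)
  have Wle: "W r \<le> weight_par R k" for r using wb(2) by (simp add: W_def)
  note ws = atom_walk_step[OF U D _ x]
  have supp: "\<And>i j. \<not> (i \<in> ?V \<and> j \<in> ?V) \<Longrightarrow> U $ i $ j = 0" and psd: "pos_semidef U"
    and tr: "trace U \<ge> real (card ?V) / 65536"
    and ld: "loewner_le U ((61/18) *\<^sub>R diag_part U)"
    and lE: "loewner_le (?E ** U ** transpose ?E)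
        (?\<alpha> *\<^sub>R diag_part (?E ** U ** transpose ?E))"
    using U k unfolding feasible_covariance_def Let_def by blast+
  note mom = direction_law_moments[OF D]
  have tr0: "trace U \<ge> 0" using tr by (meson divide_nonneg_nonneg of_nat_0_le_iff order_trans zero_le_numeral)
  have finS: "finite ?S" using D by (simp add: direction_law_def)
  have QE: "(\<Sum>v\<in>?S. pmf D v * ?Q r v) = (\<Sum>i\<in>UNIV. (class_coef S k r $ i)\<^sup>2 * U $ i $ i) / trace U" for r
  proof -
    have "(\<Sum>v\<in>?S. pmf D v * ?Q r v) = (\<Sum>i\<in>UNIV. (class_coef S k r $ i)\<^sup>2 * (\<Sum>v\<in>?S. pmf D v * (axis i 1 \<bullet> v)\<^sup>2))"
      unfolding sum_distrib_left by (subst sum.swap) (simp add: inner_axis' mult_ac)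
    then show ?thesis unfolding mom(3)
      by (simp add: sum_divide_distrib)
  qed
  \<comment> \<open>61/18 comes from the bound of \<open>U\<close> by its diagonal, the remaining
    factor 4 from \<open>class_e_vec_le\<close>.\<close>
  have var_form: "class_e_vec S k r \<bullet> (U *v class_e_vec S k r) \<le> 122/9 * (\<Sum>i\<in>UNIV. (class_coef S k r $ i)\<^sup>2 * U $ i $ i)" for r
  proof -
    have Uii: "0 \<le> U $ i $ i" for i
      using psd[unfolded pos_semidef_def, THEN conjunct2, rule_format, of "axis i 1"] by simp
    have "class_e_vec S k r \<bullet> (U *v class_e_vec S k r) \<le> 61/18 * (\<Sum>i\<in>UNIV. U $ i $ i * (class_e_vec S k r $ i)\<^sup>2)"
      by (rule loewner_diag_form[OF ld])
    also have "\<dots> \<le> 61/18 * (\<Sum>i\<in>UNIV. U $ i $ i * (2 * \<bar>class_coef S k r $ i\<bar>)\<^sup>2)"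
    proof (intro mult_left_mono sum_mono)
      fix i
      have "\<bar>class_e_vec S k r $ i\<bar>\<^sup>2 \<le> (2 * \<bar>class_coef S k r $ i\<bar>)\<^sup>2"
        using class_e_vec_le[OF ok x] by (intro power_mono) auto
      then show "(class_e_vec S k r $ i)\<^sup>2 \<le> (2 * \<bar>class_coef S k r $ i\<bar>)\<^sup>2" by simp
    qed (use Uii in auto)
    also have "\<dots> = 122/9 * (\<Sum>i\<in>UNIV. (class_coef S k r $ i)\<^sup>2 * U $ i $ i)"
      by (simp add: sum_distrib_left power_mult_distrib mult_ac)
    finally show ?thesis .
  qed
  let ?G = "1973 / (100 * s_par k) * (122/9) * weight_par R k"
  \<comment> \<open>The spectral bound across rows leaves only diagonal terms with weights
    \<open>(W r)\<^sup>2\<close>; since \<open>W r \<le> weight_par R k\<close>, these become linear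
    in \<open>W r\<close>, like the drift that has to pay for them.\<close>
  have joint: "(\<Sum>v\<in>?S. pmf D v * (\<Sum>r\<in>UNIV. W r * ?l r v)\<^sup>2) \<le> ?G * (\<Sum>r\<in>UNIV. W r * (\<Sum>v\<in>?S. pmf D v * ?Q r v))"
  proof -
    define z where "z = (\<Sum>r\<in>UNIV. W r *\<^sub>R class_e_vec S k r)"
    have Er: "?E $ r = restrict_to ?V (class_e_vec S k r)" for r
      by (auto simp: E_mat_def class_e_vec_def vec_eq_iff split: row_status.split)
    have zr: "restrict_to ?V z = (\<Sum>r\<in>UNIV. (\<chi> r. W r) $ r *\<^sub>R ?E $ r)"
      by (simp add: z_def restrict_to_sum Er)
    have "z \<bullet> (U *v z) = restrict_to ?V z \<bullet> (U *v restrict_to ?V z)"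
      using restrict_form[of ?V U z z, OF supp] by simp
    also have "\<dots> = (\<chi> r. W r) \<bullet> ((?E ** U ** transpose ?E) *v (\<chi> r. W r))"
      unfolding zr by (rule congruence_form(1)[symmetric])
    also have "\<dots> \<le> ?\<alpha> * (\<Sum>r\<in>UNIV. (?E ** U ** transpose ?E) $ r $ r * ((\<chi> r. W r) $ r)\<^sup>2)"
      by (rule loewner_diag_form[OF lE])
    also have "\<dots> = ?\<alpha> * (\<Sum>r\<in>UNIV. (class_e_vec S k r \<bullet> (U *v class_e_vec S k r)) * (W r)\<^sup>2)"
      unfolding congruence_form(2) Er by (simp add: restrict_form[of ?V U, OF supp])
    also have "\<dots> \<le> ?\<alpha> * (\<Sum>r\<in>UNIV. (122/9 * (\<Sum>i\<in>UNIV. (class_coef S k r $ i)\<^sup>2 * U $ i $ i)) * (W r * weight_par R k))"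
    proof (intro mult_left_mono sum_mono)
      fix r
      have e0: "0 \<le> class_e_vec S k r \<bullet> (U *v class_e_vec S k r)" using psd by (simp add: pos_semidef_def)
      have "(W r)\<^sup>2 \<le> W r * weight_par R k" unfolding power2_eq_square using W0 Wle by (intro mult_left_mono) auto
      then show "(class_e_vec S k r \<bullet> (U *v class_e_vec S k r)) * (W r)\<^sup>2 \<le>
          (122/9 * (\<Sum>i\<in>UNIV. (class_coef S k r $ i)\<^sup>2 * U $ i $ i)) * (W r * weight_par R k)"
        using var_form[of r] e0 by (intro mult_mono) auto
    qed (use s_par_pos[of k] in auto)
    also have "\<dots> = ?G * (\<Sum>r\<in>UNIV. W r * (\<Sum>i\<in>UNIV. (class_coef S k r $ i)\<^sup>2 * U $ i $ i))"
      by (simp add: sum_distrib_left sum_divide_distrib mult_ac)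
    finally have "z \<bullet> (U *v z) / trace U \<le> ?G * (\<Sum>r\<in>UNIV. W r * (\<Sum>i\<in>UNIV. (class_coef S k r $ i)\<^sup>2 * U $ i $ i)) / trace U"
      using tr0 by (rule divide_right_mono)
    also have "\<dots> = ?G * (\<Sum>r\<in>UNIV. W r * (\<Sum>v\<in>?S. pmf D v * ?Q r v))"
      unfolding QE by (simp add: sum_divide_distrib sum_distrib_left)
    finally show ?thesis
      using mom(3)[of z] by (simp add: z_def inner_sum_left)
  qed
  note m = mesh[OF k, unfolded small_mesh_def Let_def]
  have one: "(\<Sum>v\<in>?S. pmf D v * exp (?w v)) \<le> 1"
  proof (rule expected_exp_sum_le_one[where \<Gamma> = ?G and P = "2 * sqrt (s_par k)" and qmax = "s_par k" and N = "2 * real CARD('m) * weight_par R k",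
        OF finS _ _ mom(1) _ _ _ joint _ _ _ _ _ _ _ _ _ _ _ refl _ _ m[THEN conjunct1]
        m[THEN conjunct2, THEN conjunct1] m[THEN conjunct2, THEN conjunct2, THEN conjunct1]])
    show "(\<Sum>v\<in>?S. pmf D v * ?l r v) = 0" for r by (rule mom(2))
    show "(\<Sum>v\<in>?S. pmf D v * (?l r v)\<^sup>2) \<le> 122/9 * (\<Sum>v\<in>?S. pmf D v * ?Q r v)" for r
      unfolding mom(3) QE using divide_right_mono[OF var_form tr0] by simp
    show "\<bar>?l r v\<bar> \<le> 2 * sqrt (s_par k)" if v: "v \<in> ?S" for r v
    proof -
      have "norm (class_e_vec S k r) \<le> norm (2 *\<^sub>R class_coef S k r)"
        using class_e_vec_le[OF ok x] by (intro norm_le_componentwise_cart) (simp add: abs_mult)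
      also have "\<dots> = 2 * sqrt ((norm (class_coef S k r))\<^sup>2)" by simp
      also have "\<dots> \<le> 2 * sqrt (s_par k)"
        using class_coef_bounds(2)[OF ok] by (intro mult_left_mono real_sqrt_le_mono) auto
      finally show ?thesis
        using Cauchy_Schwarz_ineq2[of "class_e_vec S k r" v] walk_step.v_norm[OF ws[OF v]] by simp
    qed
    show "0 \<le> ?Q r v" for r v by (intro sum_nonneg) auto
    show "?Q r v \<le> s_par k" if v: "v \<in> ?S" for r v
    proof -
      have "?Q r v \<le> (\<Sum>i\<in>UNIV. (class_coef S k r $ i)\<^sup>2 * 1)"
        using walk_step.v_le[OF ws[OF v]] by (intro sum_mono mult_left_mono) (auto simp: abs_square_le_1)
      also have "\<dots> \<le> s_par k" using class_coef_bounds(2)[OF ok] by (simp add: norm_square_vec)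
      finally show ?thesis .
    qed
    show "(\<Sum>r\<in>UNIV. W r) \<le> 2 * real CARD('m) * weight_par R k"
    proof -
      have "(\<Sum>r\<in>UNIV. W r) \<le> (\<Sum>r\<in>(UNIV :: ('m \<times> bool) set). weight_par R k)" by (intro sum_mono Wle)
      then show ?thesis by (simp add: mult_ac)
    qed
    show "lambda_par R k * ?G \<le> beta_par R k"
      using outer_drift_par[OF R, of k] by (simp only: weight_par_def theta_par_def)
  qed (use W0 wp s_par_pos[of k] lambda_par_pos[OF R, of k] beta_par_pos[OF R, of k] inner_drift_par[OF R, of k] \<gamma> in \<open>simp_all\<close>)
  have "(\<Sum>v\<in>?S. pmf D v * exp (?\<theta> * (load (?step v) k j - 2))) \<le>
     (\<Sum>v\<in>?S. pmf D v * (exp (?\<theta> * (load S k j - 2)) *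
       exp (?w v)))"
  proof (intro sum_mono mult_left_mono)
    fix v assume v: "v \<in> ?S"
    have "load (?step v) k j \<le> load S k j + (\<Sum>r\<in>UNIV. live_weight S k j r * walk_step.growth R \<gamma> v S k r)"
      by (rule walk_step.load_step[OF ws[OF v] refl ok])
    then have "?\<theta> * load (?step v) k j \<le> ?\<theta> * (load S k j + (\<Sum>r\<in>UNIV. live_weight S k j r * walk_step.growth R \<gamma> v S k r))"
      using \<theta> by (intro mult_left_mono) auto
    also have "\<dots> = ?\<theta> * load S k j + ?w v"
      by (simp add: walk_step.growth_def[OF ws[OF v]] W_def distrib_left sum_distrib_left mult_ac)
    finally show "exp (?\<theta> * (load (?step v) k j - 2)) \<le> exp (?\<theta> * (load S k j - 2)) *
       exp (?w v)"
      by (simp add: right_diff_distrib flip: exp_add)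
  qed auto
  also have "\<dots> = exp (?\<theta> * (load S k j - 2)) * (\<Sum>v\<in>?S. pmf D v *
       exp (?w v))"
    by (simp add: sum_distrib_left mult_ac)
  also have "\<dots> \<le> exp (?\<theta> * (load S k j - 2)) * 1" using one by (intro mult_left_mono) auto
  finally show ?thesis by simp
qed

text \<open>On average over the law the potential does not grow, so some atom does not raise it.
  Coordinates that die only remove positive terms.\<close>

lemma potential_drift:
  assumes U: "feasible_covariance J a R K \<gamma> S U" and D: "direction_law U D"
    and x: "\<And>j. \<bar>point S $ j\<bar> \<le> 1" and ok: "\<And>i. row_ok (point S) i (rowst S i) (recs S i)"
  obtains v where "v \<in> set_pmf D" "potential (successor J a R K \<gamma> S v) \<le> potential S"
proof -
  let ?step = "successor J a R K \<gamma> S"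
  let ?S = "set_pmf D" and ?V = "alive J \<gamma> (point S)"
  let ?h = "\<lambda>S k j. exp (theta_par R k * (load S k j - 2))"
  note mom = direction_law_moments[OF D]
  have finS: "finite ?S" using D by (simp add: direction_law_def)
  have pot: "potential (?step v) \<le> (\<Sum>k\<le>K. exp (- L_par k) * (\<Sum>j\<in>?V. ?h (?step v) k j))"
    if v: "v \<in> ?S" for v
  proof -
    have "alive J \<gamma> (point (?step v)) \<subseteq> ?V"
      using walk_step.alive_x'[OF atom_walk_step[OF U D v x]] by (simp add: successor_def Let_def)
    then show ?thesis unfolding potential_def by (intro sum_mono mult_left_mono sum_mono2) auto
  qed
  have "(\<Sum>v\<in>?S. pmf D v * potential (?step v)) \<le>
      (\<Sum>v\<in>?S. pmf D v * (\<Sum>k\<le>K. exp (- L_par k) * (\<Sum>j\<in>?V. ?h (?step v) k j)))"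
    by (intro sum_mono mult_left_mono pot) auto
  also have "\<dots> = (\<Sum>v\<in>?S. \<Sum>k\<le>K. \<Sum>j\<in>?V. exp (- L_par k) * (pmf D v * ?h (?step v) k j))"
    by (simp add: sum_distrib_left mult_ac)
  also have "\<dots> = (\<Sum>k\<le>K. \<Sum>v\<in>?S. \<Sum>j\<in>?V. exp (- L_par k) * (pmf D v * ?h (?step v) k j))"
    by (rule sum.swap)
  also have "\<dots> = (\<Sum>k\<le>K. \<Sum>j\<in>?V. \<Sum>v\<in>?S. exp (- L_par k) * (pmf D v * ?h (?step v) k j))"
    by (intro sum.cong refl sum.swap)
  also have "\<dots> = (\<Sum>k\<le>K. exp (- L_par k) * (\<Sum>j\<in>?V. \<Sum>v\<in>?S. pmf D v * ?h (?step v) k j))"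
    by (simp add: sum_distrib_left)
  also have "\<dots> \<le> potential S"
    unfolding potential_def by (intro sum_mono mult_left_mono load_drift[OF U D x ok]) auto
  finally have le: "(\<Sum>v\<in>?S. pmf D v * potential (?step v)) \<le> potential S" .
  have "\<exists>v\<in>?S. potential (?step v) \<le> potential S"
  proof (rule ccontr)
    assume "\<not> ?thesis"
    then have "(\<Sum>v\<in>?S. pmf D v * potential S) < (\<Sum>v\<in>?S. pmf D v * potential (?step v))"
      using finS set_pmf_not_empty[of D] by (intro sum_strict_mono mult_strict_left_mono) (auto simp: pmf_positive)
    then show False using le mom(1) by (simp flip: sum_distrib_right)
  qed
  then show ?thesis using that by blast
qed

end

section \<open>Feasible covariances\<close>

context rounding_walk
begin

definition active_rows :: "('m, 'n) state \<Rightarrow> nat \<Rightarrow> ('m \<times> bool) set" where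
  "active_rows S k = {r. \<exists>p. rowst S (fst r) = Active p \<and> cls p = k}"

definition dangerous_rows :: "('m, 'n) state \<Rightarrow> nat \<Rightarrow> ('m \<times> bool) set" where
  "dangerous_rows S k = {r. \<exists>p X. rowst S (fst r) = Active p \<and> cls p = k \<and>
     recs S (fst r) p (snd r) = Some (SRec Dangerous X)}"

text \<open>Jensen's inequality. \<open>exp (6 * theta_par R k) = exp (L_par k) * exp R\<close> is
  exactly what is lost: the first factor by looking at one class only, the second by
  \<open>card J \<le> exp R * h\<close>. So the average of \<open>load - 2\<close> is at most
  6.\<close>

lemma sum_load_le:
  assumes pot: "potential S \<le> real (card J)" and k: "k \<le> K"
    and h: "real (card J) * exp (- R) \<le> real (card (alive J \<gamma> (point S)))"
  shows "(\<Sum>j\<in>alive J \<gamma> (point S). load S k j) \<le> 8 * real (card (alive J \<gamma> (point S)))"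
proof -
  let ?V = "alive J \<gamma> (point S)" and ?\<theta> = "theta_par R k"
  let ?h = "real (card ?V)"
  have \<theta>: "?\<theta> > 0" using L_par_ge_one[of k] R by (simp add: theta_par_def)
  have t6: "6 * ?\<theta> = L_par k + R" by (simp add: theta_par_def)
  have cancel: "exp c * (exp (- c) * y) = y" for c y :: real by (simp add: exp_minus)
  have "exp (- L_par k) * (\<Sum>j\<in>?V. exp (?\<theta> * (load S k j - 2))) \<le> potential S"
    unfolding potential_def
    by (rule member_le_sum[of k "{..K}" "\<lambda>k. exp (- L_par k) * (\<Sum>j\<in>?V. exp (theta_par R k * (load S k j - 2)))"])
      (use k in \<open>auto intro!: mult_nonneg_nonneg sum_nonneg\<close>)
  then have "exp (- L_par k) * (\<Sum>j\<in>?V. exp (?\<theta> * (load S k j - 2))) \<le> real (card J)" using pot by linarith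
  also have "real (card J) \<le> exp R * ?h"
  proof -
    have "exp R * (real (card J) * exp (- R)) = real (card J)" by (simp add: exp_minus)
    moreover have "exp R * (real (card J) * exp (- R)) \<le> exp R * ?h" using h by (intro mult_left_mono) auto
    ultimately show ?thesis by linarith
  qed
  finally have "exp (L_par k) * (exp (- L_par k) * (\<Sum>j\<in>?V. exp (?\<theta> * (load S k j - 2)))) \<le> exp (L_par k) * (exp R * ?h)"
    by (intro mult_left_mono) auto
  then have up: "(\<Sum>j\<in>?V. exp (?\<theta> * (load S k j - 2))) \<le> exp (6 * ?\<theta>) * ?h"
    unfolding t6 exp_add cancel by (simp only: mult.assoc)
  \<comment> \<open>The tangent of \<open>exp\<close> at \<open>6 * ?\<theta>\<close> replaces the
    logarithm of an average.\<close>
  have "exp (6 * ?\<theta>) * (\<Sum>j\<in>?V. 1 + (?\<theta> * (load S k j - 2) - 6 * ?\<theta>)) \<le> (\<Sum>j\<in>?V. exp (?\<theta> * (load S k j - 2)))"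
    unfolding sum_distrib_left
  proof (rule sum_mono)
    fix j
    have "exp (6 * ?\<theta>) * (1 + (?\<theta> * (load S k j - 2) - 6 * ?\<theta>)) \<le> exp (6 * ?\<theta>) * exp (?\<theta> * (load S k j - 2) - 6 * ?\<theta>)"
      by (intro mult_left_mono exp_ge_add_one_self) auto
    then show "exp (6 * ?\<theta>) * (1 + (?\<theta> * (load S k j - 2) - 6 * ?\<theta>)) \<le> exp (?\<theta> * (load S k j - 2))"
      by (simp flip: exp_add)
  qed
  with up have "exp (6 * ?\<theta>) * (\<Sum>j\<in>?V. 1 + (?\<theta> * (load S k j - 2) - 6 * ?\<theta>)) \<le> exp (6 * ?\<theta>) * ?h" by linarith
  then have "(\<Sum>j\<in>?V. 1 + (?\<theta> * (load S k j - 2) - 6 * ?\<theta>)) \<le> ?h" by simp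
  also have "(\<Sum>j\<in>?V. 1 + (?\<theta> * (load S k j - 2) - 6 * ?\<theta>)) = ?h + ?\<theta> * ((\<Sum>j\<in>?V. load S k j) - 8 * ?h)"
    by (simp add: sum.distrib sum_subtractf sum_distrib_left algebra_simps)
  finally have "?\<theta> * ((\<Sum>j\<in>?V. load S k j) - 8 * ?h) \<le> 0" by simp
  then show ?thesis using \<theta> by (simp add: mult_le_0_iff)
qed

lemma card_dangerous_rows_le:
  assumes ok: "\<And>i. row_ok (point S) i (rowst S i) (recs S i)"
    and pot: "potential S \<le> real (card J)" and k: "k \<le> K"
    and h: "real (card J) * exp (- R) \<le> real (card (alive J \<gamma> (point S)))"
  shows "real (card (dangerous_rows S k)) \<le> delta_par k / 2 * real (card (alive J \<gamma> (point S)))"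
proof -
  let ?V = "alive J \<gamma> (point S)"
  let ?h = "real (card ?V)" and ?D = "dangerous_rows S k"
  have chi0: "0 \<le> chi S i p \<epsilon>" for i p \<epsilon> by (simp add: chi_def split: option.split)
  have row: "(\<Sum>\<epsilon>\<in>UNIV. if (i, \<epsilon>) \<in> ?D then exp (L_par k) * (class_coef S k (i, \<epsilon>) $ j)\<^sup>2 else 0) \<le> row_load S k j i" for i j
  proof (cases "\<exists>p. rowst S i = Active p \<and> cls p = k")
    case True
    then obtain p where p: "rowst S i = Active p" "cls p = k" by blast
    have "(if (i, \<epsilon>) \<in> ?D then exp (L_par k) * (class_coef S k (i, \<epsilon>) $ j)\<^sup>2 else 0) \<le> chi S i p \<epsilon> * (coef p $ j)\<^sup>2" for \<epsilon>
      using p chi0[of i p \<epsilon>] by (auto simp: dangerous_rows_def class_coef_def chi_def)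
    from this[of True] this[of False] show ?thesis
      using p by (simp add: UNIV_bool row_load_def distrib_right)
  next
    case False
    then have "(i, \<epsilon>) \<notin> ?D" for \<epsilon> by (auto simp: dangerous_rows_def)
    moreover have "0 \<le> row_load S k j i" using False by (auto simp: row_load_def split: row_status.split)
    ultimately show ?thesis by simp
  qed
  have "real (card ?D) * (exp (L_par k) * (s_par k / 2)) = (\<Sum>r\<in>?D. exp (L_par k) * (s_par k / 2))" by simp
  also have "\<dots> \<le> (\<Sum>r\<in>?D. exp (L_par k) * (\<Sum>j\<in>?V. (class_coef S k r $ j)\<^sup>2))"
  proof (intro sum_mono mult_left_mono)
    fix r assume "r \<in> ?D"
    then obtain p where p: "rowst S (fst r) = Active p" "cls p = k" by (auto simp: dangerous_rows_def)
    note o = ok[of "fst r", unfolded row_ok_def p row_status.case]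
    show "s_par k / 2 \<le> (\<Sum>j\<in>?V. (class_coef S k r $ j)\<^sup>2)"
      using o p by (simp add: class_coef_def alive_energy_def)
  qed simp
  also have "\<dots> = (\<Sum>j\<in>?V. \<Sum>r\<in>?D. exp (L_par k) * (class_coef S k r $ j)\<^sup>2)"
    unfolding sum_distrib_left by (rule sum.swap)
  also have "\<dots> = (\<Sum>j\<in>?V. \<Sum>r\<in>UNIV. if r \<in> ?D then exp (L_par k) * (class_coef S k r $ j)\<^sup>2 else 0)"
    by (intro sum.cong refl sum.mono_neutral_cong_left) auto
  also have "\<dots> = (\<Sum>j\<in>?V. \<Sum>i\<in>UNIV. \<Sum>\<epsilon>\<in>UNIV. if (i, \<epsilon>) \<in> ?D then exp (L_par k) * (class_coef S k (i, \<epsilon>) $ j)\<^sup>2 else 0)"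
    by (simp add: sum.cartesian_product flip: UNIV_Times_UNIV)
  also have "\<dots> \<le> (\<Sum>j\<in>?V. load S k j)"
    unfolding load_def by (intro sum_mono row)
  also have "\<dots> \<le> 8 * ?h" by (rule sum_load_le[OF pot k h])
  finally have "real (card ?D) * (32 / (delta_par k * s_par k) * (s_par k / 2)) \<le> 8 * ?h" by (simp add: exp_L_par)
  moreover have "32 / (delta_par k * s_par k) * (s_par k / 2) = 16 / delta_par k" using s_par_pos[of k] by simp
  ultimately have "real (card ?D) * (16 / delta_par k) \<le> 8 * ?h" by (simp only:)
  then show ?thesis using delta_par_pos[of k] by (simp add: field_simps)
qed

text \<open>Double counting of the alive squares of \<open>a\<close>, by rows and by columns. It
  pays both for the constraints of large rows and for the spectral bounds, since the cost of a class
  in \<open>covariance_exists\<close> is proportional to \<open>s_par\<close>.\<close>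

lemma total_energy_le:
  assumes ok: "\<And>i. row_ok (point S) i (rowst S i) (recs S i)"
  shows "M_par * real (card {i. rowst S i = Large}) + (\<Sum>i\<in>UNIV. case rowst S i of Active p \<Rightarrow> s_par (cls p) / 2 | _ \<Rightarrow> 0)
     \<le> real (card (alive J \<gamma> (point S)))"
proof -
  let ?V = "alive J \<gamma> (point S)"
  have "M_par * real (card {i. rowst S i = Large}) = (\<Sum>i\<in>UNIV. if rowst S i = Large then M_par else 0)"
    by (simp add: sum.If_cases)
  then have "M_par * real (card {i. rowst S i = Large}) + (\<Sum>i\<in>UNIV. case rowst S i of Active p \<Rightarrow> s_par (cls p) / 2 | _ \<Rightarrow> 0)
     = (\<Sum>i\<in>UNIV. (if rowst S i = Large then M_par else 0) + (case rowst S i of Active p \<Rightarrow> s_par (cls p) / 2 | _ \<Rightarrow> 0))"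
    by (simp add: sum.distrib)
  also have "\<dots> \<le> (\<Sum>i\<in>UNIV. \<Sum>j\<in>?V. (a $ i $ j)\<^sup>2)"
  proof (rule sum_mono)
    fix i
    show "(if rowst S i = Large then M_par else 0) + (case rowst S i of Active p \<Rightarrow> s_par (cls p) / 2 | _ \<Rightarrow> 0)
        \<le> (\<Sum>j\<in>?V. (a $ i $ j)\<^sup>2)"
    proof (cases "rowst S i")
      case Large
      then show ?thesis using ok[of i] by (simp add: row_ok_def alive_energy_def)
    next
      case (Active p)
      note o = ok[of i, unfolded row_ok_def Active row_status.case]
      have "s_par (cls p) / 2 < (\<Sum>j\<in>?V. (coef p $ j)\<^sup>2)" using o by (simp add: alive_energy_def)
      also have "\<dots> \<le> (\<Sum>j\<in>?V. (a $ i $ j)\<^sup>2)"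
      proof (rule sum_mono)
        fix j
        have "coef p $ j = 0 \<or> coef p $ j = a $ i $ j" using o by blast
        then show "(coef p $ j)\<^sup>2 \<le> (a $ i $ j)\<^sup>2" by auto
      qed
      finally show ?thesis using Active by simp
    qed (simp add: sum_nonneg)
  qed
  also have "\<dots> = (\<Sum>j\<in>?V. \<Sum>i\<in>UNIV. (a $ i $ j)\<^sup>2)" by (rule sum.swap)
  also have "\<dots> \<le> (\<Sum>j\<in>?V. 1)" by (intro sum_mono cols)
  finally show ?thesis by simp
qed

lemma feasible_covariance_exists:
  assumes ok: "\<And>i. row_ok (point S) i (rowst S i) (recs S i)"
    and pot: "potential S \<le> real (card J)"
    and h9: "9 \<le> card (alive J \<gamma> (point S))"
    and hR: "real (card J) * exp (- R) \<le> real (card (alive J \<gamma> (point S)))"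
  obtains U where "feasible_covariance J a R K \<gamma> S U"
proof -
  define x where "x = point S"
  define V where "V = alive J \<gamma> x"
  define h where "h = real (card V)"
  have h: "h \<ge> 9" using h9 by (simp add: h_def V_def x_def)
  define Ls where "Ls = {i. rowst S i = Large}"
  define C where "C = ((\<lambda>i. restrict_to V (a $ i)) ` Ls \<union>
     (\<Union>k\<in>{..K}. (\<lambda>r. restrict_to V (class_e_vec S k r)) ` dangerous_rows S k)) \<union> {restrict_to V x}"
  have finC: "finite C" by (simp add: C_def)
  have cardC: "real (card C) \<le> real (card Ls) + 43/160 * h + 1"
  proof -
    have "card C \<le> (card ((\<lambda>i. restrict_to V (a $ i)) ` Ls) +
        card (\<Union>k\<in>{..K}. (\<lambda>r. restrict_to V (class_e_vec S k r)) ` dangerous_rows S k)) + card {restrict_to V x}"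
      unfolding C_def by (meson add_mono_thms_linordered_semiring(3) card_Un_le order_trans)
    also have "\<dots> \<le> (card Ls + (\<Sum>k\<in>{..K}. card (dangerous_rows S k))) + 1"
    proof (intro add_mono card_image_le)
      have "card (\<Union>k\<in>{..K}. (\<lambda>r. restrict_to V (class_e_vec S k r)) ` dangerous_rows S k) \<le>
          (\<Sum>k\<in>{..K}. card ((\<lambda>r. restrict_to V (class_e_vec S k r)) ` dangerous_rows S k))"
        by (rule card_UN_le) simp
      also have "\<dots> \<le> (\<Sum>k\<in>{..K}. card (dangerous_rows S k))"
        by (intro sum_mono card_image_le) simp
      finally show "card (\<Union>k\<in>{..K}. (\<lambda>r. restrict_to V (class_e_vec S k r)) ` dangerous_rows S k) \<le>
          (\<Sum>k\<in>{..K}. card (dangerous_rows S k))" .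
    qed auto
    finally have "real (card C) \<le> real (card Ls + (\<Sum>k\<in>{..K}. card (dangerous_rows S k)) + 1)"
      unfolding of_nat_le_iff .
    then have "real (card C) \<le> real (card Ls) + (\<Sum>k\<in>{..K}. real (card (dangerous_rows S k))) + 1" by simp
    moreover have "(\<Sum>k\<in>{..K}. real (card (dangerous_rows S k))) \<le> (\<Sum>k\<in>{..K}. delta_par k / 2 * h)"
      unfolding h_def V_def x_def by (intro sum_mono card_dangerous_rows_le ok pot hR) simp
    moreover have "(\<Sum>k\<in>{..K}. delta_par k / 2 * h) = 43/160 * (\<Sum>k\<le>K. w_par k) * h"
      by (simp add: delta_par_def sum_distrib_left sum_distrib_right)
    moreover have "43/160 * (\<Sum>k\<le>K. w_par k) * h \<le> 43/160 * 1 * h"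
      using sum_w_par_le_one[of K] h by (intro mult_right_mono mult_left_mono) auto
    ultimately show ?thesis by linarith
  qed
  \<comment> \<open>The bound of \<open>U\<close> by its own diagonal is treated as one more
    spectral class, labelled \<open>None\<close>, whose vectors are the alive coordinate
    vectors.\<close>
  define f where "f t = (case t of Inl j \<Rightarrow> if j \<in> V then axis j 1 else 0
     | Inr r \<Rightarrow> (case rowst S (fst r) of Active p \<Rightarrow> restrict_to V (e_vec R p (snd r) x) | _ \<Rightarrow> 0))"
    for t :: "'n + 'm \<times> bool"
  define cl where "cl t = (case t of Inl j \<Rightarrow> None
     | Inr r \<Rightarrow> (case rowst S (fst r) of Active p \<Rightarrow> Some (cls p) | _ \<Rightarrow> None))"
    for t :: "'n + 'm \<times> bool"
  define al where "al \<kappa> = (case \<kappa> of None \<Rightarrow> 61/18 | Some k \<Rightarrow> 1973 / (100 * s_par k))" for \<kappa>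
  define Act where "Act = {r :: 'm \<times> bool. \<exists>p. rowst S (fst r) = Active p}"
  define I where "I = Inl ` V \<union> Inr ` Act"
  have al: "al \<kappa> > 0" for \<kappa> using s_par_pos by (simp add: al_def split: option.split)
  have fI: "f t = 0" if "t \<notin> I" for t
    using that by (auto simp: f_def I_def Act_def split: sum.splits row_status.splits)
  \<comment> \<open>Two signs at \<open>100 * s / 1973\<close> each, written as a multiple of
    \<open>s / 2\<close> for comparison with the energy.\<close>
  have sumI: "(\<Sum>t\<in>I. 1 / al (cl t)) = 18/61 * h + 400/1973 * (\<Sum>i\<in>UNIV. case rowst S i of Active p \<Rightarrow> s_par (cls p) / 2 | _ \<Rightarrow> 0)"
  proof -
    have "(\<Sum>t\<in>I. 1 / al (cl t)) = (\<Sum>t\<in>Inl ` V. 1 / al (cl t)) + (\<Sum>t\<in>Inr ` Act. 1 / al (cl t))"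
      unfolding I_def by (rule sum.union_disjoint) auto
    also have "(\<Sum>t\<in>Inl ` V. 1 / al (cl t)) = 18/61 * h"
      by (simp add: sum.reindex cl_def al_def h_def)
    also have "(\<Sum>t\<in>Inr ` Act. 1 / al (cl t)) = (\<Sum>r\<in>Act. 1 / al (cl (Inr r)))"
      by (simp add: sum.reindex)
    also have "\<dots> = (\<Sum>r\<in>(UNIV :: ('m \<times> bool) set). 200/1973 * (case rowst S (fst r) of Active p \<Rightarrow> s_par (cls p) / 2 | _ \<Rightarrow> 0))"
      by (rule sum.mono_neutral_cong_left) (auto simp: Act_def cl_def al_def split: row_status.split)
    also have "\<dots> = (\<Sum>i\<in>UNIV. \<Sum>\<epsilon>\<in>(UNIV :: bool set). 200/1973 * (case rowst S i of Active p \<Rightarrow> s_par (cls p) / 2 | _ \<Rightarrow> 0))"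
      unfolding sum.cartesian_product UNIV_Times_UNIV by (simp add: case_prod_beta)
    also have "\<dots> = 400/1973 * (\<Sum>i\<in>UNIV. case rowst S i of Active p \<Rightarrow> s_par (cls p) / 2 | _ \<Rightarrow> 0)"
      by (simp add: UNIV_bool sum_distrib_left)
    finally show ?thesis .
  qed
  have count: "real (card C) + (\<Sum>t\<in>I. 1 / al (cl t)) + h / 65536 \<le> real (card V)"
  proof -
    define e where "e = (\<Sum>i\<in>UNIV. case rowst S i of Active p \<Rightarrow> s_par (cls p) / 2 | _ \<Rightarrow> 0)"
    have "60/7 * real (card Ls) + e \<le> h"
      using total_energy_le[OF ok] by (simp add: e_def Ls_def h_def V_def x_def M_par_def)
    \<comment> \<open>A large row needs one dimension but brings energy 60/7, and 60/7 * 400/1973 >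
      1, so large rows are covered by the allowance for active ones. The constraint for
      \<open>x\<close> is paid by \<open>1 \<le> h / 9\<close>.\<close>
    then have "real (card Ls) + 400/1973 * e \<le> 400/1973 * h" using of_nat_0_le_iff[of "card Ls", where 'a = real] by linarith
    then show ?thesis using cardC h unfolding sumI e_def[symmetric] h_def[symmetric] by linarith
  qed
  obtain U where U: "U \<in> admissible_covariances V C" "trace U \<ge> h / 65536"
    and spec: "\<And>\<kappa> g z. z = (\<Sum>r | r \<in> I \<and> cl r = \<kappa>. g r *\<^sub>R f r) \<Longrightarrow>
       z \<bullet> (U *v z) \<le> al \<kappa> * (\<Sum>r | r \<in> I \<and> cl r = \<kappa>. (g r)\<^sup>2 * (f r \<bullet> (U *v f r)))"
    by (rule covariance_exists[where f = f and cl = cl and \<alpha> = al and I = I and C = C and V = V and \<tau> = "h / 65536", OF finC al fI _ count]) (use h in auto)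
  have supp: "\<And>i j. \<not> (i \<in> V \<and> j \<in> V) \<Longrightarrow> U $ i $ j = 0" and psd: "pos_semidef U"
    and UC: "\<And>c. c \<in> C \<Longrightarrow> U *v c = 0" and U1: "\<And>j. U $ j $ j \<le> 1"
    using U(1) by (auto simp: admissible_covariances_def)
  have symU: "transpose U = U" using psd by (simp add: pos_semidef_def)
  have l1: "loewner_le U ((61/18) *\<^sub>R diag_part U)"
  proof (rule loewner_diagI[OF symU])
    fix z
    have set: "{t. t \<in> I \<and> cl t = None} = Inl ` V"
      by (auto simp: I_def cl_def Act_def)
    have "restrict_to V z = (\<Sum>j\<in>V. z $ j *\<^sub>R axis j 1)"
      by (simp add: vec_eq_iff axis_def if_distrib[of "\<lambda>x. _ * x"] cong: if_cong)
    also have "\<dots> = (\<Sum>t | t \<in> I \<and> cl t = None. (case t of Inl j \<Rightarrow> z $ j | Inr _ \<Rightarrow> 0) *\<^sub>R f t)"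
      unfolding set by (simp add: sum.reindex f_def)
    finally have "restrict_to V z \<bullet> (U *v restrict_to V z) \<le>
        al None * (\<Sum>t | t \<in> I \<and> cl t = None. (case t of Inl j \<Rightarrow> z $ j | Inr _ \<Rightarrow> 0)\<^sup>2 * (f t \<bullet> (U *v f t)))"
      by (rule spec)
    also have "\<dots> = 61/18 * (\<Sum>j\<in>V. U $ j $ j * (z $ j)\<^sup>2)"
      unfolding set by (simp add: sum.reindex f_def al_def mult.commute)
    also have "(\<Sum>j\<in>V. U $ j $ j * (z $ j)\<^sup>2) = (\<Sum>j\<in>UNIV. U $ j $ j * (z $ j)\<^sup>2)"
      using supp by (intro sum.mono_neutral_left) auto
    finally show "z \<bullet> (U *v z) \<le> 61/18 * (\<Sum>j\<in>UNIV. U $ j $ j * (z $ j)\<^sup>2)"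
      by (simp add: restrict_form[of V U, OF supp])
  qed
  let ?E = "E_mat J R \<gamma> S"
  let ?G = "\<lambda>k. ?E k ** U ** transpose (?E k)"
  have l2: "loewner_le (?G k)
      ((1973 / (100 * s_par k)) *\<^sub>R diag_part (?G k))" for k
  proof (rule loewner_diagI)
    show "transpose (?G k) =
        ?G k"
      by (simp add: matrix_transpose_mul symU matrix_mul_assoc)
    fix y :: "real ^ ('m \<times> bool)"
    have set: "{t. t \<in> I \<and> cl t = Some k} = Inr ` active_rows S k"
      by (auto simp: I_def cl_def Act_def active_rows_def)
    have E: "?E k $ r = (if r \<in> active_rows S k then f (Inr r) else 0)" for r
      by (auto simp: E_mat_def active_rows_def f_def V_def x_def split: row_status.split)
    have "(\<Sum>r\<in>UNIV. y $ r *\<^sub>R ?E k $ r) = (\<Sum>r\<in>active_rows S k. y $ r *\<^sub>R f (Inr r))"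
      by (rule sum.mono_neutral_cong_right) (auto simp: E)
    also have "\<dots> = (\<Sum>t | t \<in> I \<and> cl t = Some k. (case t of Inl _ \<Rightarrow> 0 | Inr r \<Rightarrow> y $ r) *\<^sub>R f t)"
      unfolding set by (simp add: sum.reindex)
    finally have "(\<Sum>r\<in>UNIV. y $ r *\<^sub>R ?E k $ r) \<bullet> (U *v (\<Sum>r\<in>UNIV. y $ r *\<^sub>R ?E k $ r)) \<le>
        al (Some k) * (\<Sum>t | t \<in> I \<and> cl t = Some k. (case t of Inl _ \<Rightarrow> 0 | Inr r \<Rightarrow> y $ r)\<^sup>2 * (f t \<bullet> (U *v f t)))"
      by (rule spec)
    also have "\<dots> = 1973 / (100 * s_par k) * (\<Sum>r\<in>active_rows S k. (y $ r)\<^sup>2 * (f (Inr r) \<bullet> (U *v f (Inr r))))"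
      unfolding set by (simp add: sum.reindex al_def)
    also have "(\<Sum>r\<in>active_rows S k. (y $ r)\<^sup>2 * (f (Inr r) \<bullet> (U *v f (Inr r)))) =
        (\<Sum>r\<in>UNIV. ?G k $ r $ r * (y $ r)\<^sup>2)"
      unfolding congruence_form(2) by (rule sum.mono_neutral_cong_left) (auto simp: E)
    finally show "y \<bullet> ((?G k) *v y) \<le>
       1973 / (100 * s_par k) * (\<Sum>r\<in>UNIV. ?G k $ r $ r * (y $ r)\<^sup>2)"
      unfolding congruence_form(1) .
  qed
  have "U \<noteq> 0"
  proof
    assume "U = 0"
    then have "trace U = 0" by (simp add: trace_def)
    then show False using U(2) h by simp
  qed
  moreover have "U *v restrict_to V (a $ i) = 0" if "rowst S i = Large" for i
    by (rule UC) (use that in \<open>auto simp: C_def Ls_def\<close>)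
  moreover have "U *v restrict_to V (e_vec R p \<epsilon> x) = 0" if r: "recs S i p \<epsilon> = Some (SRec Dangerous X)" for i p \<epsilon> X
  proof (rule UC)
    have p: "rowst S i = Active p" using ok[of i] r by (auto simp: row_ok_def)
    have "cls p \<le> K" using ok[of i] by (simp add: row_ok_def p)
    moreover have "(i, \<epsilon>) \<in> dangerous_rows S (cls p)" using r p by (auto simp: dangerous_rows_def)
    moreover have "class_e_vec S (cls p) (i, \<epsilon>) = e_vec R p \<epsilon> x" by (simp add: class_e_vec_def p x_def)
    ultimately show "restrict_to V (e_vec R p \<epsilon> x) \<in> C" unfolding C_def by force
  qed
  moreover have "U *v restrict_to V x = 0" by (rule UC) (simp add: C_def)
  ultimately have "feasible_covariance J a R K \<gamma> S U"
    unfolding feasible_covariance_def Let_def x_def[symmetric] V_def[symmetric] using psd supp U1 U(2) l1 l2 by (simp add: h_def)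
  then show ?thesis by (rule that)
qed

end

section \<open>The trajectory\<close>

context rounding_walk
begin

definition good :: "('m, 'n) state \<Rightarrow> bool" where
  "good S \<longleftrightarrow> (\<forall>j. \<bar>point S $ j\<bar> \<le> 1) \<and> (\<forall>j. j \<notin> J \<longrightarrow> point S $ j = 0) \<and>
     (\<forall>i. row_ok (point S) i (rowst S i) (recs S i)) \<and> potential S \<le> real (card J)"

lemma alive_b: "alive J \<gamma> b = J"
  using b_in by (auto simp: alive_def) (smt (verit))

lemma b_cube: "\<bar>b $ j\<bar> \<le> 1"
  using b_in[of j] b_out[of j] \<gamma> by (cases "j \<in> J") auto

text \<open>Whether by prepayment or by two records of value 1, a row charges at most
  \<open>2 * (a $ i $ j)\<^sup>2\<close> to a column. Hence initial loads are at most 2 and no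
  exponent in the potential is positive.\<close>

lemma initial_good: "good (initial_state J a b R K \<gamma>)"
proof -
  define S where "S = (initial_state J a b R K \<gamma> :: ('m, 'n) state)"
  have pS: "point S = b" by (simp add: S_def initial_state_def Let_def)
  have st: "rowst S i = (if alive_energy J \<gamma> b (a $ i) > M_par then Large else snd (normalize R K b 0 (a $ i)))"
    and rc: "recs S i p \<epsilon> = born_records (rowst S i) p \<epsilon>" for i p \<epsilon>
    by (simp_all add: S_def initial_state_def Let_def)
  have small: "(norm (a $ i))\<^sup>2 \<le> s_par 0" if "\<not> alive_energy J \<gamma> b (a $ i) > M_par" for i
  proof -
    have "alive_energy J \<gamma> b (a $ i) = (norm (a $ i))\<^sup>2"
      by (rule alive_energy_eq_norm) (simp add: alive_b supp)
    then show ?thesis using that by (simp add: M_par_def s_par_def)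
  qed
  have ok: "row_ok b i (rowst S i) (recs S i)" for i
  proof (cases "alive_energy J \<gamma> b (a $ i) > M_par")
    case True
    then show ?thesis by (simp add: row_ok_def st rc born_records_def)
  next
    case False
    show ?thesis
    proof (rule normalized_row_ok[OF b_cube _ _ _ small[OF False]])
      show "rowst S i = snd (normalize R K b 0 (a $ i))" using False by (simp add: st)
    qed (auto simp: alive_b supp budget_def rc born_records_def)
  qed
  have row: "row_load S k j i \<le> 2 * (a $ i $ j)\<^sup>2" for k j i
  proof (cases "rowst S i")
    case (Active c)
    then have nl: "\<not> alive_energy J \<gamma> b (a $ i) > M_par" by (auto simp: st split: if_splits)
    have "normalized_ok R K b 0 (a $ i) (Active c)"
      using normalize_ok[OF R _ small[OF nl], of K b] nl Active by (simp add: st)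
    note o = this[unfolded normalized_ok_def row_status.case]
    have "chi S i c \<epsilon> = 1" for \<epsilon>
      using o by (simp add: chi_def rc born_records_def Active Z_val_def pS)
    moreover have "(coef c $ j)\<^sup>2 \<le> (a $ i $ j)\<^sup>2"
    proof -
      have "coef c $ j = 0 \<or> coef c $ j = a $ i $ j" using o by blast
      then show ?thesis by auto
    qed
    ultimately show ?thesis by (simp add: row_load_def Active)
  qed (simp_all add: row_load_def)
  have "load S k j \<le> 2" for k j
  proof -
    have "load S k j \<le> (\<Sum>i\<in>UNIV. 2 * (a $ i $ j)\<^sup>2)" unfolding load_def by (intro sum_mono row)
    also have "\<dots> = 2 * (\<Sum>i\<in>UNIV. (a $ i $ j)\<^sup>2)" by (simp add: sum_distrib_left)
    finally show ?thesis using cols[of j] by linarith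
  qed
  then have e1: "exp (theta_par R k * (load S k j - 2)) \<le> 1" for k j
    using L_par_ge_one[of k] R by (simp add: theta_par_def mult_le_0_iff)
  have "potential S \<le> (\<Sum>k\<le>K. exp (- L_par k) * (\<Sum>j\<in>J. 1))"
    unfolding potential_def pS alive_b by (intro sum_mono mult_left_mono e1) auto
  also have "\<dots> = (\<Sum>k\<le>K. exp (- L_par k)) * real (card J)" by (simp add: sum_distrib_right)
  also have "\<dots> \<le> 1 * real (card J)" by (intro mult_right_mono sum_exp_neg_L_par) auto
  finally have "potential S \<le> real (card J)" by simp
  then show ?thesis using ok b_cube b_out by (simp add: good_def pS flip: S_def)
qed

lemma norm_point_le:
  assumes "good S"
  shows "(norm (point S))\<^sup>2 \<le> real (card J)"
proof -
  have "(norm (point S))\<^sup>2 = (\<Sum>j\<in>J. (point S $ j)\<^sup>2)"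
    unfolding norm_square_vec using assms by (intro sum.mono_neutral_right) (auto simp: good_def)
  also have "\<dots> \<le> (\<Sum>j\<in>J. 1)"
    using assms by (intro sum_mono) (auto simp: good_def abs_square_le_1)
  finally show ?thesis by simp
qed

lemma good_successor:
  assumes S: "good S" and h: "\<not> int (card (alive J \<gamma> (point S))) \<le> N_bound R (card J)"
  obtains S' where "complete_successor J a R K \<gamma> S S'" "good S'"
    "(norm (point S'))\<^sup>2 = (norm (point S))\<^sup>2 + \<gamma>\<^sup>2"
proof -
  let ?V = "alive J \<gamma> (point S)"
  have x: "\<And>j. \<bar>point S $ j\<bar> \<le> 1" and ok: "\<And>i. row_ok (point S) i (rowst S i) (recs S i)"
    and pot: "potential S \<le> real (card J)" and x0: "\<And>j. j \<notin> J \<Longrightarrow> point S $ j = 0"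
    using S by (auto simp: good_def)
  \<comment> \<open>For integers, exceeding \<open>\<lceil>c\<rceil> - 1\<close> means being at
    least \<open>\<lceil>c\<rceil>\<close>; this is why the \<open>- 1\<close> in
    \<open>N_bound\<close> is harmless.\<close>
  have h9: "9 \<le> card ?V" and "\<lceil>real (card J) * exp (- R)\<rceil> \<le> int (card ?V)"
    using h by (auto simp: N_bound_def)
  then have hR: "real (card J) * exp (- R) \<le> real (card ?V)" by (simp add: ceiling_le_iff)
  obtain U where U: "feasible_covariance J a R K \<gamma> S U"
    using feasible_covariance_exists[OF ok pot h9 hR] .
  have "pos_semidef U" "trace U \<ge> real (card ?V) / 65536"
    using U unfolding feasible_covariance_def Let_def by blast+
  moreover have "real (card ?V) / 65536 > 0" using h9 by simp
  ultimately obtain D where D: "direction_law U D" using direction_law_exists[of U] by (meson less_le_trans)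
  obtain v where v: "v \<in> set_pmf D" and pv: "potential (successor J a R K \<gamma> S v) \<le> potential S"
    using potential_drift[OF U D x ok] .
  interpret walk_step J a b R K \<gamma> "point S" v by (rule atom_walk_step[OF U D v x])
  let ?S' = "successor J a R K \<gamma> S v"
  have pS': "point ?S' = point S + \<gamma> *\<^sub>R v" by (simp add: successor_def Let_def)
  have vJ: "v $ j = 0" if "j \<notin> J" for j using v_supp[of j] that by (simp add: alive_def)
  show ?thesis
  proof (rule that[of ?S'])
    show "complete_successor J a R K \<gamma> S ?S'"
      using U D v by (auto simp: complete_successor_def)
    have "row_ok (point ?S') i (rowst ?S' i) (recs ?S' i)" for i
      unfolding pS'
      by (rule step_row_ok[OF refl ok atom_large[OF U D v x] atom_dangerous[OF U D v x]])
    then show "good ?S'"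
      unfolding good_def using x'_cube x0 vJ pv pot by (simp add: pS')
    have "orthogonal (point S) (\<gamma> *\<^sub>R v)"
      using atom_point[OF U D v x] by (simp add: orthogonal_def)
    from norm_add_Pythagorean[OF this] show "(norm (point ?S'))\<^sup>2 = (norm (point S))\<^sup>2 + \<gamma>\<^sup>2"
      by (simp add: pS' v_norm)
  qed
qed

text \<open>Each step raises the squared norm by \<open>\<gamma>\<^sup>2\<close>, and
  \<open>norm_point_le\<close> caps it at \<open>card J\<close>, so \<open>n\<close> bounds the
  number of steps still possible. For \<open>n = 0\<close> one more good successor would exceed the
  cap.\<close>

lemma good_walk_exists:
  assumes "good S" and "real (card J) - (norm (point S))\<^sup>2 \<le> real n * \<gamma>\<^sup>2"
  shows "\<exists>Ss. Ss \<noteq> [] \<and> hd Ss = S \<and>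
     (\<forall>t. Suc t < length Ss \<longrightarrow> complete_successor J a R K \<gamma> (Ss ! t) (Ss ! Suc t)) \<and>
     good (last Ss) \<and> int (card (alive J \<gamma> (point (last Ss)))) \<le> N_bound R (card J)"
  using assms
proof (induction n arbitrary: S)
  case 0
  have "int (card (alive J \<gamma> (point S))) \<le> N_bound R (card J)"
  proof (rule ccontr)
    assume "\<not> ?thesis"
    from good_successor[OF 0(1) this] obtain S' where "good S'"
      "(norm (point S'))\<^sup>2 = (norm (point S))\<^sup>2 + \<gamma>\<^sup>2" .
    moreover have "\<gamma>\<^sup>2 > 0" using \<gamma> by simp
    moreover have "real (card J) \<le> (norm (point S))\<^sup>2" using 0(2) by simp
    ultimately show False using norm_point_le[of S'] by linarith
  qed
  then show ?case using 0 by (intro exI[of _ "[S]"]) simp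
next
  case (Suc n)
  show ?case
  proof (cases "int (card (alive J \<gamma> (point S))) \<le> N_bound R (card J)")
    case True
    then show ?thesis using Suc.prems by (intro exI[of _ "[S]"]) simp
  next
    case False
    obtain S' where S': "complete_successor J a R K \<gamma> S S'" "good S'"
      "(norm (point S'))\<^sup>2 = (norm (point S))\<^sup>2 + \<gamma>\<^sup>2"
      by (rule good_successor[OF Suc.prems(1) False])
    have "real (card J) - (norm (point S'))\<^sup>2 \<le> real n * \<gamma>\<^sup>2"
      using Suc.prems(2) S'(3) by (simp add: algebra_simps)
    from Suc.IH[OF S'(2) this] obtain Ss where Ss: "Ss \<noteq> []" "hd Ss = S'"
      "\<forall>t. Suc t < length Ss \<longrightarrow> complete_successor J a R K \<gamma> (Ss ! t) (Ss ! Suc t)"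
      "good (last Ss)" "int (card (alive J \<gamma> (point (last Ss)))) \<le> N_bound R (card J)" by blast
    have "complete_successor J a R K \<gamma> ((S # Ss) ! t) ((S # Ss) ! Suc t)" if "Suc t < length (S # Ss)" for t
    proof (cases t)
      case 0
      then show ?thesis using S'(1) Ss(1,2) by (simp add: hd_conv_nth)
    next
      case (Suc t')
      then show ?thesis using Ss(3) that by simp
    qed
    then show ?thesis using Ss by (intro exI[of _ "S # Ss"]) simp
  qed
qed

lemma budget_mono: "k \<le> l \<Longrightarrow> budget k \<le> budget l"
  unfolding budget_def using B_par_pos[OF R] by (intro add_left_mono sum_mono2) (auto intro: less_imp_le)

text \<open>An active restriction is accounted for as if it retired now. A terminal residual costs
  at most 2: Cauchy-Schwarz and \<open>s_par (Suc K) \<le> 1 / card J\<close> bound its sum of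
  absolute values by 1, and displacements are at most 2.\<close>

lemma good_discrepancy_le:
  assumes S: "good S" and y: "near (point S) y" and eq: "\<And>j. j \<in> alive J \<gamma> (point S) \<Longrightarrow> y $ j = point S $ j"
  shows "\<bar>a $ i \<bullet> (y - b)\<bar> \<le> budget (Suc K) + 2"
proof -
  let ?x = "point S"
  have x: "\<And>j. \<bar>?x $ j\<bar> \<le> 1" and ok: "row_ok ?x i (rowst S i) (recs S i)"
    using S by (auto simp: good_def)
  have dead: "\<bar>c \<bullet> (y - ?x)\<bar> \<le> \<gamma> * real (card J)" if c: "\<And>j. c $ j = 0 \<or> c $ j = a $ i $ j" for c
  proof -
    let ?d = "\<chi> j. if j \<in> alive J \<gamma> ?x then 0 else c $ j"
    have "c \<bullet> (y - ?x) = ?d \<bullet> (y - ?x)"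
      unfolding inner_vec_def by (intro sum.cong refl) (auto simp: eq)
    also have "\<bar>\<dots>\<bar> \<le> \<gamma> * real (card J)"
    proof (rule dead_inner_le[OF _ _ _ y])
      fix j
      show "\<bar>?d $ j\<bar> \<le> 1" using c[of j] entry_le[of i j] by auto
      show "?d $ j = 0" if "j \<notin> J" using c[of j] supp[OF that, of i] by auto
    qed simp
    finally show ?thesis .
  qed
  have b0: "budget (Suc K) \<ge> 1" using budget_mono[of 0 "Suc K"] by (simp add: budget_def)
  show ?thesis
  proof (cases "rowst S i")
    case Large
    then have "a $ i \<bullet> (?x - b) = 0" using ok by (simp add: row_ok_def)
    then have "a $ i \<bullet> (y - b) = a $ i \<bullet> (y - ?x)" by (simp add: inner_diff_right)
    then show ?thesis using dead[of "a $ i"] \<gamma> b0 by simp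
  next
    case (Active p)
    note o = ok[unfolded row_ok_def Active row_status.case]
    have Zle: "Z_val R p \<epsilon> ?x \<le> 21/20 * B_par R (cls p)" for \<epsilon>
    proof -
      obtain rs where "rs = Live \<and> Z_val R p \<epsilon> ?x < B_par R (cls p) \<or>
             rs = Dangerous \<and> Z_val R p \<epsilon> ?x \<le> 21/20 * B_par R (cls p)" using o by blast
      then show ?thesis using B_par_pos[OF R, of "cls p"] by auto
    qed
    have "\<bar>a $ i \<bullet> (y - b) - coef p \<bullet> (y - anchor p)\<bar> \<le> budget (cls p) + B_par R (cls p)" using o y by blast
    moreover have "\<bar>coef p \<bullet> (?x - anchor p)\<bar> \<le> 21/20 * B_par R (cls p) + B_par R (cls p) / 2"
      using Zle x o by (intro abs_coef_inner_le) auto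
    moreover have "\<bar>coef p \<bullet> (y - ?x)\<bar> \<le> \<gamma> * real (card J)" using o by (intro dead) auto
    moreover have "\<gamma> * real (card J) \<le> B_par R (cls p) / 20"
      using mesh[of "cls p"] o by (simp add: small_mesh_def Let_def)
    moreover have "coef p \<bullet> (y - anchor p) = coef p \<bullet> (?x - anchor p) + coef p \<bullet> (y - ?x)"
      by (simp add: inner_diff_right)
    moreover have "budget (Suc (cls p)) = budget (cls p) + 26/10 * B_par R (cls p)" by (simp add: budget_def)
    moreover have "budget (Suc (cls p)) \<le> budget (Suc K)" using o by (intro budget_mono) simp
    ultimately show ?thesis by linarith
  next
    case (Terminal w u)
    note o = ok[unfolded row_ok_def Terminal row_status.case]
    have wJ: "w $ j = 0" if "j \<notin> J" for j
    proof -
      have "w $ j = 0 \<or> w $ j = a $ i $ j" using o by blast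
      then show ?thesis using supp[OF that, of i] by auto
    qed
    have "\<bar>w \<bullet> (y - u)\<bar> \<le> (\<Sum>j\<in>UNIV. \<bar>w $ j * (y - u) $ j\<bar>)" by (simp add: inner_vec_def sum_abs)
    also have "\<dots> = (\<Sum>j\<in>J. \<bar>w $ j * (y - u) $ j\<bar>)" using wJ by (intro sum.mono_neutral_right) auto
    also have "\<dots> \<le> (\<Sum>j\<in>J. \<bar>w $ j\<bar> * 2)"
    proof (rule sum_mono)
      fix j
      have "\<bar>y $ j\<bar> \<le> 1" "\<bar>u $ j\<bar> \<le> 1" using y o by (auto simp: near_def)
      then have "\<bar>(y - u) $ j\<bar> \<le> 2" by simp
      then show "\<bar>w $ j * (y - u) $ j\<bar> \<le> \<bar>w $ j\<bar> * 2" unfolding abs_mult by (intro mult_left_mono) auto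
    qed
    also have "\<dots> = 2 * (\<Sum>j\<in>J. \<bar>w $ j\<bar>)" by (simp add: sum_distrib_left mult.commute)
    also have "(\<Sum>j\<in>J. \<bar>w $ j\<bar>) \<le> 1"
    proof (rule power2_le_imp_le)
      have "(\<Sum>j\<in>J. \<bar>w $ j\<bar>)\<^sup>2 \<le> (\<Sum>j\<in>J. \<bar>w $ j\<bar>\<^sup>2) * real (card J)"
        by (rule sum_squared_le_sum_of_squares)
      also have "(\<Sum>j\<in>J. \<bar>w $ j\<bar>\<^sup>2) = (norm w)\<^sup>2"
        unfolding norm_square_vec using wJ by (simp add: sum.mono_neutral_left)
      also have "(norm w)\<^sup>2 * real (card J) \<le> 1 / real (card J) * real (card J)"
        using o K by (intro mult_right_mono) auto
      also have "\<dots> = 1\<^sup>2" using card_J by auto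
      finally show "(\<Sum>j\<in>J. \<bar>w $ j\<bar>)\<^sup>2 \<le> 1\<^sup>2" .
    qed simp
    finally have "\<bar>w \<bullet> (y - u)\<bar> \<le> 2" by simp
    moreover have "\<bar>a $ i \<bullet> (y - b) - w \<bullet> (y - u)\<bar> \<le> budget (Suc K)" using o y by blast
    ultimately show ?thesis by linarith
  qed
qed

end

section \<open>From the end of the walk to the rounding of \<open>b\<close>\<close>

lemma infnorm_le_cart:
  fixes x :: "real ^ 'n::finite"
  assumes "\<And>i. \<bar>x $ i\<bar> \<le> c"
  shows "infnorm x \<le> c"
  unfolding infnorm_cart by (rule cSup_least) (use assms in auto)

theorem theorem1p2:
  fixes A :: "real ^ 'n::finite ^ 'm::finite" and b :: "real ^ 'n" and R :: real
  assumes columns: "\<forall>j. (\<Sum>i\<in>UNIV. (A $ i $ j)\<^sup>2) \<le> 1"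
    and box: "\<forall>j. \<bar>b $ j\<bar> \<le> 1"
    and R: "R \<ge> 0"
  defines "J \<equiv> fractional b"
  defines "q \<equiv> card J"
  defines "a \<equiv> (\<chi> i. restrict_to J (A $ i))"
  defines "bJ \<equiv> restrict_to J b"
  shows "(\<exists>y. good_rounding A b R y) \<and>
    (q \<le> 8 \<longrightarrow> good_rounding A b R b) \<and>
    (q > 8 \<longrightarrow> (\<forall>K. s_par (K + 1) \<le> 1 / real q \<longrightarrow>
       (\<exists>\<gamma> Ss. 0 < \<gamma> \<and> \<gamma> < 1/2 \<and> (\<forall>j\<in>J. \<gamma> < 1 - \<bar>b $ j\<bar>) \<and>
          trajectory J a bJ R K \<gamma> Ss \<and>
          int (card (alive J \<gamma> (point (last Ss)))) \<le> N_bound R q \<and>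
          good_rounding A b R (final_rounding J b \<gamma> (point (last Ss))))))"
proof -
  have trivial: "good_rounding A b R b" if "q \<le> 8"
    using that box R by (simp add: good_rounding_def N_bound_def q_def J_def infnorm_0)
  have main: "\<exists>\<gamma> Ss. 0 < \<gamma> \<and> \<gamma> < 1/2 \<and> (\<forall>j\<in>J. \<gamma> < 1 - \<bar>b $ j\<bar>) \<and>
          trajectory J a bJ R K \<gamma> Ss \<and>
          int (card (alive J \<gamma> (point (last Ss)))) \<le> N_bound R q \<and>
          good_rounding A b R (final_rounding J b \<gamma> (point (last Ss)))"
    if q8: "q > 8" and K: "s_par (K + 1) \<le> 1 / real q" for K
  proof -
    obtain \<gamma> where \<gamma>0: "0 < \<gamma>" "\<gamma> < 1/2" "\<And>j. j \<in> J \<Longrightarrow> \<gamma> < 1 - \<bar>b $ j\<bar>" "\<gamma> * real q \<le> 1"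
      and mesh: "\<And>k. k \<le> K \<Longrightarrow> small_mesh R q (2 * real CARD('m) * weight_par R k) k \<gamma>"
      by (rule mesh_exists[OF R, of J "\<lambda>j. \<bar>b $ j\<bar>" q K "\<lambda>k. 2 * real CARD('m) * weight_par R k"])
        (auto simp: J_def fractional_def)
    interpret rounding_walk J a bJ R K \<gamma>
    proof
      show "(\<Sum>i\<in>UNIV. (a $ i $ j)\<^sup>2) \<le> 1" for j
        using columns by (cases "j \<in> J") (auto simp: a_def)
    qed (use R q8 K \<gamma>0 mesh in \<open>auto simp: q_def a_def bJ_def\<close>)
    obtain n :: nat where "real q / \<gamma>\<^sup>2 \<le> real n" using real_arch_simple by blast
    then have "real (card J) \<le> real n * \<gamma>\<^sup>2" using \<gamma>(1) by (simp add: pos_divide_le_eq q_def)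
    then have n: "real (card J) - (norm (point (initial_state J a bJ R K \<gamma> :: ('m, 'n) state)))\<^sup>2 \<le> real n * \<gamma>\<^sup>2"
      using zero_le_power2[of "norm (point (initial_state J a bJ R K \<gamma> :: ('m, 'n) state))"] by linarith
    obtain Ss where Ss: "Ss \<noteq> []" "hd Ss = (initial_state J a bJ R K \<gamma> :: ('m, 'n) state)"
      "\<forall>t. Suc t < length Ss \<longrightarrow> complete_successor J a R K \<gamma> (Ss ! t) (Ss ! Suc t)"
      "good (last Ss)" "int (card (alive J \<gamma> (point (last Ss)))) \<le> N_bound R (card J)"
      using good_walk_exists[OF initial_good n] by blast
    define x where "x = point (last Ss)"
    define y where "y = final_rounding J b \<gamma> x"
    have x1: "\<bar>x $ j\<bar> \<le> 1" for j using Ss(4) by (simp add: good_def x_def)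
    have notJ: "\<bar>b $ j\<bar> = 1" if "j \<notin> J" for j
      using that box[rule_format, of j] by (simp add: J_def fractional_def)
    have dead: "1 - \<gamma> \<le> \<bar>x $ j\<bar>" if "j \<in> J" "j \<notin> alive J \<gamma> x" for j
      using that by (simp add: alive_def)
    \<comment> \<open>Since \<open>\<gamma> < 1/2\<close>, a dead coordinate is far from 0 and its
      sign is nonzero.\<close>
    have y_dead: "\<bar>y $ j\<bar> = 1" "\<bar>y $ j - x $ j\<bar> \<le> \<gamma>" if "j \<in> J" "j \<notin> alive J \<gamma> x" for j
      using dead[OF that] x1[of j] \<gamma> that by (auto simp: y_def final_rounding_def sgn_if)
    have y_alive: "y $ j = x $ j" if "j \<in> alive J \<gamma> x" for j
      using that by (simp add: y_def final_rounding_def alive_def)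
    have y_out: "y $ j = b $ j" if "j \<notin> J" for j
      using that by (simp add: y_def final_rounding_def)
    have y1: "\<bar>y $ j\<bar> \<le> 1" for j
      using y_dead(1)[of j] y_alive[of j] y_out[of j] x1[of j] box[rule_format, of j]
      by (cases "j \<in> J"; cases "j \<in> alive J \<gamma> x") auto
    have frac: "fractional y = alive J \<gamma> x"
    proof
      show "fractional y \<subseteq> alive J \<gamma> x"
        using y_dead(1) y_out notJ by (force simp: fractional_def)
      show "alive J \<gamma> x \<subseteq> fractional y"
        using y_alive \<gamma> by (auto simp: fractional_def alive_def)
    qed
    have "near x y" using y1 y_dead(2) by (auto simp: near_def)
    have "\<bar>(A *v (y - b)) $ i\<bar> \<le> 2395 * (1 + R) powr (1/4)" for i
    proof -
      have "(A *v (y - b)) $ i = a $ i \<bullet> (y - bJ)"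
        unfolding matrix_vector_mul_component inner_vec_def
        by (intro sum.cong refl) (auto simp: a_def bJ_def y_out)
      also have "\<bar>\<dots>\<bar> \<le> budget (Suc K) + 2"
        using \<open>near x y\<close> y_alive by (intro good_discrepancy_le[OF Ss(4)]) (auto simp: x_def)
      also have "\<dots> \<le> 2395 * (1 + R) powr (1/4)"
        using sum_B_par_le[OF R, of "Suc K"] by (simp add: budget_def)
      finally show ?thesis .
    qed
    then have inf: "infnorm (A *v (y - b)) \<le> 2395 * (1 + R) powr (1/4)" by (rule infnorm_le_cart)
    have "y $ j = b $ j" if "\<bar>b $ j\<bar> = 1" for j
      using that by (intro y_out) (simp add: J_def fractional_def)
    then have "good_rounding A b R y"
      using y1 inf Ss(5) by (simp add: good_rounding_def frac x_def J_def)
    moreover have "trajectory J a bJ R K \<gamma> Ss" using Ss by (simp add: trajectory_def)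
    ultimately show ?thesis
      using \<gamma>0(1,2) Ss(5) unfolding y_def x_def q_def
      by (intro exI[of _ \<gamma>] exI[of _ Ss] conjI ballI) (use \<gamma>0(3) in auto)
  qed
  have "\<exists>y. good_rounding A b R y"
  proof (cases "q \<le> 8")
    case False
    \<comment> \<open>\<open>s_par (q + 4)\<close> equals 15/28 divided by \<open>2 ^ q\<close>, so
      the claim reduces to \<open>15 * q \<le> 28 * 2 ^ q\<close>.\<close>
    have "s_par (q + 3 + 1) \<le> 1 / real q"
    proof -
      have "real q \<le> 2 ^ q" using less_exp[of q] by (metis less_imp_le of_nat_le_iff of_nat_numeral of_nat_power)
      then have "15 * real q \<le> 28 * 2 ^ q" using zero_le_power[of "2 :: real" q] by linarith
      then show ?thesis using False by (simp add: s_par_def field_simps power_add)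
    qed
    then show ?thesis using main[of "q + 3"] False by (meson not_le)
  qed (use trivial in blast)
  then show ?thesis using trivial main by blast
qed

end
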